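(* For any $k$, the function $\mathrm{csm}_k:\mathrm{Mat}_{n+1}\to\mathcal Z_k(\mathbb R^{n+1}/\mathbf 1)$ sending $M$ to $\mathrm{csm}_k(M)$ is a valuation under matroid polytope subdivisions: for every $M\in\mathrm{Mat}_{n+1}$ and every matroid polytope subdivision $\mathcal S$ of $Q=Q(M)$, $$\mathrm{csm}_k(M)=\sum_{F\in\mathrm{int}(\mathcal S)}(-1)^{\dim Q-\dim F}\,\mathrm{csm}_k(M_F).$$
   Context: $\mathrm{Mat}_{n+1}$ is the set of matroids on $E=\{0,\dots,n\}$. The matroid polytope of $M$ is $Q(M)=\mathrm{conv}\{\mathbf e_B: B\text{ a basis of }M\}\subseteq\mathbb R^{n+1}$, where $\mathbf e_B=\sum_{i\in B}\mathbf e_i$. A subdivision of a $D$-dimensional polytope $Q$ is a collection of $D$-dimensional polytopes $P_1,\dots,P_m$ with vertices among those of $Q$, whose union is $Q$, and such that any nonempty $P_i\cap P_j$ is a proper face of both; it is a matroid polytope subdivision if every $P_i$ is a matroid polytope. Faces of $\mathcal S$ are faces of the $P_i$; $\mathrm{int}(\mathcal S)$ is the set of faces of $\mathcal S$ not contained in the boundary of $Q$. Each such face $F$ is a matroid polytope, and $M_F$ denotes the matroid with $Q(M_F)=F$. $\mathcal Z_k(\mathbb R^{n+1}/\mathbf 1)$ is the group of $k$-dimensional fan tropical cycles in $\mathbb R^{n+1}/\mathbb R(1,\dots,1)$: balanced rational weighted pure $k$-dimensional fans modulo the equivalence identifying fans with the same support (union of nonzero-weight top cones) and agreeing weights on overlapping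 top cones; addition is union of supports with addition of weights. $\mathrm{csm}_k(M)$: for loopless $M$ of rank $d+1$, the $k$-skeleton of the Bergman fan $\mathcal B(M)$ (cones spanned by $\mathbf e_{F_1},\dots,\mathbf e_{F_k}$ modulo $\mathbf 1$ for chains of flats $\emptyset=F_0\subsetneq F_1\subsetneq\dots\subsetneq F_k\subsetneq F_{k+1}=E$) with weights $(-1)^{d-k}\prod_{i=0}^k\beta(M|F_{i+1}/F_i)$, where $\beta(N)=(-1)^{r(N)}\sum_F\mu(\emptyset,F)r(F)$ for loopless $N$ and $\beta(N)=0$ if $N$ has a loop; $\mathrm{csm}_k(M)=\emptyset$ (the zero cycle) if $M$ has a loop. *)

theory Defs
  imports "HOL-Analysis.Analysis" "HOL-Algebra.FiniteProduct"
begin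

section \<open>Matroids\<close>

record 'a matroid =
  ground :: "'a set"
  bases :: "'a set set"

definition is_matroid :: "'a matroid \<Rightarrow> bool" where
  "is_matroid M \<longleftrightarrow>
     finite (ground M) \<and> bases M \<noteq> {} \<and> (\<forall>B\<in>bases M. B \<subseteq> ground M) \<and>
     (\<forall>A\<in>bases M. \<forall>B\<in>bases M. \<forall>x\<in>A - B. \<exists>y\<in>B - A. insert y (A - {x}) \<in> bases M)"

text \<open>The ground set \<open>{0,\<dots>,n}\<close> is the universe of an arbitrary finite type, with
  \<open>CARD('e) = n + 1\<close>. Minors live on subsets of it.\<close>

definition Mat :: "'e::finite matroid set" where
  "Mat = {M. is_matroid M \<and> ground M = UNIV}"

definition rank_on :: "'a matroid \<Rightarrow> 'a set \<Rightarrow> nat" where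
  "rank_on M A = Max ((\<lambda>B. card (A \<inter> B)) ` bases M)"

definition matroid_rank :: "'a matroid \<Rightarrow> nat" where
  "matroid_rank M = rank_on M (ground M)"

definition flats :: "'a matroid \<Rightarrow> 'a set set" where
  "flats M = {F. F \<subseteq> ground M \<and> (\<forall>x\<in>ground M - F. rank_on M F < rank_on M (insert x F))}"

definition loopless :: "'a matroid \<Rightarrow> bool" where
  "loopless M \<longleftrightarrow> (\<forall>x\<in>ground M. \<exists>B\<in>bases M. x \<in> B)"

definition restriction :: "'a matroid \<Rightarrow> 'a set \<Rightarrow> 'a matroid" where
  "restriction M A =
     \<lparr>ground = A, bases = {A \<inter> B |B. B \<in> bases M \<and> card (A \<inter> B) = rank_on M A}\<rparr>"

definition contraction :: "'a matroid \<Rightarrow> 'a set \<Rightarrow> 'a matroid" where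
  "contraction M A =
     \<lparr>ground = ground M - A, bases = {B - A |B. B \<in> bases M \<and> card (A \<inter> B) = rank_on M A}\<rparr>"

text \<open>The Moebius function of a family of finite sets ordered by inclusion.\<close>

function moebius :: "'a set set \<Rightarrow> 'a set \<Rightarrow> 'a set \<Rightarrow> int" where
  "moebius P A B =
     (if A = B then 1
      else if finite B \<and> A \<subset> B then - (\<Sum>C\<in>{C \<in> P. A \<subseteq> C \<and> C \<subset> B}. moebius P A C)
      else 0)"
  by pat_completeness auto
termination
  by (relation "Wellfounded.measure (\<lambda>(P, A, B). card B)") (auto intro: psubset_card_mono)

declare moebius.simps [simp del]

definition beta_invariant :: "'a matroid \<Rightarrow> int" where
  "beta_invariant N =
     (if loopless N
      then (-1) ^ matroid_rank N * (\<Sum>F\<in>flats N. moebius (flats N) {} F * int (rank_on N F))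
      else 0)"

section \<open>Matroid polytopes and their subdivisions\<close>

definition e_vec :: "'e set \<Rightarrow> real ^ 'e::finite" where
  "e_vec B = (\<Sum>i\<in>B. axis i 1)"

definition matroid_polytope :: "'e::finite matroid \<Rightarrow> (real ^ 'e) set" where
  "matroid_polytope M = convex hull (e_vec ` bases M)"

definition polytope_subdivision :: "'v::euclidean_space set set \<Rightarrow> 'v set \<Rightarrow> bool" where
  "polytope_subdivision S Q \<longleftrightarrow>
     finite S \<and>
     (\<forall>P\<in>S. polytope P \<and> aff_dim P = aff_dim Q \<and>
            {v. v extreme_point_of P} \<subseteq> {v. v extreme_point_of Q}) \<and>
     \<Union>S = Q \<and>
     (\<forall>P\<in>S. \<forall>P'\<in>S. P \<noteq> P' \<and> P \<inter> P' \<noteq> {} \<longrightarrow>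
        (P \<inter> P') face_of P \<and> P \<inter> P' \<noteq> P \<and> (P \<inter> P') face_of P' \<and> P \<inter> P' \<noteq> P')"

definition matroid_subdivision :: "(real ^ 'e::finite) set set \<Rightarrow> (real ^ 'e) set \<Rightarrow> bool" where
  "matroid_subdivision S Q \<longleftrightarrow>
     polytope_subdivision S Q \<and> (\<forall>P\<in>S. \<exists>N\<in>Mat. P = matroid_polytope N)"

text \<open>The empty face is contained in the boundary, hence never interior.\<close>

definition interior_faces :: "'v::euclidean_space set set \<Rightarrow> 'v set \<Rightarrow> 'v set set" where
  "interior_faces S Q = {F. (\<exists>P\<in>S. F face_of P) \<and> \<not> F \<subseteq> rel_frontier Q}"

definition matroid_of :: "(real ^ 'e::finite) set \<Rightarrow> 'e matroid" where
  "matroid_of F = (THE M. M \<in> Mat \<and> matroid_polytope M = F)"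

section \<open>The quotient of \<open>\<real>\<^sup>n\<^sup>+\<^sup>1\<close> by \<open>(1,\<dots>,1)\<close>\<close>

quotient_type 'e tspace = "real ^ 'e::finite" / "\<lambda>x y. \<exists>c. \<forall>i. x $ i = y $ i + c"
  morphisms rep_tspace mod_one
proof (rule equivpI)
  show "reflp (\<lambda>x y :: real ^ 'e. \<exists>c. \<forall>i. x $ i = y $ i + c)"
    by (auto intro!: reflpI exI[of _ 0])
  show "symp (\<lambda>x y :: real ^ 'e. \<exists>c. \<forall>i. x $ i = y $ i + c)"
  proof (rule sympI, elim exE)
    fix x y :: "real ^ 'e" and c
    assume "\<forall>i. x $ i = y $ i + c"
    then show "\<exists>c. \<forall>i. y $ i = x $ i + c" by (auto intro!: exI[of _ "- c"])
  qed
  show "transp (\<lambda>x y :: real ^ 'e. \<exists>c. \<forall>i. x $ i = y $ i + c)"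
  proof (rule transpI, elim exE)
    fix x y z :: "real ^ 'e" and c d
    assume "\<forall>i. x $ i = y $ i + c" "\<forall>i. y $ i = z $ i + d"
    then show "\<exists>c. \<forall>i. x $ i = z $ i + c" by (auto intro!: exI[of _ "d + c"])
  qed
qed

instantiation tspace :: (finite) real_vector
begin

lift_definition zero_tspace :: "'a tspace" is "0" .

lift_definition plus_tspace :: "'a tspace \<Rightarrow> 'a tspace \<Rightarrow> 'a tspace" is "(+)"
proof (elim exE)
  fix x x' y y' :: "real ^ 'a" and c d
  assume "\<forall>i. x $ i = x' $ i + c" "\<forall>i. y $ i = y' $ i + d"
  then show "\<exists>c. \<forall>i. (x + y) $ i = (x' + y') $ i + c" by (auto intro!: exI[of _ "c + d"])
qed

lift_definition uminus_tspace :: "'a tspace \<Rightarrow> 'a tspace" is "uminus"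
proof (elim exE)
  fix x y :: "real ^ 'a" and c
  assume "\<forall>i. x $ i = y $ i + c"
  then show "\<exists>c. \<forall>i. (- x) $ i = (- y) $ i + c" by (auto intro!: exI[of _ "- c"])
qed

lift_definition minus_tspace :: "'a tspace \<Rightarrow> 'a tspace \<Rightarrow> 'a tspace" is "(-)"
proof (elim exE)
  fix x x' y y' :: "real ^ 'a" and c d
  assume "\<forall>i. x $ i = x' $ i + c" "\<forall>i. y $ i = y' $ i + d"
  then show "\<exists>c. \<forall>i. (x - y) $ i = (x' - y') $ i + c" by (auto intro!: exI[of _ "c - d"])
qed

lift_definition scaleR_tspace :: "real \<Rightarrow> 'a tspace \<Rightarrow> 'a tspace" is "scaleR"
proof (elim exE)
  fix a :: real and x y :: "real ^ 'a" and c
  assume "\<forall>i. x $ i = y $ i + c"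
  then show "\<exists>c. \<forall>i. (a *\<^sub>R x) $ i = (a *\<^sub>R y) $ i + c"
    by (auto intro!: exI[of _ "a * c"] simp: algebra_simps)
qed

instance
  by standard (transfer; auto intro!: exI[of _ 0] simp: algebra_simps)+

end

definition tlattice :: "'e::finite tspace set" where
  "tlattice = {mod_one x |x. \<forall>i. x $ i \<in> \<int>}"

section \<open>Fan tropical cycles\<close>

text \<open>Everything in this section is relative to a lattice \<open>L\<close> in a real vector space. A weighted
  fan is a fan together with a weight function, of which only the values on the cones of
  dimension \<open>k\<close> matter.\<close>

type_synonym 'v wfan = "'v set set \<times> ('v set \<Rightarrow> int)"

definition rational_cone :: "'v::real_vector set \<Rightarrow> 'v set \<Rightarrow> bool" where
  "rational_cone L \<sigma> \<longleftrightarrow> (\<exists>G. finite G \<and> G \<subseteq> L \<and> \<sigma> = convex_cone hull G)"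

definition rational_fan :: "'v::real_vector set \<Rightarrow> 'v set set \<Rightarrow> bool" where
  "rational_fan L \<Sigma> \<longleftrightarrow>
     finite \<Sigma> \<and> (\<forall>\<sigma>\<in>\<Sigma>. rational_cone L \<sigma>) \<and>
     (\<forall>\<sigma>\<in>\<Sigma>. \<forall>\<tau>. \<tau> face_of \<sigma> \<and> \<tau> \<noteq> {} \<longrightarrow> \<tau> \<in> \<Sigma>) \<and>
     (\<forall>\<sigma>\<in>\<Sigma>. \<forall>\<tau>\<in>\<Sigma>. (\<sigma> \<inter> \<tau>) face_of \<sigma> \<and> (\<sigma> \<inter> \<tau>) face_of \<tau>)"

definition top_cones :: "nat \<Rightarrow> 'v::real_vector set set \<Rightarrow> 'v set set" where
  "top_cones k \<Sigma> = {\<sigma> \<in> \<Sigma>. dim \<sigma> = k}"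

definition pure_fan :: "nat \<Rightarrow> 'v::real_vector set set \<Rightarrow> bool" where
  "pure_fan k \<Sigma> \<longleftrightarrow> (\<forall>\<tau>\<in>\<Sigma>. \<exists>\<sigma>\<in>top_cones k \<Sigma>. \<tau> \<subseteq> \<sigma>)"

text \<open>For a facet \<open>\<tau>\<close> of \<open>\<sigma>\<close>: a vector of \<open>\<sigma>\<close> which together with the lattice of \<open>\<tau>\<close> generates
  the lattice of \<open>\<sigma>\<close>. It is unique up to the lattice of \<open>\<tau>\<close>.\<close>

definition lattice_normal :: "'v::real_vector set \<Rightarrow> 'v set \<Rightarrow> 'v set \<Rightarrow> 'v \<Rightarrow> bool" where
  "lattice_normal L \<tau> \<sigma> u \<longleftrightarrow>
     u \<in> \<sigma> \<and> L \<inter> span \<sigma> = {of_int m *\<^sub>R u + t |m t. t \<in> L \<inter> span \<tau>}"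

definition balanced :: "'v::real_vector set \<Rightarrow> nat \<Rightarrow> 'v wfan \<Rightarrow> bool" where
  "balanced L k = (\<lambda>(\<Sigma>, \<omega>). \<forall>\<tau>\<in>\<Sigma>. dim \<tau> + 1 = k \<longrightarrow>
     (\<exists>u. (\<forall>\<sigma>\<in>{\<sigma> \<in> top_cones k \<Sigma>. \<tau> \<subseteq> \<sigma>}. lattice_normal L \<tau> \<sigma> (u \<sigma>)) \<and>
          (\<Sum>\<sigma>\<in>{\<sigma> \<in> top_cones k \<Sigma>. \<tau> \<subseteq> \<sigma>}. of_int (\<omega> \<sigma>) *\<^sub>R u \<sigma>) \<in> span \<tau>))"

definition tropical_fan :: "'v::real_vector set \<Rightarrow> nat \<Rightarrow> 'v wfan \<Rightarrow> bool" where
  "tropical_fan L k X \<longleftrightarrow>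
     rational_fan L (fst X) \<and> pure_fan k (fst X) \<and> balanced L k X"

definition fan_support :: "nat \<Rightarrow> 'v::real_vector wfan \<Rightarrow> 'v set" where
  "fan_support k = (\<lambda>(\<Sigma>, \<omega>). \<Union>{\<sigma> \<in> top_cones k \<Sigma>. \<omega> \<sigma> \<noteq> 0})"

definition fan_equiv :: "'v::real_vector set \<Rightarrow> nat \<Rightarrow> ('v wfan \<times> 'v wfan) set" where
  "fan_equiv L k = {(X, Y). tropical_fan L k X \<and> tropical_fan L k Y \<and>
     fan_support k X = fan_support k Y \<and>
     (\<forall>\<sigma>\<in>top_cones k (fst X). \<forall>\<tau>\<in>top_cones k (fst Y). dim (\<sigma> \<inter> \<tau>) = k \<longrightarrow> snd X \<sigma> = snd Y \<tau>)}"

definition cycle_class :: "'v::real_vector set \<Rightarrow> nat \<Rightarrow> 'v wfan \<Rightarrow> 'v wfan set" where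
  "cycle_class L k X = fan_equiv L k `` {X}"

text \<open>Weights may vanish, so any two cycles have representatives on a common underlying fan that
  covers the union of their supports; there the weights are added.\<close>

definition cycle_add ::
    "'v::real_vector set \<Rightarrow> nat \<Rightarrow> 'v wfan set \<Rightarrow> 'v wfan set \<Rightarrow> 'v wfan set" where
  "cycle_add L k A B =
     (\<Union>{cycle_class L k (\<Sigma>, \<lambda>\<sigma>. \<omega> \<sigma> + \<omega>' \<sigma>) |\<Sigma> \<omega> \<omega>'. (\<Sigma>, \<omega>) \<in> A \<and> (\<Sigma>, \<omega>') \<in> B})"

definition zero_cycle :: "'v::real_vector set \<Rightarrow> nat \<Rightarrow> 'v wfan set" where
  "zero_cycle L k = cycle_class L k ({}, \<lambda>_. 0)"

text \<open>As the group structures of HOL-Algebra are multiplicative, addition of cycles is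
  \<open>\<otimes>\<close>, multiples are powers \<open>[^]\<close>, and sums are \<open>finprod\<close>.\<close>

definition cycle_group :: "'v::real_vector set \<Rightarrow> nat \<Rightarrow> 'v wfan set monoid" where
  "cycle_group L k =
     \<lparr>carrier = {X. tropical_fan L k X} // fan_equiv L k,
      monoid.mult = cycle_add L k, one = zero_cycle L k\<rparr>"

abbreviation Z_group :: "nat \<Rightarrow> 'e::finite tspace wfan set monoid" where
  "Z_group k \<equiv> cycle_group tlattice k"

section \<open>Chern-Schwartz-MacPherson cycles of matroids\<close>

text \<open>The list \<open>[F\<^sub>1, \<dots>, F\<^sub>k]\<close> stands for the chain
  \<open>\<emptyset> = F\<^sub>0 \<subset> F\<^sub>1 \<subset> \<dots> \<subset> F\<^sub>k \<subset> F\<^sub>k\<^sub>+\<^sub>1 = E\<close>.\<close>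

definition flat_chain :: "'a matroid \<Rightarrow> 'a set list \<Rightarrow> bool" where
  "flat_chain M Fs \<longleftrightarrow> set Fs \<subseteq> flats M \<and> sorted_wrt (\<subset>) ({} # Fs @ [ground M])"

definition chain_cone :: "'e::finite set list \<Rightarrow> 'e tspace set" where
  "chain_cone Fs = convex_cone hull ((\<lambda>F. mod_one (e_vec F)) ` set Fs)"

definition bergman_skeleton :: "nat \<Rightarrow> 'e::finite matroid \<Rightarrow> 'e tspace set set" where
  "bergman_skeleton k M = {chain_cone Fs |Fs. flat_chain M Fs \<and> length Fs \<le> k}"

definition chain_weight :: "'a matroid \<Rightarrow> 'a set list \<Rightarrow> int" where
  "chain_weight M Fs =
     (let G = {} # Fs @ [ground M]; k = length Fs in
      (-1) ^ (matroid_rank M - 1 - k) *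
      (\<Prod>i=0..k. beta_invariant (contraction (restriction M (G ! (i + 1))) (G ! i))))"

definition csm_weight :: "nat \<Rightarrow> 'e::finite matroid \<Rightarrow> 'e tspace set \<Rightarrow> int" where
  "csm_weight k M \<sigma> =
     chain_weight M (THE Fs. flat_chain M Fs \<and> length Fs = k \<and> chain_cone Fs = \<sigma>)"

text \<open>For a loopless matroid of rank \<open>d + 1\<close> the Bergman fan has dimension \<open>d\<close>, so its
  \<open>k\<close>-skeleton is a \<open>k\<close>-dimensional fan only for \<open>k \<le> d\<close>; beyond that the cycle is zero.\<close>

definition csm :: "nat \<Rightarrow> 'e::finite matroid \<Rightarrow> 'e tspace wfan set" where
  "csm k M =
     (if loopless M \<and> k < matroid_rank M
      then cycle_class tlattice k (bergman_skeleton k M, csm_weight k M)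
      else zero_cycle tlattice k)"

end

theory Submission
  imports Defs
begin

text \<open>Write \<open>S(F, G) = (\<Sum>A. F \<subseteq> A \<subseteq> G. (-1)\<^sup>|\<^sup>A\<^sup>| r(A))\<close>. Up to sign, \<open>\<beta>((M|G)/F)\<close> is \<open>S(F, G)\<close>, which
  vanishes when \<open>F\<close> is not a flat of \<open>M|G\<close>. Hence \<open>csm\<^sub>k(M)\<close> is carried by the \<open>k\<close>-skeleton of the
  braid fan, where a chain \<open>F\<^sub>1 \<subset> \<dots> \<subset> F\<^sub>k\<close> of arbitrary subsets has weight \<open>\<plusminus> \<Prod>S(F\<^sub>i, F\<^sub>i\<^sub>+\<^sub>1)\<close> with a
  sign independent of \<open>M\<close>. It is balanced because the sum of \<open>(-1)\<^sup>|\<^sup>F\<^sup>| S(G, F) S(F, H)\<close> over the \<open>F\<close>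
  between \<open>G\<close> and \<open>H\<close> that contain \<open>e\<close> does not depend on \<open>e \<in> H - G\<close>.

  Expanding the product, the weight becomes a combination of products \<open>r(A\<^sub>0) \<cdots> r(A\<^sub>k)\<close> over chains of
  sets, hence of truth values of \<open>r(A\<^sub>0) \<ge> s\<^sub>0 \<and> \<dots> \<and> r(A\<^sub>k) \<ge> s\<^sub>k\<close>. By the greedy property this condition
  says that \<open>Q(M)\<close> meets a convex open set, and for such a set the Euler relation over the interior
  faces of a subdivision is additivity of the Euler characteristic with compact support, applied to
  the partition of the relative interior of \<open>Q(M)\<close> into relatively open cells.\<close>

section \<open>Bases and rank\<close>

text \<open>Tropical cycles are classes of fans, and a sum is defined through representatives on a
  common fan. Instead of refining arbitrary fans, every \<open>csm k M\<close> is given a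
  representative on one fan that depends only on \<open>k\<close> and the ground set, so that the
  claim becomes an identity of integer weights, one chain at a time. Then every chain of subsets
  must carry a weight; \<open>S(F, G)\<close> makes sense for any pair of sets, and its vanishing
  also covers matroids with loops and values of \<open>k\<close> beyond the dimension. A rank
  \<open>r(A)\<close> is the number of thresholds \<open>s\<close> in \<open>1..n+1\<close> with
  \<open>s \<le> r(A)\<close>, which turns products of ranks into truth values. The condition
  \<open>r(A) \<ge> s\<close> is tested by \<open>x(A) > s - 1\<close> at a point \<open>x\<close>
  of the polytope: the inequality is strict because an open set meeting a face also meets its
  relative interior. Nestedness matters: one basis attains all ranks of a chain, whereas for sets
  that are not nested the point \<open>x\<close> may fail to exist.\<close>

lemma card_bases_le:
  assumes M: "is_matroid M" and "A \<in> bases M" "B \<in> bases M"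
  shows "card A \<le> card B"
  using assms(2)
proof (induction "card (A - B)" arbitrary: A rule: less_induct)
  case less
  have fin: "finite X" if "X \<in> bases M" for X
    using M that unfolding is_matroid_def by (meson finite_subset)
  show ?case
  proof (cases "A \<subseteq> B")
    case True
    then show ?thesis using fin assms(3) card_mono by blast
  next
    case False
    then obtain x where x: "x \<in> A - B" by blast
    then obtain y where y: "y \<in> B - A" "insert y (A - {x}) \<in> bases M"
      using M less.prems assms(3) unfolding is_matroid_def by blast
    have "insert y (A - {x}) - B = (A - B) - {x}" using y by auto
    then have "card (insert y (A - {x}) - B) < card (A - B)"
      using x fin[OF less.prems] by (metis card_Diff1_less finite_Diff)
    then have "card (insert y (A - {x})) \<le> card B" using less.hyps y by blast
    moreover have "card (insert y (A - {x})) = card A"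
      using x y fin[OF less.prems]
      by (metis DiffD1 DiffD2 card.remove card_insert_disjoint finite_Diff)
    ultimately show ?thesis by simp
  qed
qed

lemma card_bases_eq:
  assumes "is_matroid M" "A \<in> bases M" "B \<in> bases M"
  shows "card A = card B"
  using assms card_bases_le by (metis antisym)

text \<open>Only elements outside \<open>J \<union> B\<close> are exchanged away, so
  \<open>J\<close> stays in the basis while the rest moves into \<open>B\<close>. This serves as
  augmentation of independent sets.\<close>

lemma basis_extend:
  assumes M: "is_matroid M" and A: "A \<in> bases M" "J \<subseteq> A" and B: "B \<in> bases M"
  shows "\<exists>B'\<in>bases M. J \<subseteq> B' \<and> B' \<subseteq> J \<union> B"
  using A
proof (induction "card (A - (J \<union> B))" arbitrary: A rule: less_induct)
  case less
  have fin: "finite X" if "X \<in> bases M" for X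
    using M that unfolding is_matroid_def by (meson finite_subset)
  show ?case
  proof (cases "A \<subseteq> J \<union> B")
    case True
    then show ?thesis using less.prems by blast
  next
    case False
    then obtain x where x: "x \<in> A" "x \<notin> J" "x \<notin> B" by blast
    then obtain y where y: "y \<in> B - A" "insert y (A - {x}) \<in> bases M"
      using M less.prems B unfolding is_matroid_def by blast
    have "insert y (A - {x}) - (J \<union> B) = (A - (J \<union> B)) - {x}" using y by auto
    then have "card (insert y (A - {x}) - (J \<union> B)) < card (A - (J \<union> B))"
      using x fin[OF less.prems(1)] by (metis DiffI UnE card_Diff1_less finite_Diff)
    moreover have "J \<subseteq> insert y (A - {x})" using x less.prems by blast
    ultimately show ?thesis using less.hyps y by blast
  qed
qed

text \<open>Exchanging in both bases at once keeps the sum of the two indicator vectors. This is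
  what makes every face of a matroid polytope a matroid polytope.\<close>

lemma symmetric_exchange:
  assumes M: "is_matroid M" and A: "A \<in> bases M" and B: "B \<in> bases M" and x: "x \<in> A - B"
  shows "\<exists>y\<in>B - A. insert y (A - {x}) \<in> bases M \<and> insert x (B - {y}) \<in> bases M"
proof -
  have fin: "finite X" if "X \<in> bases M" for X
    using M that unfolding is_matroid_def by (meson finite_subset)
  \<comment> \<open>\<open>I\<close> is the fundamental circuit of \<open>x\<close> with respect to
    \<open>B\<close>, with \<open>x\<close> removed. As \<open>insert x I\<close> is dependent, a
    basis \<open>B1\<close> between \<open>I\<close> and \<open>I \<union> A\<close> has to avoid
    \<open>x\<close>.\<close>
  define I where "I = {y \<in> B. insert x (B - {y}) \<in> bases M}"
  have xB: "x \<notin> B" using x by simp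
  show ?thesis
  proof (rule ccontr)
    assume no: "\<not> ?thesis"
    have card_eq: "card X = card A" if "X \<in> bases M" for X
      using card_bases_eq[OF M that A] .
    have IB: "I \<subseteq> B" unfolding I_def by blast
    obtain B1 where B1: "B1 \<in> bases M" "I \<subseteq> B1" "B1 \<subseteq> I \<union> A"
      using basis_extend[OF M B IB A] by blast
    show False
    proof (cases "x \<in> B1")
      case True
      then obtain B' where B': "B' \<in> bases M" "insert x I \<subseteq> B'" "B' \<subseteq> insert x B"
        using basis_extend[OF M B1(1) _ B, of "insert x I"] B1 IB True
        by (metis Un_insert_left insert_subset sup.absorb2)
      have "B - B' \<noteq> {}"
      proof
        assume "B - B' = {}"
        then have "insert x B \<subseteq> B'" using B' by blast
        then have "card (insert x B) \<le> card B'" using fin B'(1) by (simp add: card_mono)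
        then show False using card_eq[OF B'(1)] card_eq[OF B] xB fin[OF B] by simp
      qed
      then obtain y where y: "y \<in> B" "y \<notin> B'" by blast
      have "B' \<subseteq> insert x (B - {y})" using B' y by blast
      moreover have "card (insert x (B - {y})) = card B'"
        using card_eq[OF B'(1)] card_eq[OF B] xB y fin[OF B]
        by (metis Diff_iff card.remove card_insert_disjoint finite_Diff)
      ultimately have "B' = insert x (B - {y})"
        using fin[OF B] by (simp add: card_subset_eq)
      then have "y \<in> I" using y B' unfolding I_def by simp
      then show False using y B' by blast
    next
      case False
      \<comment> \<open>The element that completes \<open>A - {x}\<close> comes from
        \<open>B1\<close> and is outside \<open>A\<close>, hence it lies in
        \<open>I\<close>.\<close>
      obtain B2 where B2: "B2 \<in> bases M" "A - {x} \<subseteq> B2" "B2 \<subseteq> (A - {x}) \<union> B1"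
        using basis_extend[OF M A _ B1(1), of "A - {x}"] by blast
      have "B2 \<noteq> A - {x}"
        using card_eq[OF B2(1)] x fin[OF A] by (metis DiffD1 card_Diff1_less less_irrefl)
      then obtain y where y: "y \<in> B2" "y \<notin> A - {x}" using B2 by blast
      then have yI: "y \<in> I" "y \<noteq> x" using B2 B1 False by blast+
      then have "y \<in> B - A" using y IB by blast
      have "insert y (A - {x}) \<subseteq> B2" using B2 y by blast
      moreover have "card (insert y (A - {x})) = card B2"
        using card_eq[OF B2(1)] x y fin[OF A]
        by (metis DiffD1 card.remove card_insert_disjoint finite_Diff)
      ultimately have "insert y (A - {x}) = B2"
        using fin[OF B2(1)] by (simp add: card_subset_eq)
      then have "insert y (A - {x}) \<in> bases M" using B2 by simp
      then show False using no \<open>y \<in> B - A\<close> yI unfolding I_def by blast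
    qed
  qed
qed

section \<open>The rank function and its greedy property\<close>

lemma is_matroid_finite:
  assumes "is_matroid M"
  shows "finite (ground M)" "bases M \<noteq> {}" "finite (bases M)"
    "B \<in> bases M \<Longrightarrow> finite B" "B \<in> bases M \<Longrightarrow> B \<subseteq> ground M"
proof -
  show *: "finite (ground M)" "bases M \<noteq> {}" "B \<in> bases M \<Longrightarrow> B \<subseteq> ground M"
    using assms unfolding is_matroid_def by auto
  then show "B \<in> bases M \<Longrightarrow> finite B" by (simp add: finite_subset)
  have "bases M \<subseteq> Pow (ground M)" using assms unfolding is_matroid_def by auto
  then show "finite (bases M)" using * by (simp add: finite_subset)
qed

lemma rank_ge: "is_matroid M \<Longrightarrow> B \<in> bases M \<Longrightarrow> card (A \<inter> B) \<le> rank_on M A"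
  unfolding rank_on_def using is_matroid_finite(3) by (intro Max_ge) auto

lemma rank_attained:
  assumes "is_matroid M"
  obtains B where "B \<in> bases M" "card (A \<inter> B) = rank_on M A"
proof -
  have "rank_on M A \<in> (\<lambda>B. card (A \<inter> B)) ` bases M"
    unfolding rank_on_def using is_matroid_finite[OF assms] by (intro Max_in) auto
  then show ?thesis using that by force
qed

lemma rank_on_empty: "is_matroid M \<Longrightarrow> rank_on M {} = 0"
  by (metis rank_attained card.empty inf_bot_left)

lemma rank_on_ground:
  "is_matroid M \<Longrightarrow> B \<in> bases M \<Longrightarrow> rank_on M (ground M) = card B"
  by (metis rank_attained card_bases_eq inf.absorb2 is_matroid_finite(5))

text \<open>Induction from the largest member \<open>T\<close>: a basis \<open>B\<close> optimal for
  the smaller members keeps its part inside \<open>T\<close> and is completed from a basis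
  \<open>B2\<close> optimal for \<open>T\<close>. Outside \<open>T\<close> the result is contained
  in \<open>B2\<close>, so by equal cardinality it has at least as many elements inside
  \<open>T\<close>.\<close>

lemma chain_basis:
  assumes M: "is_matroid M" and "finite \<A>" "\<And>X Y. X \<in> \<A> \<Longrightarrow> Y \<in> \<A> \<Longrightarrow> X \<subseteq> Y \<or> Y \<subseteq> X"
  shows "\<exists>B\<in>bases M. \<forall>X\<in>\<A>. card (X \<inter> B) = rank_on M X"
  using assms(2,3)
proof (induction "card \<A>" arbitrary: \<A>)
  case 0
  then show ?case using is_matroid_finite(2)[OF M] by auto
next
  case (Suc n)
  then have ne: "\<A> \<noteq> {}" by auto
  obtain T where "T \<in> \<A>" "\<forall>X\<in>\<A>. T \<subseteq> X \<longrightarrow> T = X"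
    using finite_has_maximal[OF Suc.prems(1) ne] by auto
  then have T: "T \<in> \<A>" "\<And>X. X \<in> \<A> \<Longrightarrow> X \<subseteq> T" using Suc.prems(2) by blast+
  have "n = card (\<A> - {T})" using Suc T by simp
  then obtain B where B: "B \<in> bases M" "\<forall>X\<in>\<A> - {T}. card (X \<inter> B) = rank_on M X"
    using Suc.hyps(1)[of "\<A> - {T}"] Suc.prems by auto
  obtain B2 where B2: "B2 \<in> bases M" "card (T \<inter> B2) = rank_on M T"
    using rank_attained[OF M] by blast
  obtain B' where B': "B' \<in> bases M" "B \<inter> T \<subseteq> B'" "B' \<subseteq> (B \<inter> T) \<union> B2"
    using basis_extend[OF M B(1) _ B2(1), of "B \<inter> T"] by auto
  have fin: "finite B'" "finite B2" using is_matroid_finite(4)[OF M] B' B2 by auto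
  have "card (B' - T) \<le> card (B2 - T)" using B' fin by (intro card_mono) auto
  moreover have "card B' = card B2" using card_bases_eq[OF M] B' B2 by blast
  moreover have "card B' = card (B' \<inter> T) + card (B' - T)" "card B2 = card (B2 \<inter> T) + card (B2 - T)"
    using fin by (metis card_Int_Diff)+
  ultimately have "card (B2 \<inter> T) \<le> card (B' \<inter> T)" by linarith
  then have "card (T \<inter> B') = rank_on M T"
    using rank_ge[OF M B'(1), of T] B2 by (simp add: Int_commute)
  moreover have "card (X \<inter> B') = rank_on M X" if "X \<in> \<A> - {T}" for X
  proof -
    have "X \<inter> B \<subseteq> X \<inter> B'" using T that B' by blast
    then have "card (X \<inter> B) \<le> card (X \<inter> B')" using fin by (intro card_mono) auto
    then show ?thesis using rank_ge[OF M B'(1), of X] B that by force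
  qed
  ultimately show ?case using B'(1) by blast
qed

lemma rank_mono: "is_matroid M \<Longrightarrow> A \<subseteq> B \<Longrightarrow> rank_on M A \<le> rank_on M B"
proof -
  assume M: "is_matroid M" and "A \<subseteq> B"
  obtain X where X: "X \<in> bases M" "card (A \<inter> X) = rank_on M A" using rank_attained[OF M] by blast
  have "card (A \<inter> X) \<le> card (B \<inter> X)"
    using \<open>A \<subseteq> B\<close> is_matroid_finite(4)[OF M X(1)] by (intro card_mono) auto
  then show ?thesis using X rank_ge[OF M X(1), of B] by linarith
qed

lemma rank_insert_le:
  assumes M: "is_matroid M"
  shows "rank_on M (insert x A) \<le> rank_on M A + 1"
proof -
  obtain X where X: "X \<in> bases M" "card (insert x A \<inter> X) = rank_on M (insert x A)"
    using rank_attained[OF M] by blast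
  have fin: "finite X" using is_matroid_finite(4)[OF M X(1)] .
  have "card (insert x A \<inter> X) \<le> card (insert x (A \<inter> X))" using fin by (intro card_mono) auto
  also have "\<dots> \<le> card (A \<inter> X) + 1" using fin by (simp add: card_insert_if)
  finally show ?thesis using X rank_ge[OF M X(1), of A] by linarith
qed

text \<open>A basis attaining the ranks of both \<open>A\<close> and \<open>insert x B\<close>
  cannot contain \<open>x\<close> unless \<open>x \<in> A\<close>, since otherwise it would give
  \<open>insert x A\<close> a larger rank than \<open>A\<close>.\<close>

lemma rank_insert_submod:
  assumes M: "is_matroid M" and "A \<subseteq> B" "rank_on M (insert x A) = rank_on M A"
  shows "rank_on M (insert x B) = rank_on M B"
proof (rule antisym)
  obtain X where X: "X \<in> bases M" "\<forall>Y\<in>{A, insert x B}. card (Y \<inter> X) = rank_on M Y"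
    using chain_basis[OF M, of "{A, insert x B}"] assms(2) by auto
  have fin: "finite X" using is_matroid_finite(4)[OF M X(1)] .
  have "card (insert x A \<inter> X) \<le> card (A \<inter> X)" using X rank_ge[OF M X(1), of "insert x A"] assms by simp
  then have "x \<in> A \<or> x \<notin> X"
    using fin by (cases "x \<in> X") (auto simp: Int_insert_left card_insert_if split: if_splits)
  then have "insert x B \<inter> X = B \<inter> X" using assms(2) by blast
  then show "rank_on M (insert x B) \<le> rank_on M B" using X rank_ge[OF M X(1), of B] by force
qed (use rank_mono[OF M] in blast)

section \<open>An Euler relation for polytope subdivisions\<close>

text \<open>The one-dimensional Euler computation. \<open>h i t\<close> is the factor by which the
  Euler number of a set changes when it is cut at level \<open>t\<close>, where the projection of
  the set is the point or open interval with ends \<open>l i\<close> and \<open>u i\<close>. The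
  jumps from \<open>t\<close> to just after \<open>t\<close> add up to 1 for points and intervals
  alike, which recovers the coefficients.\<close>

lemma sum_open_intervals_zero:
  fixes c :: "'i \<Rightarrow> int" and l u :: "'i \<Rightarrow> real"
  defines "h \<equiv> \<lambda>i t. if l i = u i then of_bool (t = l i) else - of_bool (l i < t \<and> t < u i)"
  assumes I: "finite I" and lu: "\<And>i. i \<in> I \<Longrightarrow> l i \<le> u i"
    and zero: "\<And>t. (\<Sum>i\<in>I. c i * h i t) = 0"
  shows "(\<Sum>i\<in>I. c i) = 0"
proof -
  define T where "T = l ` I \<union> u ` I"
  have T: "finite T" unfolding T_def using I by simp
  \<comment> \<open>At most half the smallest gap, so \<open>t + \<delta>\<close> stays below the
    next endpoint. The inserted 1 covers the case of a single endpoint.\<close>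
  have "\<exists>\<delta>>0. \<forall>s\<in>T. \<forall>t\<in>T. t < s \<longrightarrow> t + \<delta> < s"
  proof -
    define D where "D = (\<lambda>(s, t). (s - t) / 2) ` {(s, t) \<in> T \<times> T. t < s}"
    have D: "finite (insert 1 D)" unfolding D_def
      using T by (intro finite.insertI finite_imageI finite_subset[OF _ finite_cartesian_product[OF T T]]) auto
    have "Min (insert 1 D) > 0" using D by (auto simp: D_def)
    moreover have "t + Min (insert 1 D) < s" if "s \<in> T" "t \<in> T" "t < s" for s t
    proof -
      have "(s - t) / 2 \<in> insert 1 D" using that unfolding D_def by force
      then have "Min (insert 1 D) \<le> (s - t) / 2" using D by (intro Min_le) auto
      then show ?thesis using that by simp
    qed
    ultimately show ?thesis by blast
  qed
  then obtain \<delta> where \<delta>: "\<delta> > 0" "\<And>s t. s \<in> T \<Longrightarrow> t \<in> T \<Longrightarrow> t < s \<Longrightarrow> t + \<delta> < s" by blast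
  have jump: "(\<Sum>t\<in>T. h i t - h i (t + \<delta>)) = 1" if i: "i \<in> I" for i
  proof -
    have mem: "l i \<in> T" "u i \<in> T" using i unfolding T_def by auto
    have "h i t - h i (t + \<delta>) = of_bool (t = l i)" if t: "t \<in> T" for t
    proof (cases "l i = u i")
      case True
      have "t + \<delta> \<noteq> l i" using \<delta>(1) \<delta>(2)[OF mem(1) t] by force
      then show ?thesis using True unfolding h_def by simp
    next
      case False
      then have lt: "l i < u i" using lu[OF i] by simp
      have "(l i < t + \<delta> \<and> t + \<delta> < u i) \<longleftrightarrow> (l i \<le> t \<and> t < u i)"
        using \<delta>(1) \<delta>(2)[OF mem(1) t] \<delta>(2)[OF mem(2) t] by force
      then show ?thesis using False lt unfolding h_def by auto
    qed
    then show ?thesis using T mem by (simp add: of_bool_def sum.delta)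
  qed
  have "(\<Sum>i\<in>I. c i) = (\<Sum>i\<in>I. c i * (\<Sum>t\<in>T. h i t - h i (t + \<delta>)))"
    using jump by simp
  also have "\<dots> = (\<Sum>i\<in>I. \<Sum>t\<in>T. c i * h i t - c i * h i (t + \<delta>))"
    by (simp add: sum_distrib_left right_diff_distrib)
  also have "\<dots> = (\<Sum>t\<in>T. (\<Sum>i\<in>I. c i * h i t) - (\<Sum>i\<in>I. c i * h i (t + \<delta>)))"
    by (subst sum.swap) (simp add: sum_subtractf)
  also have "\<dots> = 0" using zero by simp
  finally show ?thesis .
qed

lemma relatively_open_interval:
  fixes S :: "real set"
  assumes "convex S" "bounded S" "S \<noteq> {}" "rel_interior S = S"
  shows "\<exists>l u. l \<le> u \<and> (S = (if l = u then {l} else {l<..<u}))"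
proof (cases "\<exists>a. S = {a}")
  case True
  then show ?thesis by auto
next
  case False
  have bdd: "bdd_below S" "bdd_above S"
    using assms(2) by (simp_all add: bounded_imp_bdd_below bounded_imp_bdd_above)
  have "aff_dim S \<noteq> -1" "aff_dim S \<noteq> 0" "aff_dim S \<le> 1" "aff_dim S \<ge> -1"
    using assms(3) False aff_dim_le_DIM[of S] by (auto simp: aff_dim_eq_0 aff_dim_empty aff_dim_geq)
  then have "aff_dim S = 1" by linarith
  then have "aff_dim S = int DIM(real)" by simp
  then have "rel_interior S = interior S" by (rule interior_rel_interior)
  then have "open S" unfolding assms(4) by (rule interior_eq[THEN iffD1, OF sym])
  have Inf: "Inf S < t" if t: "t \<in> S" for t
  proof -
    obtain e where "e > 0" "ball t e \<subseteq> S" using \<open>open S\<close> t unfolding open_contains_ball by blast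
    moreover have "t - e/2 \<in> ball t e" using \<open>e > 0\<close> by (simp add: dist_real_def)
    ultimately have "Inf S \<le> t - e/2" using bdd by (intro cInf_lower) auto
    then show ?thesis using \<open>e > 0\<close> by simp
  qed
  have Sup: "t < Sup S" if t: "t \<in> S" for t
  proof -
    obtain e where "e > 0" "ball t e \<subseteq> S" using \<open>open S\<close> t unfolding open_contains_ball by blast
    moreover have "t + e/2 \<in> ball t e" using \<open>e > 0\<close> by (simp add: dist_real_def)
    ultimately have "t + e/2 \<le> Sup S" using bdd by (intro cSup_upper) auto
    then show ?thesis using \<open>e > 0\<close> by simp
  qed
  have "t \<in> S" if "Inf S < t" "t < Sup S" for t
  proof -
    obtain x y where "x \<in> S" "x < t" "y \<in> S" "t < y"
      using \<open>Inf S < t\<close> \<open>t < Sup S\<close> assms(3) bdd by (metis cInf_less_iff less_cSup_iff)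
    then show ?thesis
      using assms(1) by (meson is_interval_convex_1 is_interval_1 less_imp_le)
  qed
  then have "S = {Inf S<..<Sup S}" using Inf Sup by auto
  moreover have "Inf S < Sup S" using Inf Sup assms(3) by (meson all_not_in_conv less_trans)
  ultimately show ?thesis by (metis less_imp_le less_irrefl)
qed

text \<open>The Euler characteristic with compact support of a relatively open convex set. The empty
  set needs its own value, as \<open>nat (-1) = 0\<close> would yield 1.\<close>

definition open_euler :: "'v::euclidean_space set \<Rightarrow> int" where
  "open_euler U = (if U = {} then 0 else (-1) ^ nat (aff_dim U))"

text \<open>As \<open>U\<close> is open in its affine hull, the affine hull of the slice is the
  slice of the affine hull; a hyperplane that meets this hull without containing it lowers the
  dimension by exactly one.\<close>

lemma open_euler_slice:
  fixes U :: "'v::euclidean_space set"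
  assumes U: "convex U" "rel_interior U = U" and "U \<inter> {x. b \<bullet> x = t} \<noteq> {}" "\<not> U \<subseteq> {x. b \<bullet> x = t}"
  shows "open_euler (U \<inter> {x. b \<bullet> x = t}) = - open_euler U"
proof -
  let ?H = "{x. b \<bullet> x = t}"
  have aH: "affine ?H" by (rule affine_hyperplane)
  obtain T where T: "open T" "U = affine hull U \<inter> T"
    using openin_rel_interior[of U] U(2) by (auto simp: openin_open)
  have "(affine hull U \<inter> ?H) \<inter> T = U \<inter> ?H" using T by blast
  then have "affine hull (U \<inter> ?H) = affine hull (affine hull U \<inter> ?H)"
    using affine_hull_affine_Int_open[of "affine hull U \<inter> ?H" T] assms(3) T(1) aH
    by (metis affine_Int affine_affine_hull hull_hull)
  then have "aff_dim (U \<inter> ?H) = aff_dim (affine hull U \<inter> ?H)"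
    by (metis aff_dim_affine_hull)
  also have "\<dots> = aff_dim U - 1"
  proof -
    have "affine hull U \<inter> ?H \<noteq> {}" using assms(3) hull_subset[of U affine] by blast
    moreover have "\<not> affine hull U \<subseteq> ?H" using assms(4) hull_subset[of U affine] by blast
    ultimately show ?thesis by (simp add: aff_dim_affine_Int_hyperplane)
  qed
  finally have d: "aff_dim (U \<inter> ?H) = aff_dim U - 1" .
  moreover have "0 \<le> aff_dim (U \<inter> ?H)"
    using assms(3) aff_dim_empty[of "U \<inter> ?H"] aff_dim_geq[of "U \<inter> ?H"] by linarith
  ultimately have "nat (aff_dim U) = Suc (nat (aff_dim (U \<inter> ?H)))" by simp
  then show ?thesis unfolding open_euler_def using assms(3) by auto
qed

text \<open>A version of Groemer's theorem for relatively open convex sets, with Hadwiger's proof by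
  slicing along the coordinates that are not yet fixed.\<close>

lemma open_euler_linear_aux:
  fixes U :: "'i \<Rightarrow> 'v::euclidean_space set" and a :: "'i \<Rightarrow> int"
  assumes "finite J" "J \<subseteq> Basis" "finite I"
    and "\<And>i. i \<in> I \<Longrightarrow> convex (U i) \<and> bounded (U i) \<and> rel_interior (U i) = U i"
    and "\<And>i j x y b. \<lbrakk>i \<in> I; j \<in> I; x \<in> U i; y \<in> U j; b \<in> Basis - J\<rbrakk> \<Longrightarrow> b \<bullet> x = b \<bullet> y"
    and "\<And>x. (\<Sum>i\<in>I. a i * of_bool (x \<in> U i)) = 0"
  shows "(\<Sum>i\<in>I. a i * open_euler (U i)) = 0"
  using assms
proof (induction J arbitrary: U rule: finite_induct)
  case empty
  show ?case
  proof (cases "\<exists>i\<in>I. U i \<noteq> {}")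
    case True
    then obtain p i0 where p: "i0 \<in> I" "p \<in> U i0" by blast
    have "x = p" if "i \<in> I" "x \<in> U i" for i x
    proof (rule euclidean_eqI)
      fix b :: 'v
      assume "b \<in> Basis"
      then have "b \<bullet> x = b \<bullet> p" using empty.prems(4)[OF that(1) p(1) that(2) p(2), of b] by simp
      then show "x \<bullet> b = p \<bullet> b" by (simp only: inner_commute)
    qed
    then have "U i = {} \<or> U i = {p}" if "i \<in> I" for i using that by blast
    then have "open_euler (U i) = of_bool (p \<in> U i)" if "i \<in> I" for i
      using that by (force simp: open_euler_def)
    then show ?thesis using empty.prems(5)[of p] by simp
  qed (simp add: open_euler_def)
next
  case (insert b J)
  \<comment> \<open>Empty sets have Euler number 0 and no projection interval, so they are set
    aside.\<close>
  define I' where "I' = {i \<in> I. U i \<noteq> {}}"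
  have fI: "finite I'" using insert.prems unfolding I'_def by simp
  have "\<exists>l u. l \<le> u \<and> ((\<lambda>x. b \<bullet> x) ` U i = (if l = u then {l} else {l<..<u}))" if "i \<in> I'" for i
  proof (rule relatively_open_interval)
    have i: "i \<in> I" "U i \<noteq> {}" "convex (U i)" "bounded (U i)" "rel_interior (U i) = U i"
      using that insert.prems(3) unfolding I'_def by auto
    have lin: "linear (\<lambda>x. b \<bullet> x)" by (simp add: bounded_linear.linear bounded_linear_inner_right)
    show "convex ((\<lambda>x. b \<bullet> x) ` U i)" using convex_linear_image[OF lin i(3)] .
    show "bounded ((\<lambda>x. b \<bullet> x) ` U i)" using i(4) bounded_linear_image bounded_linear_inner_right by blast
    show "(\<lambda>x. b \<bullet> x) ` U i \<noteq> {}" using i by simp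
    show "rel_interior ((\<lambda>x. b \<bullet> x) ` U i) = (\<lambda>x. b \<bullet> x) ` U i"
      using rel_interior_convex_linear_image[OF lin i(3)] i(5) by simp
  qed
  then have "\<forall>i\<in>I'. \<exists>p. fst p \<le> snd p \<and>
      (\<lambda>x. b \<bullet> x) ` U i = (if fst p = snd p then {fst p} else {fst p<..<snd p})"
    by (metis fst_conv snd_conv)
  then obtain p where p: "\<forall>i\<in>I'. fst (p i) \<le> snd (p i) \<and>
      (\<lambda>x. b \<bullet> x) ` U i = (if fst (p i) = snd (p i) then {fst (p i)} else {fst (p i)<..<snd (p i)})"
    by (rule bchoice[THEN exE])
  define l where "l = fst \<circ> p"
  define u where "u = snd \<circ> p"
  have lu: "\<And>i. i \<in> I' \<Longrightarrow> l i \<le> u i"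
    "\<And>i. i \<in> I' \<Longrightarrow> (\<lambda>x. b \<bullet> x) ` U i = (if l i = u i then {l i} else {l i<..<u i})"
    using p unfolding l_def u_def comp_def by blast+
  have slice: "open_euler (U i \<inter> {x. b \<bullet> x = t}) =
      open_euler (U i) * (if l i = u i then of_bool (t = l i) else - of_bool (l i < t \<and> t < u i))"
    if i: "i \<in> I'" for i t
  proof (cases "l i = u i")
    case True
    then have "U i \<inter> {x. b \<bullet> x = t} = (if t = l i then U i else {})"
      using lu(2)[OF i] by auto
    then show ?thesis using True by (simp add: open_euler_def)
  next
    case False
    then have im: "(\<lambda>x. b \<bullet> x) ` U i = {l i<..<u i}" "l i < u i" using lu[OF i] by auto
    have "U i \<inter> {x. b \<bullet> x = t} \<noteq> {} \<longleftrightarrow> t \<in> (\<lambda>x. b \<bullet> x) ` U i" by blast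
    then have ne: "U i \<inter> {x. b \<bullet> x = t} \<noteq> {} \<longleftrightarrow> l i < t \<and> t < u i" unfolding im(1) by simp
    have "\<not> U i \<subseteq> {x. b \<bullet> x = t}"
    proof
      assume "U i \<subseteq> {x. b \<bullet> x = t}"
      then have "(\<lambda>x. b \<bullet> x) ` U i \<subseteq> {t}" by blast
      then have "{l i<..<u i} \<subseteq> {t}" unfolding im(1) .
      then show False using im(2) infinite_Ioo finite_subset by blast
    qed
    moreover have "convex (U i)" "rel_interior (U i) = U i"
      using insert.prems(3)[of i] i unfolding I'_def by blast+
    ultimately have "l i < t \<and> t < u i \<Longrightarrow> open_euler (U i \<inter> {x. b \<bullet> x = t}) = - open_euler (U i)"
      using open_euler_slice ne by blast
    moreover have "\<not> (l i < t \<and> t < u i) \<Longrightarrow> open_euler (U i \<inter> {x. b \<bullet> x = t}) = 0"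
      using ne unfolding open_euler_def by metis
    ultimately show ?thesis using False by (cases "l i < t \<and> t < u i") simp_all
  qed
  have "(\<Sum>i\<in>I'. a i * open_euler (U i) *
      (if l i = u i then of_bool (t = l i) else - of_bool (l i < t \<and> t < u i))) = 0" for t
  proof -
    \<comment> \<open>After cutting at level \<open>t\<close> all points agree in the coordinate
      \<open>b\<close>, which thus leaves the free coordinates \<open>J\<close>.\<close>
    have "(\<Sum>i\<in>I. a i * open_euler (U i \<inter> {x. b \<bullet> x = t})) = 0"
    proof (rule insert.IH)
      show "J \<subseteq> Basis" "finite I" using insert.prems by auto
      show "convex (U i \<inter> {x. b \<bullet> x = t}) \<and> bounded (U i \<inter> {x. b \<bullet> x = t}) \<and>
          rel_interior (U i \<inter> {x. b \<bullet> x = t}) = U i \<inter> {x. b \<bullet> x = t}" if "i \<in> I" for i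
        using insert.prems(3)[OF that] convex_affine_rel_interior_Int[of "U i" "{x. b \<bullet> x = t}"]
        by (cases "U i \<inter> {x. b \<bullet> x = t} = {}")
          (auto simp: affine_hyperplane convex_Int convex_hyperplane bounded_Int)
      show "b' \<bullet> x = b' \<bullet> y" if "i \<in> I" "j \<in> I" "x \<in> U i \<inter> {x. b \<bullet> x = t}"
        "y \<in> U j \<inter> {x. b \<bullet> x = t}" "b' \<in> Basis - J" for i j x y b'
        using that insert.prems(4)[of i j x y b'] by (cases "b' = b") auto
      show "(\<Sum>i\<in>I. a i * of_bool (x \<in> U i \<inter> {x. b \<bullet> x = t})) = 0" for x
        using insert.prems(5)[of x] by (cases "b \<bullet> x = t") auto
    qed
    also have "(\<Sum>i\<in>I. a i * open_euler (U i \<inter> {x. b \<bullet> x = t})) =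
        (\<Sum>i\<in>I'. a i * open_euler (U i \<inter> {x. b \<bullet> x = t}))"
      using insert.prems(2) by (intro sum.mono_neutral_right) (auto simp: I'_def open_euler_def)
    finally show ?thesis by (simp add: slice mult.assoc)
  qed
  then have "(\<Sum>i\<in>I'. a i * open_euler (U i)) = 0"
    by (intro sum_open_intervals_zero[OF fI, of l u "\<lambda>i. a i * open_euler (U i)"] lu(1))
  also have "(\<Sum>i\<in>I'. a i * open_euler (U i)) = (\<Sum>i\<in>I. a i * open_euler (U i))"
    using insert.prems(2) by (intro sum.mono_neutral_left) (auto simp: I'_def open_euler_def)
  finally show ?case .
qed

section \<open>The cell partition of the relative interior\<close>

lemma rel_interior_face_exists:
  fixes P :: "'v::euclidean_space set"
  assumes "polytope P" "x \<in> P"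
  shows "\<exists>F. F face_of P \<and> x \<in> rel_interior F"
  using assms
proof (induction "nat (aff_dim P + 1)" arbitrary: P rule: less_induct)
  case less
  show ?case
  proof (cases "x \<in> rel_interior P")
    case True
    then show ?thesis using less.prems face_of_refl polytope_imp_convex by blast
  next
    case False
    then have "x \<in> rel_frontier P" using less.prems closure_subset by (auto simp: rel_frontier_def)
    then obtain G where G: "G face_of P" "G \<noteq> P" "x \<in> G"
      using rel_frontier_of_polyhedron_alt[OF polytope_imp_polyhedron[OF less.prems(1)]] by blast
    have "aff_dim G < aff_dim P" using G less.prems face_of_aff_dim_lt polytope_imp_convex by blast
    then have "nat (aff_dim G + 1) < nat (aff_dim P + 1)" using aff_dim_geq[of G] by linarith
    then obtain F where "F face_of G" "x \<in> rel_interior F"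
      using less.hyps G less.prems face_of_polytope_polytope by blast
    then show ?thesis using G face_of_trans by blast
  qed
qed

text \<open>If the relative interiors of faces \<open>F\<close> of \<open>P\<close> and
  \<open>F'\<close> of \<open>P'\<close> share a point, then both are faces of the common face
  \<open>P \<inter> P'\<close>, and faces of one convex set with intersecting relative interiors
  coincide. Existence of a cell through a point comes from descending in a polytope \<open>P\<close>
  that contains it.\<close>

lemma interior_face_sum:
  fixes Q :: "'v::euclidean_space set"
  assumes S: "polytope_subdivision S Q" and Q: "polytope Q"
  shows "finite (interior_faces S Q)"
    and "of_bool (x \<in> rel_interior Q) = (\<Sum>F\<in>interior_faces S Q. of_bool (x \<in> rel_interior F) :: int)"
proof -
  have S': "finite S" "\<And>P. P \<in> S \<Longrightarrow> polytope P" "\<Union>S = Q"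
    "\<And>P P'. \<lbrakk>P \<in> S; P' \<in> S; P \<noteq> P'; P \<inter> P' \<noteq> {}\<rbrakk> \<Longrightarrow> (P \<inter> P') face_of P \<and> (P \<inter> P') face_of P'"
    using S unfolding polytope_subdivision_def by auto
  have "finite (\<Union>P\<in>S. {F. F face_of P})" using S' by (auto simp: finite_polytope_faces)
  then show fin: "finite (interior_faces S Q)"
    by (rule rev_finite_subset) (auto simp: interior_faces_def)
  have conv: "convex F" if "F \<in> interior_faces S Q" for F
    using that by (auto simp: interior_faces_def dest: face_of_imp_convex)
  have sub: "rel_interior F \<subseteq> rel_interior Q" if F: "F \<in> interior_faces S Q" for F
  proof (rule subset_rel_interior_convex)
    show "convex F" "convex Q" using conv[OF F] Q by (auto simp: polytope_imp_convex)
    show "F \<subseteq> closure Q" "\<not> F \<subseteq> rel_frontier Q"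
      using F S'(3) closure_subset[of Q] by (auto simp: interior_faces_def dest!: face_of_imp_subset)
  qed
  have uniq: "F = F'" if FF: "F \<in> interior_faces S Q" "F' \<in> interior_faces S Q"
    and xFF: "x \<in> rel_interior F" "x \<in> rel_interior F'" for F F'
  proof -
    obtain P P' where P: "P \<in> S" "F face_of P" "P' \<in> S" "F' face_of P'"
      using FF unfolding interior_faces_def by blast
    have x: "x \<in> F" "x \<in> F'" using xFF rel_interior_subset by blast+
    then have "x \<in> P \<inter> P'" using P by (auto dest!: face_of_imp_subset)
    have faces: "(P \<inter> P') face_of P" "(P \<inter> P') face_of P'"
      using S'(4)[OF P(1,3)] \<open>x \<in> P \<inter> P'\<close> P(1,3) S'(2) polytope_imp_convex
      by (cases "P = P'"; auto intro: face_of_refl)+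
    have "F \<subseteq> P \<inter> P'"
      using subset_of_face_of[OF faces(1) face_of_imp_subset[OF P(2)]] \<open>x \<in> P \<inter> P'\<close> xFF by blast
    moreover have "F' \<subseteq> P \<inter> P'"
      using subset_of_face_of[OF faces(2) face_of_imp_subset[OF P(4)]] \<open>x \<in> P \<inter> P'\<close> xFF by blast
    ultimately have "F face_of (P \<inter> P')" "F' face_of (P \<inter> P')"
      using P by (auto intro: face_of_subset)
    then show ?thesis using face_of_eq xFF by blast
  qed
  have ex: "\<exists>F\<in>interior_faces S Q. x \<in> rel_interior F" if x: "x \<in> rel_interior Q"
  proof -
    obtain P where P: "P \<in> S" "x \<in> P" using S'(3) x rel_interior_subset by blast
    obtain F where F: "F face_of P" "x \<in> rel_interior F"
      using rel_interior_face_exists[OF S'(2)[OF P(1)] P(2)] by blast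
    then have "F \<in> interior_faces S Q"
      using P x rel_interior_subset[of F] by (auto simp: interior_faces_def rel_frontier_def)
    then show ?thesis using F by blast
  qed
  show "of_bool (x \<in> rel_interior Q) = (\<Sum>F\<in>interior_faces S Q. of_bool (x \<in> rel_interior F) :: int)"
  proof (cases "x \<in> rel_interior Q")
    case True
    then obtain F where F: "F \<in> interior_faces S Q" "x \<in> rel_interior F" using ex by blast
    have "(\<Sum>F\<in>interior_faces S Q. of_bool (x \<in> rel_interior F) :: int) =
        (\<Sum>F'\<in>interior_faces S Q. if F' = F then 1 else 0)"
      using uniq F by (intro sum.cong) auto
    then show ?thesis using True F fin by simp
  next
    case False
    then have "(\<Sum>F\<in>interior_faces S Q. of_bool (x \<in> rel_interior F) :: int) = 0"
      using sub by (intro sum.neutral) auto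
    then show ?thesis using False by simp
  qed
qed

text \<open>Here openness of \<open>C\<close> enters twice: a point of \<open>F \<inter> C\<close>
  can be moved into the relative interior of \<open>F\<close>, and cutting with \<open>C\<close>
  does not lower the dimension.\<close>

lemma open_euler_rel_interior_Int_open:
  fixes F :: "'v::euclidean_space set"
  assumes "convex F" "open C"
  shows "open_euler (rel_interior F \<inter> C) = (-1) ^ nat (aff_dim F) * of_bool (F \<inter> C \<noteq> {})"
proof (cases "F \<inter> C = {}")
  case True
  then have "rel_interior F \<inter> C = {}" using rel_interior_subset by blast
  then show ?thesis using True by (simp add: open_euler_def)
next
  case False
  then have "closure (rel_interior F) \<inter> C \<noteq> {}"
    using assms(1) convex_closure_rel_interior closure_subset[of F] by blast
  then have ne: "rel_interior F \<inter> C \<noteq> {}"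
    using assms(2) by (metis Int_commute open_Int_closure_eq_empty)
  have "affine hull (rel_interior F \<inter> C) = affine hull (rel_interior F)"
    using convex_rel_interior[OF assms(1)] assms(2) ne by (rule affine_hull_convex_Int_open)
  then have "aff_dim (rel_interior F \<inter> C) = aff_dim (rel_interior F)" by (metis aff_dim_affine_hull)
  then have "aff_dim (rel_interior F \<inter> C) = aff_dim F"
    using rel_interior_aff_dim[OF assms(1)] by simp
  then show ?thesis using ne False by (simp add: open_euler_def)
qed

text \<open>The cells \<open>rel_interior F \<inter> C\<close> partition
  \<open>rel_interior Q \<inter> C\<close>, so their Euler numbers add up. Multiplying by
  \<open>(-1) ^ nat (aff_dim Q)\<close> moves the sign of \<open>Q\<close> to the other side, where
  it combines to the codimension.\<close>

lemma subdivision_valuation: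
  fixes Q :: "'v::euclidean_space set"
  assumes S: "polytope_subdivision S Q" and Q: "polytope Q" and C: "open C" "convex C"
  shows "of_bool (Q \<inter> C \<noteq> {}) =
    (\<Sum>F\<in>interior_faces S Q. (-1) ^ nat (aff_dim Q - aff_dim F) * of_bool (F \<inter> C \<noteq> {}) :: int)"
proof -
  let ?\<F> = "interior_faces S Q"
  have face: "convex F \<and> bounded F \<and> aff_dim F \<ge> 0 \<and> aff_dim F \<le> aff_dim Q" if F: "F \<in> ?\<F>" for F
  proof -
    obtain P where P: "P \<in> S" "F face_of P" "F \<noteq> {}" using F unfolding interior_faces_def by blast
    then have "F \<subseteq> Q" using S by (auto simp: polytope_subdivision_def dest!: face_of_imp_subset)
    moreover have "bounded F" using \<open>F \<subseteq> Q\<close> Q polytope_imp_bounded bounded_subset by blast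
    ultimately show ?thesis
      using P(3) aff_dim_subset[of F Q] face_of_imp_convex[OF P(2)] aff_dim_geq[of F] aff_dim_empty[of F]
      by auto
  qed
  \<comment> \<open>The index \<open>None\<close> stands for \<open>Q\<close>, apart from the cells,
    because \<open>Q\<close> can itself be one of its interior faces.\<close>
  define U where "U = case_option (rel_interior Q \<inter> C) (\<lambda>F. rel_interior F \<inter> C)"
  define a :: "'v set option \<Rightarrow> int" where "a = case_option 1 (\<lambda>_. -1)"
  define I where "I = insert None (Some ` ?\<F>)"
  have fin: "finite ?\<F>" using interior_face_sum(1)[OF S Q] .
  have sumI: "(\<Sum>i\<in>I. g i) = g None + (\<Sum>F\<in>?\<F>. g (Some F))" for g :: "'v set option \<Rightarrow> int"
    unfolding I_def using fin by (subst sum.insert) (auto simp: sum.reindex)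
  have rel: "convex (rel_interior X \<inter> C) \<and> bounded (rel_interior X \<inter> C) \<and>
      rel_interior (rel_interior X \<inter> C) = rel_interior X \<inter> C" if "convex X" "bounded X" for X
  proof -
    have "openin (top_of_set (affine hull X)) (rel_interior X \<inter> C)"
      by (rule openin_Int_open[OF openin_rel_interior C(1)])
    moreover have "rel_interior X \<inter> C \<noteq> {} \<Longrightarrow> affine hull (rel_interior X \<inter> C) = affine hull X"
      using calculation by (rule affine_hull_openin)
    ultimately have "rel_interior (rel_interior X \<inter> C) = rel_interior X \<inter> C"
      using rel_interior_openin[of "rel_interior X \<inter> C"] by (cases "rel_interior X \<inter> C = {}") auto
    then show ?thesis
      using that C bounded_subset[OF that(2), of "rel_interior X \<inter> C"] rel_interior_subset[of X]
      by (auto intro: convex_rel_interior convex_Int)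
  qed
  have "(\<Sum>i\<in>I. a i * open_euler (U i)) = 0"
  proof (rule open_euler_linear_aux[of Basis])
    show "finite I" unfolding I_def using fin by simp
    show "convex (U i) \<and> bounded (U i) \<and> rel_interior (U i) = U i" if "i \<in> I" for i
      using that rel Q face unfolding I_def U_def
      by (auto simp: polytope_imp_convex polytope_imp_bounded)
    show "(\<Sum>i\<in>I. a i * of_bool (x \<in> U i)) = 0" for x
      using interior_face_sum(2)[OF S Q, of x] unfolding sumI a_def U_def
      by (cases "x \<in> C") (simp_all add: sum_negf)
  qed auto
  then have *: "(-1) ^ nat (aff_dim Q) * of_bool (Q \<inter> C \<noteq> {}) =
      (\<Sum>F\<in>?\<F>. (-1) ^ nat (aff_dim F) * of_bool (F \<inter> C \<noteq> {}) :: int)"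
    unfolding sumI using face Q C
    by (simp add: a_def U_def open_euler_rel_interior_Int_open polytope_imp_convex sum_negf)
  have sgn: "(-1) ^ nat (aff_dim Q) * (-1) ^ nat (aff_dim F) = (-1 :: int) ^ nat (aff_dim Q - aff_dim F)"
    if "F \<in> ?\<F>" for F
  proof -
    have "nat (aff_dim Q) = nat (aff_dim Q - aff_dim F) + nat (aff_dim F)"
      using face[OF that] by linarith
    then show ?thesis by (simp add: power_add)
  qed
  have "of_bool (Q \<inter> C \<noteq> {}) = (-1) ^ nat (aff_dim Q) * ((-1) ^ nat (aff_dim Q) * of_bool (Q \<inter> C \<noteq> {}) :: int)"
    by (simp add: mult.assoc[symmetric])
  also have "\<dots> = (\<Sum>F\<in>?\<F>. (-1) ^ nat (aff_dim Q) * ((-1) ^ nat (aff_dim F) * of_bool (F \<inter> C \<noteq> {})))"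
    unfolding * by (simp add: sum_distrib_left)
  also have "\<dots> = (\<Sum>F\<in>?\<F>. (-1) ^ nat (aff_dim Q - aff_dim F) * of_bool (F \<inter> C \<noteq> {}))"
    using sgn by (intro sum.cong) (auto simp: mult.assoc[symmetric])
  finally show ?thesis .
qed

section \<open>Alternating sums and the beta invariant\<close>

definition altsum :: "('a set \<Rightarrow> int) \<Rightarrow> 'a set \<Rightarrow> 'a set \<Rightarrow> int" where
  "altsum f F G = (\<Sum>A\<in>{F..G}. (-1) ^ card A * f A)"

lemma finite_set_interval: "finite G \<Longrightarrow> finite {F..G :: 'a set}"
  by (rule finite_subset[of _ "Pow G"]) auto

lemma altsum_split:
  assumes "finite G" "x \<in> G" "x \<notin> F"
  shows "altsum f F G = (\<Sum>A\<in>{F..G - {x}}. (-1) ^ card A * (f A - f (insert x A)))"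
proof -
  have eq: "{F..G} = {F..G - {x}} \<union> insert x ` {F..G - {x}}"
  proof (rule equalityI; rule subsetI)
    fix A assume "A \<in> {F..G}"
    then show "A \<in> {F..G - {x}} \<union> insert x ` {F..G - {x}}"
      using assms by (cases "x \<in> A") (auto simp: image_iff intro!: bexI[of _ "A - {x}"])
  qed (use assms in auto)
  have fin: "finite {F..G - {x}}" using assms by (intro finite_set_interval) simp
  have inj: "inj_on (insert x) {F..G - {x}}"
  proof (rule inj_onI)
    fix A B assume "A \<in> {F..G - {x}}" "B \<in> {F..G - {x}}" "insert x A = insert x B"
    moreover from this have "x \<notin> A" "x \<notin> B" by auto
    ultimately show "A = B" by (simp add: insert_ident)
  qed
  have card: "card (insert x A) = Suc (card A)" if "A \<in> {F..G - {x}}" for A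
    using that assms(1) by (metis Diff_iff atLeastAtMost_iff card_insert_disjoint finite_Diff finite_subset insertI1 subsetD)
  have "altsum f F G = (\<Sum>A\<in>{F..G - {x}}. (-1) ^ card A * f A) +
      (\<Sum>A\<in>insert x ` {F..G - {x}}. (-1) ^ card A * f A)"
    unfolding altsum_def eq using fin by (intro sum.union_disjoint) auto
  also have "(\<Sum>A\<in>insert x ` {F..G - {x}}. (-1) ^ card A * f A) =
      (\<Sum>A\<in>{F..G - {x}}. - ((-1) ^ card A * f (insert x A)))"
    by (subst sum.reindex[OF inj]) (intro sum.cong, auto simp: card)
  finally show ?thesis by (simp add: sum_negf right_diff_distrib sum_subtractf)
qed

lemma altsum_const: "finite G \<Longrightarrow> altsum (\<lambda>_. c) F G = (if F = G then (-1) ^ card G * c else 0)"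
proof (cases "F \<subset> G")
  case True
  moreover assume "finite G"
  ultimately show ?thesis using altsum_split[of G _ F "\<lambda>_. c"] by auto
next
  case False
  then have "{F..G} = (if F = G then {G} else {})" by auto
  then show ?thesis by (simp add: altsum_def)
qed

lemma altsum_diff: "altsum (\<lambda>A. f A - g A) F G = altsum f F G - altsum g F G"
  by (simp add: altsum_def right_diff_distrib sum_subtractf)

text \<open>An element that never changes \<open>f\<close> makes the terms of \<open>A\<close> and
  \<open>insert x A\<close> cancel. This is the source of all vanishing weights.\<close>

lemma altsum_loop:
  assumes "finite G" "x \<in> G" "x \<notin> F" "\<And>A. F \<subseteq> A \<Longrightarrow> A \<subseteq> G \<Longrightarrow> f (insert x A) = f A"
  shows "altsum f F G = 0"
  unfolding altsum_split[OF assms(1-3)]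
proof (rule sum.neutral, rule ballI)
  fix A assume "A \<in> {F..G - {x}}"
  then have "F \<subseteq> A" "A \<subseteq> G" by auto
  then have "f (insert x A) = f A" by (rule assms(4))
  then show "(-1) ^ card A * (f A - f (insert x A)) = 0" by simp
qed

text \<open>The identity \<open>2 a (r - a) = (r\<^sup>2 + r) - (a\<^sup>2 + a)\<close> for \<open>a \<in> {r, r + 1}\<close> makes the sum
  over all \<open>F\<close> containing \<open>e\<close> independent of \<open>e\<close>.\<close>

lemma altsum_convolution:
  fixes r :: "'a set \<Rightarrow> int"
  assumes H: "finite H" and e: "e \<in> H" "e \<notin> G" and GH: "G \<subseteq> H"
    and step: "\<And>A. r (insert e A) = r A \<or> r (insert e A) = r A + 1"
  shows "2 * (\<Sum>F\<in>{insert e G..H}. (-1) ^ card F * altsum r G F * altsum r F H) =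
    altsum (\<lambda>A. r A ^ 2 + r A) G H"
proof -
  let ?I = "{G..H}" and ?s = "\<lambda>A :: 'a set. (-1 :: int) ^ card A"
  have fin: "finite ?I" "finite {insert e G..H}" using H by (auto intro: finite_set_interval)
  have "(\<Sum>F\<in>{insert e G..H}. ?s F * altsum r G F * altsum r F H) =
      (\<Sum>F\<in>{insert e G..H}. \<Sum>A\<in>?I. \<Sum>B\<in>?I.
        ?s F * of_bool (A \<subseteq> F \<and> F \<subseteq> B) * (?s A * r A) * (?s B * r B))"
  proof (rule sum.cong[OF refl])
    fix F assume F: "F \<in> {insert e G..H}"
    have "altsum r G F = (\<Sum>A\<in>?I. of_bool (A \<subseteq> F) * (?s A * r A))"
      unfolding altsum_def using F fin by (intro sum.mono_neutral_cong_left) auto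
    moreover have "altsum r F H = (\<Sum>B\<in>?I. of_bool (F \<subseteq> B) * (?s B * r B))"
      unfolding altsum_def using F fin by (intro sum.mono_neutral_cong_left) auto
    ultimately have "altsum r G F * altsum r F H = (\<Sum>A\<in>?I. \<Sum>B\<in>?I.
        (of_bool (A \<subseteq> F) * (?s A * r A)) * (of_bool (F \<subseteq> B) * (?s B * r B)))"
      by (simp only: sum_product)
    then have "?s F * (altsum r G F * altsum r F H) = (\<Sum>A\<in>?I. \<Sum>B\<in>?I.
        ?s F * ((of_bool (A \<subseteq> F) * (?s A * r A)) * (of_bool (F \<subseteq> B) * (?s B * r B))))"
      by (simp only: sum_distrib_left)
    then show "?s F * altsum r G F * altsum r F H =
        (\<Sum>A\<in>?I. \<Sum>B\<in>?I. ?s F * of_bool (A \<subseteq> F \<and> F \<subseteq> B) * (?s A * r A) * (?s B * r B))"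
      by (simp only: of_bool_conj mult_ac)
  qed
  also have "\<dots> = (\<Sum>A\<in>?I. \<Sum>B\<in>?I. \<Sum>F\<in>{insert e G..H}.
      ?s F * of_bool (A \<subseteq> F \<and> F \<subseteq> B) * (?s A * r A) * (?s B * r B))"
    by (subst sum.swap, rule sum.cong[OF refl], rule sum.swap)
  also have "\<dots> = (\<Sum>A\<in>?I. ?s A * (r A * r (insert e A)))"
  proof (rule sum.cong[OF refl])
    fix A assume A: "A \<in> ?I"
    have "(\<Sum>F\<in>{insert e G..H}. ?s F * of_bool (A \<subseteq> F \<and> F \<subseteq> B) * (?s A * r A) * (?s B * r B)) =
        (if B = insert e A then ?s A * (r A * r (insert e A)) else 0)" if B: "B \<in> ?I" for B
    proof -
      \<comment> \<open>The signs of the \<open>F\<close> between \<open>insert e A\<close> and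
        \<open>B\<close> cancel unless this interval is a single set, so the double sum collapses to
        the pairs with \<open>B = insert e A\<close>.\<close>
      have "(\<Sum>F\<in>{insert e G..H}. ?s F * of_bool (A \<subseteq> F \<and> F \<subseteq> B)) = altsum (\<lambda>_. 1) (insert e A) B"
        unfolding altsum_def using A B fin by (intro sum.mono_neutral_cong_right) auto
      also have "\<dots> = (if B = insert e A then ?s B else 0)"
      proof -
        have "finite B" using B H finite_subset by auto
        then show ?thesis using altsum_const[of B 1 "insert e A"] by simp
      qed
      finally show ?thesis by (simp add: sum_distrib_right[symmetric])
    qed
    moreover have "insert e A \<in> ?I" using A e by auto
    ultimately show "(\<Sum>B\<in>?I. \<Sum>F\<in>{insert e G..H}.
        ?s F * of_bool (A \<subseteq> F \<and> F \<subseteq> B) * (?s A * r A) * (?s B * r B)) =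
        ?s A * (r A * r (insert e A))"
      using fin by (simp add: sum.delta)
  qed
  also have "\<dots> = altsum (\<lambda>A. r A * r (insert e A)) G H" by (simp add: altsum_def)
  \<comment> \<open>Splitting at \<open>e\<close> pairs \<open>A\<close> with
    \<open>insert e A\<close>, where both factors become \<open>r (insert e A)\<close>. The factor 2
    makes the identity for ranks differing by at most 1 integral.\<close>
  finally have "2 * (\<Sum>F\<in>{insert e G..H}. ?s F * altsum r G F * altsum r F H) =
      (\<Sum>A\<in>{G..H - {e}}. ?s A * (2 * (r A * r (insert e A) - r (insert e A) * r (insert e A))))"
    using altsum_split[OF H e, of "\<lambda>A. r A * r (insert e A)"] by (simp add: sum_distrib_left algebra_simps)
  also have "\<dots> = (\<Sum>A\<in>{G..H - {e}}. ?s A * ((r A ^ 2 + r A) - (r (insert e A) ^ 2 + r (insert e A))))"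
  proof (rule sum.cong[OF refl])
    fix A
    show "?s A * (2 * (r A * r (insert e A) - r (insert e A) * r (insert e A))) =
        ?s A * ((r A ^ 2 + r A) - (r (insert e A) ^ 2 + r (insert e A)))"
      using step[of A] by (auto simp: power2_eq_square algebra_simps)
  qed
  also have "\<dots> = altsum (\<lambda>A. r A ^ 2 + r A) G H" using altsum_split[OF H e] by simp
  finally show ?thesis .
qed

text \<open>Grouping the subsets of a closed set \<open>C\<close> by their closure turns the
  vanishing of their signed count, for nonempty \<open>C\<close>, into the recursion that defines
  \<open>moebius\<close>. Closedness of the empty set provides the base case.\<close>

lemma moebius_closure:
  assumes E: "finite E" and L: "L \<subseteq> Pow E" "{} \<in> L"
    and cl: "\<And>A. A \<subseteq> E \<Longrightarrow> cl A \<in> L" "\<And>A. A \<subseteq> E \<Longrightarrow> A \<subseteq> cl A"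
      "\<And>A C. C \<in> L \<Longrightarrow> A \<subseteq> C \<Longrightarrow> cl A \<subseteq> C"
    and C: "C \<in> L"
  shows "moebius L {} C = (\<Sum>A\<in>{A. A \<subseteq> E \<and> cl A = C}. (-1) ^ card A)"
  using C
proof (induction "card C" arbitrary: C rule: less_induct)
  case less
  have fin: "finite C" using less.prems L E finite_subset by blast
  have finL: "finite L" using L E finite_subset by blast
  show ?case
  proof (cases "C = {}")
    case True
    have "cl {} = {}" using cl(3)[OF L(2), of "{}"] by simp
    moreover have "A = {}" if "A \<subseteq> E" "cl A = {}" for A using cl(2)[OF that(1)] that(2) by simp
    ultimately have "{A. A \<subseteq> E \<and> cl A = {}} = {{}}" by auto
    then show ?thesis using True by (subst moebius.simps) simp
  next
    case False
    let ?D = "{D \<in> L. {} \<subseteq> D \<and> D \<subset> C}"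
    have disj: "(\<Sum>A\<in>Pow C. (-1 :: int) ^ card A) =
        (\<Sum>D\<in>{D \<in> L. D \<subseteq> C}. \<Sum>A\<in>{A. A \<subseteq> E \<and> cl A = D}. (-1) ^ card A)"
    proof -
      have "Pow C = (\<Union>D\<in>{D \<in> L. D \<subseteq> C}. {A. A \<subseteq> E \<and> cl A = D})"
      proof (rule equalityI; rule subsetI)
        fix A assume "A \<in> Pow C"
        then have "A \<subseteq> C" "A \<subseteq> E" using less.prems L by auto
        then have "cl A \<in> L" "cl A \<subseteq> C" using cl(1)[of A] cl(3)[OF less.prems, of A] by auto
        then show "A \<in> (\<Union>D\<in>{D \<in> L. D \<subseteq> C}. {A. A \<subseteq> E \<and> cl A = D})"
          using \<open>A \<subseteq> E\<close> by simp
      next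
        fix A assume "A \<in> (\<Union>D\<in>{D \<in> L. D \<subseteq> C}. {A. A \<subseteq> E \<and> cl A = D})"
        then have "A \<subseteq> E" "cl A \<subseteq> C" by auto
        then show "A \<in> Pow C" using cl(2)[of A] by auto
      qed
      moreover have "(\<Sum>A\<in>(\<Union>D\<in>{D \<in> L. D \<subseteq> C}. {A. A \<subseteq> E \<and> cl A = D}). (-1 :: int) ^ card A) =
          (\<Sum>D\<in>{D \<in> L. D \<subseteq> C}. \<Sum>A\<in>{A. A \<subseteq> E \<and> cl A = D}. (-1) ^ card A)"
        by (rule sum.UNION_disjoint) (use finL E in auto)
      ultimately show ?thesis by simp
    qed
    have "moebius L {} C = - (\<Sum>D\<in>?D. moebius L {} D)"
      using False fin by (subst moebius.simps) auto
    also have "(\<Sum>D\<in>?D. moebius L {} D) = (\<Sum>D\<in>?D. \<Sum>A\<in>{A. A \<subseteq> E \<and> cl A = D}. (-1) ^ card A)"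
      using less.hyps fin by (intro sum.cong) (auto simp: psubset_card_mono)
    also have "\<dots> = (\<Sum>A\<in>Pow C. (-1) ^ card A) - (\<Sum>A\<in>{A. A \<subseteq> E \<and> cl A = C}. (-1) ^ card A)"
    proof -
      have "{D \<in> L. D \<subseteq> C} = insert C ?D" using less.prems by auto
      then show ?thesis unfolding disj using finL by (simp add: sum.insert)
    qed
    also have "(\<Sum>A\<in>Pow C. (-1 :: int) ^ card A) = 0"
    proof -
      have "Pow C = {{}..C}" by auto
      then show ?thesis using altsum_const[OF fin, of 1 "{}"] False by (simp add: altsum_def)
    qed
    finally show ?thesis by simp
  qed
qed

text \<open>Elements that do not raise the rank of \<open>A\<close> can be adjoined one after the
  other without raising it, by submodularity. Only properties of \<open>r\<close> are assumed, so
  that the result applies to minors as well as to \<open>M\<close>.\<close>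

lemma rank_closure:
  fixes r :: "'a set \<Rightarrow> nat"
  defines "cl \<equiv> \<lambda>E A. {x \<in> E. r (insert x A) = r A}"
  assumes E: "finite E" and A: "A \<subseteq> E"
    and mono: "\<And>A B. A \<subseteq> B \<Longrightarrow> B \<subseteq> E \<Longrightarrow> r A \<le> r B"
    and submod: "\<And>A B x. \<lbrakk>A \<subseteq> B; B \<subseteq> E; x \<in> E; r (insert x A) = r A\<rbrakk> \<Longrightarrow> r (insert x B) = r B"
  shows "r (cl E A) = r A" and "\<forall>x\<in>E - cl E A. r (cl E A) < r (insert x (cl E A))"
proof -
  have sub: "cl E A \<subseteq> E" "A \<subseteq> cl E A" using A by (auto simp: cl_def insert_absorb)
  have "r (A \<union> X) = r A" if "finite X" "X \<subseteq> cl E A" for X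
    using that
  proof (induction X rule: finite_induct)
    case (insert x X)
    have "r (insert x (A \<union> X)) = r (A \<union> X)"
      using submod[of A "A \<union> X" x] insert A sub(1) by (auto simp: cl_def)
    then show ?case using insert by simp
  qed simp
  moreover have "A \<union> cl E A = cl E A" using sub(2) by blast
  ultimately show r_cl: "r (cl E A) = r A" using E sub(1) by (metis finite_subset order_refl)
  show "\<forall>x\<in>E - cl E A. r (cl E A) < r (insert x (cl E A))"
  proof (rule ballI, rule ccontr)
    fix x assume x: "x \<in> E - cl E A" and "\<not> r (cl E A) < r (insert x (cl E A))"
    then have "r (insert x (cl E A)) \<le> r A" using r_cl by simp
    moreover have "r (insert x A) \<le> r (insert x (cl E A))"
      using mono[of "insert x A" "insert x (cl E A)"] x sub by auto
    moreover have "r A \<le> r (insert x A)" using mono[of A "insert x A"] x A by auto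
    ultimately show False using x by (auto simp: cl_def)
  qed
qed

text \<open>A set and its closure have the same rank, so \<open>moebius_closure\<close> spreads the
  sum over flats to all subsets. With a loop both sides are zero. The hypotheses speak of the rank
  function alone, because minors are accessed through their ranks and not through basis
  exchange.\<close>

lemma beta_altsum:
  fixes N :: "'a matroid"
  defines "r \<equiv> rank_on N" and "E \<equiv> ground N"
  assumes E: "finite E"
    and mono: "\<And>A B. A \<subseteq> B \<Longrightarrow> B \<subseteq> E \<Longrightarrow> r A \<le> r B"
    and submod: "\<And>A B x. \<lbrakk>A \<subseteq> B; B \<subseteq> E; x \<in> E; r (insert x A) = r A\<rbrakk> \<Longrightarrow> r (insert x B) = r B"
    and loop: "loopless N \<longleftrightarrow> (\<forall>x\<in>E. r {x} \<noteq> r {})"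
  shows "beta_invariant N = (-1) ^ r E * altsum (\<lambda>A. int (r A)) {} E"
proof (cases "loopless N")
  case False
  then obtain x where x: "x \<in> E" "r {x} = r {}" using loop by blast
  have "altsum (\<lambda>A. int (r A)) {} E = 0"
    using E x(1)
  proof (rule altsum_loop)
    show "int (r (insert x A)) = int (r A)" if "A \<subseteq> E" for A using submod[of "{}" A x] x that by simp
  qed auto
  then show ?thesis using False by (simp add: beta_invariant_def)
next
  case True
  define cl where "cl A = {x \<in> E. r (insert x A) = r A}" for A
  have flat: "C \<in> flats N \<longleftrightarrow> C \<subseteq> E \<and> (\<forall>x\<in>E - C. r C < r (insert x C))" for C
    by (simp add: flats_def r_def E_def)
  have cl_sub: "A \<subseteq> cl A" if "A \<subseteq> E" for A
    using that by (auto simp: cl_def insert_absorb)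
  have "cl A \<subseteq> E" for A by (auto simp: cl_def)
  have r_cl: "r (cl A) = r A" and cl_flat: "cl A \<in> flats N" if "A \<subseteq> E" for A
    using rank_closure[OF E that mono submod] \<open>cl A \<subseteq> E\<close> unfolding flat cl_def by auto
  have cl_least: "cl A \<subseteq> C" if "C \<in> flats N" "A \<subseteq> C" for A C
  proof
    fix x assume x: "x \<in> cl A"
    then have "r (insert x C) = r C" using submod[of A C x] that by (auto simp: cl_def flat)
    then show "x \<in> C"
      using x that(1) unfolding cl_def flat by (metis (lifting) DiffI less_irrefl mem_Collect_eq)
  qed
  have empty: "{} \<in> flats N"
    using True loop mono[of "{}"] by (force simp: flat)
  have sub: "flats N \<subseteq> Pow E" by (auto simp: flat)
  have "(\<Sum>F\<in>flats N. moebius (flats N) {} F * int (r F)) =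
      (\<Sum>F\<in>flats N. \<Sum>A\<in>{A. A \<subseteq> E \<and> cl A = F}. (-1) ^ card A * int (r A))"
  proof (rule sum.cong[OF refl])
    fix F assume F: "F \<in> flats N"
    have "moebius (flats N) {} F = (\<Sum>A\<in>{A. A \<subseteq> E \<and> cl A = F}. (-1) ^ card A)"
      by (rule moebius_closure[OF E sub empty]) (fact cl_flat cl_sub cl_least F)+
    then show "moebius (flats N) {} F * int (r F) =
        (\<Sum>A\<in>{A. A \<subseteq> E \<and> cl A = F}. (-1) ^ card A * int (r A))"
      using r_cl by (auto simp: sum_distrib_right intro!: sum.cong)
  qed
  also have "\<dots> = (\<Sum>A\<in>(\<Union>F\<in>flats N. {A. A \<subseteq> E \<and> cl A = F}). (-1) ^ card A * int (r A))"
  proof (rule sum.UNION_disjoint[symmetric])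
    show "finite (flats N)" by (rule finite_subset[of _ "Pow E"]) (use E in \<open>auto simp: flat\<close>)
  qed (use E in auto)
  also have "(\<Union>F\<in>flats N. {A. A \<subseteq> E \<and> cl A = F}) = {{}..E}" using cl_flat by auto
  finally show ?thesis
    using True by (simp add: beta_invariant_def altsum_def matroid_rank_def r_def E_def)
qed

section \<open>Ranks and beta invariants of minors\<close>

lemma rank_restriction:
  assumes M: "is_matroid M" and "A \<subseteq> G"
  shows "rank_on (restriction M G) A = rank_on M A"
proof -
  obtain B where B: "B \<in> bases M" "card (A \<inter> B) = rank_on M A" "card (G \<inter> B) = rank_on M G"
    using chain_basis[OF M, of "{A, G}"] assms(2) by auto
  have *: "A \<inter> (G \<inter> X) = A \<inter> X" for X using assms(2) by blast
  have "rank_on (restriction M G) A =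
      Max ((\<lambda>B. card (A \<inter> B)) ` {G \<inter> B |B. B \<in> bases M \<and> card (G \<inter> B) = rank_on M G})"
    by (simp add: rank_on_def[of "restriction M G" A]) (simp add: restriction_def)
  also have "\<dots> = rank_on M A"
  proof (intro Max_eqI)
    show "finite ((\<lambda>B. card (A \<inter> B)) ` {G \<inter> B |B. B \<in> bases M \<and> card (G \<inter> B) = rank_on M G})"
      using is_matroid_finite(3)[OF M] by simp
    show "rank_on M A \<in> (\<lambda>B. card (A \<inter> B)) ` {G \<inter> B |B. B \<in> bases M \<and> card (G \<inter> B) = rank_on M G}"
      using B *[of B] by (intro image_eqI[of _ _ "G \<inter> B"]) auto
  qed (use rank_ge[OF M] * in auto)
  finally show ?thesis .
qed

lemma bases_minor:
  assumes M: "is_matroid M" and "F \<subseteq> G"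
  shows "bases (contraction (restriction M G) F) =
    (\<lambda>B. G \<inter> B - F) ` {B \<in> bases M. card (G \<inter> B) = rank_on M G \<and> card (F \<inter> B) = rank_on M F}"
proof -
  have *: "F \<inter> (G \<inter> X) = F \<inter> X" for X using assms(2) by blast
  have "bases (contraction (restriction M G) F) =
      {B - F |B. B \<in> bases (restriction M G) \<and> card (F \<inter> B) = rank_on M F}"
    by (simp add: contraction_def rank_restriction[OF assms])
  also have "bases (restriction M G) = (\<lambda>B. G \<inter> B) ` {B \<in> bases M. card (G \<inter> B) = rank_on M G}"
    by (simp add: restriction_def setcompr_eq_image)
  finally show ?thesis by (simp only: setcompr_eq_image) (force simp: *)
qed

text \<open>A basis attaining the ranks of \<open>F\<close>, \<open>A \<union> F\<close> and
  \<open>G\<close> at once induces a basis of the minor that realises the maximum.\<close>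

lemma rank_minor:
  assumes M: "is_matroid M" and FG: "F \<subseteq> G" "A \<subseteq> G - F"
  shows "rank_on (contraction (restriction M G) F) A = rank_on M (A \<union> F) - rank_on M F"
proof -
  have card: "card (A \<inter> (G \<inter> B - F)) = card ((A \<union> F) \<inter> B) - card (F \<inter> B)" if "B \<in> bases M" for B
  proof -
    have "(A \<union> F) \<inter> B = (A \<inter> (G \<inter> B - F)) \<union> (F \<inter> B)" "(A \<inter> (G \<inter> B - F)) \<inter> (F \<inter> B) = {}"
      using FG by auto
    then show ?thesis
      using is_matroid_finite(4)[OF M that] by (simp add: card_Un_disjoint)
  qed
  obtain B where B: "B \<in> bases M" "card (F \<inter> B) = rank_on M F"
      "card ((A \<union> F) \<inter> B) = rank_on M (A \<union> F)" "card (G \<inter> B) = rank_on M G"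
    using chain_basis[OF M, of "{F, A \<union> F, G}"] FG by auto
  show ?thesis unfolding rank_on_def[of "contraction _ _"] bases_minor[OF M FG(1)]
  proof (intro Max_eqI)
    let ?S = "{B \<in> bases M. card (G \<inter> B) = rank_on M G \<and> card (F \<inter> B) = rank_on M F}"
    show "finite ((\<lambda>B. card (A \<inter> B)) ` (\<lambda>B. G \<inter> B - F) ` ?S)"
      using is_matroid_finite(3)[OF M] by simp
    show "rank_on M (A \<union> F) - rank_on M F \<in> (\<lambda>B. card (A \<inter> B)) ` (\<lambda>B. G \<inter> B - F) ` ?S"
      unfolding image_image by (rule image_eqI[of _ _ B]) (use B card[OF B(1)] in simp_all)
    fix y assume "y \<in> (\<lambda>B. card (A \<inter> B)) ` (\<lambda>B. G \<inter> B - F) ` ?S"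
    then obtain B where B: "B \<in> bases M" "card (F \<inter> B) = rank_on M F" "y = card (A \<inter> (G \<inter> B - F))"
      by auto
    then show "y \<le> rank_on M (A \<union> F) - rank_on M F"
      using card[OF B(1)] rank_ge[OF M B(1), of "A \<union> F"] by (simp add: diff_le_mono)
  qed
qed

text \<open>Replacing \<open>A\<close> by \<open>A \<union> F\<close> moves the sum over subsets of
  \<open>G - F\<close> to the interval from \<open>F\<close> to \<open>G\<close>, at the cost of
  \<open>(-1) ^ card F\<close>. The rank of the minor differs from that of \<open>M\<close> by the
  constant \<open>rank_on M F\<close>, which an alternating sum over a nontrivial interval does not
  see.\<close>

lemma beta_minor:
  assumes M: "is_matroid M" and FG: "F \<subset> G" "G \<subseteq> ground M"
  shows "beta_invariant (contraction (restriction M G) F) =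
    (-1) ^ (rank_on M G - rank_on M F + card F) * altsum (\<lambda>A. int (rank_on M A)) F G"
proof -
  let ?N = "contraction (restriction M G) F" and ?r = "rank_on M"
  have sub: "F \<subseteq> G" using FG by blast
  have E: "ground ?N = G - F" by (simp add: contraction_def restriction_def)
  have fin: "finite G" using FG is_matroid_finite(1)[OF M] finite_subset by blast
  have r: "rank_on ?N A = ?r (A \<union> F) - ?r F" if "A \<subseteq> G - F" for A
    using rank_minor[OF M sub that] .
  have ge: "?r F \<le> ?r (A \<union> F)" for A using rank_mono[OF M] by blast
  have "beta_invariant ?N = (-1) ^ rank_on ?N (G - F) * altsum (\<lambda>A. int (rank_on ?N A)) {} (G - F)"
  proof (rule beta_altsum[of ?N, unfolded E])
    show "finite (G - F)" using fin by simp
    show "rank_on ?N A \<le> rank_on ?N B" if "A \<subseteq> B" "B \<subseteq> G - F" for A B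
    proof -
      have "?r (A \<union> F) \<le> ?r (B \<union> F)" using that by (intro rank_mono[OF M]) blast
      moreover have "A \<subseteq> G - F" using that by blast
      ultimately show ?thesis using r that by (simp add: diff_le_mono)
    qed
    show "rank_on ?N (insert x B) = rank_on ?N B"
      if "A \<subseteq> B" "B \<subseteq> G - F" "x \<in> G - F" "rank_on ?N (insert x A) = rank_on ?N A" for A B x
    proof -
      have "?r (insert x (A \<union> F)) = ?r (A \<union> F)"
        using that r[of A] r[of "insert x A"] ge[of A] ge[of "insert x A"] by auto
      then have "?r (insert x (B \<union> F)) = ?r (B \<union> F)"
        using rank_insert_submod[OF M, of "A \<union> F" "B \<union> F"] that(1) by blast
      then show ?thesis using that r[of B] r[of "insert x B"] by auto
    qed
    show "loopless ?N \<longleftrightarrow> (\<forall>x\<in>G - F. rank_on ?N {x} \<noteq> rank_on ?N {})"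
    proof -
      have "(\<exists>B\<in>bases ?N. x \<in> B) \<longleftrightarrow> ?r (insert x F) \<noteq> ?r F" if x: "x \<in> G - F" for x
      proof
        assume "\<exists>B\<in>bases ?N. x \<in> B"
        then obtain B where B: "B \<in> bases M" "x \<in> B" "card (F \<inter> B) = ?r F"
          unfolding bases_minor[OF M sub] by auto
        have "card (insert x F \<inter> B) = Suc (card (F \<inter> B))"
          using B x is_matroid_finite(4)[OF M B(1)] by (simp add: Int_insert_left)
        then show "?r (insert x F) \<noteq> ?r F" using rank_ge[OF M B(1), of "insert x F"] B by linarith
      next
        assume *: "?r (insert x F) \<noteq> ?r F"
        obtain B where B: "B \<in> bases M" "card (F \<inter> B) = ?r F"
          "card (insert x F \<inter> B) = ?r (insert x F)" "card (G \<inter> B) = ?r G"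
          using chain_basis[OF M, of "{F, insert x F, G}"] sub x by auto
        then have "x \<in> B" using * by (auto simp: Int_insert_left split: if_splits)
        then have "x \<in> G \<inter> B - F" using x by simp
        moreover have "G \<inter> B - F \<in> bases ?N" unfolding bases_minor[OF M sub] using B by simp
        ultimately show "\<exists>B\<in>bases ?N. x \<in> B" by (rule bexI)
      qed
      moreover have "rank_on ?N {x} = rank_on ?N {} \<longleftrightarrow> ?r (insert x F) = ?r F" if "x \<in> G - F" for x
        using r[of "{x}"] r[of "{}"] ge[of "{x}"] that by auto
      ultimately show ?thesis unfolding loopless_def E by blast
    qed
  qed
  also have "rank_on ?N (G - F) = ?r G - ?r F"
    using r[of "G - F"] sub by (simp add: Un_absorb2)
  also have "altsum (\<lambda>A. int (rank_on ?N A)) {} (G - F) = (-1) ^ card F * altsum (\<lambda>A. int (?r A)) F G"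
  proof -
    have "altsum (\<lambda>A. int (rank_on ?N A)) {} (G - F) =
        (\<Sum>A\<in>{{}..G - F}. (-1) ^ card F * ((-1) ^ card (A \<union> F) * (int (?r (A \<union> F)) - int (?r F))))"
      unfolding altsum_def
    proof (rule sum.cong[OF refl])
      fix A assume A: "A \<in> {{}..G - F}"
      have "card (A \<union> F) = card A + card F"
        using A fin sub by (intro card_Un_disjoint) (auto intro: finite_subset)
      then have "(-1 :: int) ^ card A = (-1) ^ card F * (-1) ^ card (A \<union> F)"
        by (simp add: power_add)
      then show "(-1) ^ card A * int (rank_on ?N A) =
          (-1) ^ card F * ((-1) ^ card (A \<union> F) * (int (?r (A \<union> F)) - int (?r F)))"
        using r[of A] ge[of A] A by (simp add: of_nat_diff)
    qed
    also have "\<dots> = (-1) ^ card F * (\<Sum>A\<in>{{}..G - F}. (-1) ^ card (A \<union> F) * (int (?r (A \<union> F)) - int (?r F)))"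
      by (simp add: sum_distrib_left)
    also have "(\<Sum>A\<in>{{}..G - F}. (-1) ^ card (A \<union> F) * (int (?r (A \<union> F)) - int (?r F))) =
        altsum (\<lambda>A. int (?r A) - int (?r F)) F G"
      unfolding altsum_def
      by (rule sum.reindex_bij_witness[of _ "\<lambda>A. A - F" "\<lambda>A. A \<union> F"]) (use sub in \<open>auto simp: Un_absorb2\<close>)
    also have "\<dots> = altsum (\<lambda>A. int (?r A)) F G"
      unfolding altsum_diff using altsum_const[OF fin, of "int (?r F)" F] FG by auto
    finally show ?thesis .
  qed
  finally show ?thesis by (simp add: power_add)
qed

section \<open>Cones over chains of sets\<close>

lemma chain_Union_mem:
  assumes "finite \<C>" "\<C> \<noteq> {}" "\<And>X Y. X \<in> \<C> \<Longrightarrow> Y \<in> \<C> \<Longrightarrow> X \<subseteq> Y \<or> Y \<subseteq> X"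
  shows "\<Union>\<C> \<in> \<C>"
  using assms
proof (induction \<C> rule: finite_ne_induct)
  case (insert X \<C>)
  then have "\<Union>\<C> \<in> \<C>" by blast
  then have "X \<subseteq> \<Union>\<C> \<or> \<Union>\<C> \<subseteq> X" using insert.prems by blast
  then show ?case using \<open>\<Union>\<C> \<in> \<C>\<close> by (auto simp: Un_absorb1 Un_absorb2)
qed simp

lemma chain_Inter_mem:
  assumes "finite \<C>" "\<C> \<noteq> {}" "\<And>X Y. X \<in> \<C> \<Longrightarrow> Y \<in> \<C> \<Longrightarrow> X \<subseteq> Y \<or> Y \<subseteq> X"
  shows "\<Inter>\<C> \<in> \<C>"
  using assms
proof (induction \<C> rule: finite_ne_induct)
  case (insert X \<C>)
  then have "\<Inter>\<C> \<in> \<C>" by blast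
  then have "X \<subseteq> \<Inter>\<C> \<or> \<Inter>\<C> \<subseteq> X" using insert.prems by blast
  then show ?case using \<open>\<Inter>\<C> \<in> \<C>\<close> by (auto simp: Int_absorb1 Int_absorb2)
qed simp

lemma e_vec_nth [simp]: "e_vec B $ i = of_bool (i \<in> B)"
  by (simp add: e_vec_def axis_def sum.delta of_bool_def)

lemma mod_one_add: "mod_one (x + y) = mod_one x + mod_one y"
  by (simp add: plus_tspace.abs_eq)

lemma mod_one_scaleR: "mod_one (c *\<^sub>R x) = c *\<^sub>R mod_one x"
  by (simp add: scaleR_tspace.abs_eq)

lemma linear_mod_one: "linear mod_one"
  by (rule linearI) (simp_all add: mod_one_add mod_one_scaleR)

lemma mod_one_eq_iff: "mod_one x = mod_one y \<longleftrightarrow> (\<exists>c. \<forall>i. x $ i = y $ i + c)"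
  by (rule tspace.abs_eq_iff)

text \<open>Differences of coordinates are the coordinate functionals that descend to the quotient.
  They separate its points and are integral on the lattice, so arguments about cones can be carried
  out with them.\<close>

lift_definition tdiff :: "'e \<Rightarrow> 'e \<Rightarrow> 'e::finite tspace \<Rightarrow> real" is "\<lambda>i j x. x $ i - x $ j"
  by auto

lemma tdiff_mod_one [simp]: "tdiff i j (mod_one x) = x $ i - x $ j"
  by (rule tdiff.abs_eq)

lemma linear_tdiff: "linear (tdiff i j)"
  by (rule linearI; transfer) (simp_all add: algebra_simps)

lemma tspace_eqI:
  assumes "\<And>i. tdiff i j x = tdiff i j y"
  shows "x = y"
  using assms
proof transfer
  fix j and x y :: "real ^ 'a"
  assume *: "\<And>i. x $ i - x $ j = y $ i - y $ j"
  have "x $ i = y $ i + (x $ j - y $ j)" for i using *[of i] by simp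
  then show "\<exists>c. \<forall>i. x $ i = y $ i + c" by blast
qed

abbreviation ray :: "'e::finite set \<Rightarrow> 'e tspace" where
  "ray F \<equiv> mod_one (e_vec F)"

text \<open>A set rather than a list, since a cone depends only on the set of its rays. The empty
  set and the whole set are excluded because their indicator vectors are zero in the
  quotient.\<close>

definition proper_chain :: "'e set set \<Rightarrow> bool" where
  "proper_chain \<F> \<longleftrightarrow> {} \<notin> \<F> \<and> UNIV \<notin> \<F> \<and> (\<forall>F\<in>\<F>. \<forall>G\<in>\<F>. F \<subseteq> G \<or> G \<subseteq> F)"

lemma proper_chainD:
  "proper_chain \<F> \<Longrightarrow> F \<in> \<F> \<Longrightarrow> F \<noteq> {}" "proper_chain \<F> \<Longrightarrow> F \<in> \<F> \<Longrightarrow> F \<noteq> UNIV"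
  "proper_chain \<F> \<Longrightarrow> F \<in> \<F> \<Longrightarrow> G \<in> \<F> \<Longrightarrow> F \<subseteq> G \<or> G \<subseteq> F"
  unfolding proper_chain_def by metis+

lemma proper_chain_subset: "proper_chain \<F> \<Longrightarrow> \<G> \<subseteq> \<F> \<Longrightarrow> proper_chain \<G>"
  unfolding proper_chain_def by (metis subsetD)

definition cone_of :: "'e::finite set set \<Rightarrow> 'e tspace set" where
  "cone_of \<F> = convex_cone hull (ray ` \<F>)"

lemma chain_cone_eq_cone_of: "chain_cone Fs = cone_of (set Fs)"
  by (simp add: chain_cone_def cone_of_def)

lemma convex_cone_sum:
  assumes "convex_cone S" "\<And>i. i \<in> I \<Longrightarrow> f i \<in> S"
  shows "sum f I \<in> S"
  using assms(2)
proof (induction I rule: infinite_finite_induct)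
  case (insert x F)
  then show ?case using convex_cone_add[OF assms(1)] by simp
qed (simp_all add: convex_cone_contains_0[OF assms(1)])

lemma ray_in_cone_of: "F \<in> \<F> \<Longrightarrow> ray F \<in> cone_of \<F>"
  unfolding cone_of_def by (rule hull_inc) simp

lemma convex_cone_cone_of: "convex_cone (cone_of \<F>)"
  unfolding cone_of_def by (rule convex_cone_convex_cone_hull)

lemma cone_of_mono: "\<F> \<subseteq> \<G> \<Longrightarrow> cone_of \<F> \<subseteq> cone_of \<G>"
  unfolding cone_of_def by (rule hull_mono) blast

lemma cone_of_eq: "cone_of \<F> = {(\<Sum>F\<in>\<F>. c F *\<^sub>R ray F) |c. \<forall>F\<in>\<F>. 0 \<le> c F}"
proof (rule equalityI)
  let ?C = "{(\<Sum>F\<in>\<F>. c F *\<^sub>R ray F) |c. \<forall>F\<in>\<F>. 0 \<le> c F}"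
  show "?C \<subseteq> cone_of \<F>"
    by (auto intro!: convex_cone_sum[OF convex_cone_cone_of] convex_cone_scaleR[OF convex_cone_cone_of]
        ray_in_cone_of)
  show "cone_of \<F> \<subseteq> ?C" unfolding cone_of_def
  proof (rule hull_minimal)
    show "ray ` \<F> \<subseteq> ?C"
    proof
      fix x assume "x \<in> ray ` \<F>"
      then obtain F where F: "F \<in> \<F>" "x = ray F" by blast
      then have "x = (\<Sum>G\<in>\<F>. of_bool (G = F) *\<^sub>R ray G)"
        by (simp add: of_bool_def if_distrib[of "\<lambda>c. c *\<^sub>R _"] sum.delta cong: if_cong)
      then show "x \<in> ?C" by (intro CollectI exI[of _ "\<lambda>G. of_bool (G = F)"]) simp
    qed
    show "convex_cone ?C"
      unfolding convex_cone_iff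
    proof (intro conjI ballI allI impI)
      show "0 \<in> ?C" by (intro CollectI exI[of _ "\<lambda>_. 0"]) simp
    next
      fix x y assume "x \<in> ?C" "y \<in> ?C"
      then obtain c d where "\<forall>F\<in>\<F>. 0 \<le> c F" "\<forall>F\<in>\<F>. 0 \<le> d F"
        "x = (\<Sum>F\<in>\<F>. c F *\<^sub>R ray F)" "y = (\<Sum>F\<in>\<F>. d F *\<^sub>R ray F)" by auto
      then show "x + y \<in> ?C"
        by (intro CollectI exI[of _ "\<lambda>F. c F + d F"]) (simp add: scaleR_add_left sum.distrib)
    next
      fix x and a :: real assume "x \<in> ?C" "0 \<le> a"
      then obtain c where "\<forall>F\<in>\<F>. 0 \<le> c F" "x = (\<Sum>F\<in>\<F>. c F *\<^sub>R ray F)" by auto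
      then show "a *\<^sub>R x \<in> ?C" using \<open>0 \<le> a\<close>
        by (intro CollectI exI[of _ "\<lambda>F. a * c F"]) (simp add: scaleR_sum_right)
    qed
  qed
qed

lemma cone_ofE:
  assumes "x \<in> cone_of \<F>"
  obtains c where "\<And>F. F \<in> \<F> \<Longrightarrow> 0 \<le> c F" "x = (\<Sum>F\<in>\<F>. c F *\<^sub>R ray F)"
  using assms unfolding cone_of_eq by blast

lemma tdiff_sum: "tdiff i j (\<Sum>F\<in>\<F>. c F *\<^sub>R ray F) = (\<Sum>F\<in>\<F>. c F * (of_bool (i \<in> F) - of_bool (j \<in> F)))"
proof -
  have "tdiff i j (\<Sum>F\<in>\<F>. c F *\<^sub>R ray F) = (\<Sum>F\<in>\<F>. tdiff i j (c F *\<^sub>R ray F))"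
    by (rule linear_sum[OF linear_tdiff])
  also have "\<dots> = (\<Sum>F\<in>\<F>. c F * (of_bool (i \<in> F) - of_bool (j \<in> F)))"
    by (simp add: linear_cmul[OF linear_tdiff])
  finally show ?thesis .
qed

text \<open>The proper upper level sets of a representative of \<open>x\<close>.\<close>

definition levels :: "'e::finite tspace \<Rightarrow> 'e set set" where
  "levels x = {F. F \<noteq> {} \<and> F \<noteq> UNIV \<and> (\<forall>i\<in>F. \<forall>j\<in>- F. 0 < tdiff i j x)}"

text \<open>For \<open>i\<close> in a member \<open>F\<close> and \<open>j\<close> outside it, no
  member of the chain contains \<open>j\<close> without \<open>i\<close>, so all terms of
  \<open>tdiff i j\<close> are nonnegative and that of \<open>F\<close> counts. Conversely, a level
  set must be a member: it is the one separating its lowest element from the highest element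
  outside.\<close>

lemma levels_cone:
  assumes \<F>: "proper_chain \<F>" and c: "\<And>F. F \<in> \<F> \<Longrightarrow> 0 \<le> c F"
  shows "levels (\<Sum>F\<in>\<F>. c F *\<^sub>R ray F) = {F \<in> \<F>. 0 < c F}" (is "levels ?x = _")
proof (rule equalityI; rule subsetI)
  fix F assume "F \<in> {F \<in> \<F>. 0 < c F}"
  then have F: "F \<in> \<F>" "0 < c F" by auto
  have "0 < tdiff i j ?x" if ij: "i \<in> F" "j \<notin> F" for i j
    unfolding tdiff_sum
  proof (rule sum_pos2)
    show "finite \<F>" "F \<in> \<F>" using F by auto
    show "0 < c F * (of_bool (i \<in> F) - of_bool (j \<in> F))" using F ij by simp
    show "0 \<le> c G * (of_bool (i \<in> G) - of_bool (j \<in> G))" if G: "G \<in> \<F>" for G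
      using proper_chainD(3)[OF \<F> F(1) G] c[OF G] ij by auto
  qed
  then show "F \<in> levels ?x"
    using proper_chainD(1,2)[OF \<F> F(1)] unfolding levels_def by simp
next
  fix G assume "G \<in> levels ?x"
  then have G: "G \<noteq> {}" "G \<noteq> UNIV" "\<And>i j. i \<in> G \<Longrightarrow> j \<notin> G \<Longrightarrow> 0 < tdiff i j ?x"
    unfolding levels_def by auto
  define h where "h i = (\<Sum>F\<in>\<F>. c F * of_bool (i \<in> F))" for i
  have td: "tdiff i j ?x = h i - h j" for i j
    unfolding tdiff_sum h_def by (simp add: right_diff_distrib sum_subtractf)
  \<comment> \<open>\<open>h\<close> is the representative given by the combination;
    \<open>i0\<close> is lowest in \<open>G\<close>, and \<open>j0\<close> below is highest outside
    \<open>G\<close>. A positive member between them can neither miss a point of \<open>G\<close>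
    nor contain one outside.\<close>
  define i0 where "i0 = arg_min_on h G"
  have i0: "i0 \<in> G" "\<And>i. i \<in> G \<Longrightarrow> h i0 \<le> h i"
    unfolding i0_def using G(1) by (auto intro: arg_min_if_finite(1) arg_min_least)
  define j0 where "j0 = arg_min_on (\<lambda>j. - h j) (- G)"
  have ne: "- G \<noteq> {}" using G(2) by auto
  have j0: "j0 \<notin> G" "\<And>j. j \<notin> G \<Longrightarrow> h j \<le> h j0"
    unfolding j0_def using ne arg_min_if_finite(1)[of "- G" "\<lambda>j. - h j"] arg_min_least[of "- G" _ "\<lambda>j. - h j"]
    by auto
  have "\<exists>F\<in>\<F>. 0 < c F * (of_bool (i0 \<in> F) - of_bool (j0 \<in> F))"
  proof (rule ccontr)
    assume "\<not> ?thesis"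
    then have "tdiff i0 j0 ?x \<le> 0" unfolding tdiff_sum by (intro sum_nonpos) (auto simp: not_less)
    then show False using G(3)[OF i0(1) j0(1)] by simp
  qed
  then obtain F where F: "F \<in> \<F>" "0 < c F * (of_bool (i0 \<in> F) - of_bool (j0 \<in> F))" by blast
  then have F': "0 < c F" "i0 \<in> F" "j0 \<notin> F"
    using c[OF F(1)] by (auto simp: of_bool_def split: if_splits)
  have "G \<subseteq> F"
  proof (rule ccontr)
    assume "\<not> G \<subseteq> F"
    then obtain i where i: "i \<in> G" "i \<notin> F" by blast
    have "0 < tdiff i0 i ?x" unfolding tdiff_sum
    proof (rule sum_pos2)
      show "finite \<F>" "F \<in> \<F>" using F by auto
      show "0 < c F * (of_bool (i0 \<in> F) - of_bool (i \<in> F))" using F' i by simp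
      show "0 \<le> c H * (of_bool (i0 \<in> H) - of_bool (i \<in> H))" if H: "H \<in> \<F>" for H
        using proper_chainD(3)[OF \<F> F(1) H] c[OF H] F' i by auto
    qed
    then show False using i0(2)[OF i(1)] td by simp
  qed
  moreover have "F \<subseteq> G"
  proof (rule ccontr)
    assume "\<not> F \<subseteq> G"
    then obtain j where j: "j \<in> F" "j \<notin> G" by blast
    have "0 < tdiff j j0 ?x" unfolding tdiff_sum
    proof (rule sum_pos2)
      show "finite \<F>" "F \<in> \<F>" using F by auto
      show "0 < c F * (of_bool (j \<in> F) - of_bool (j0 \<in> F))" using F' j by simp
      show "0 \<le> c H * (of_bool (j \<in> H) - of_bool (j0 \<in> H))" if H: "H \<in> \<F>" for H
        using proper_chainD(3)[OF \<F> F(1) H] c[OF H] F' j by auto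
    qed
    then show False using j0(2)[OF j(2)] td by simp
  qed
  ultimately show "G \<in> {F \<in> \<F>. 0 < c F}" using F F' by auto
qed

text \<open>Take \<open>i\<close> in \<open>F\<close> outside all smaller members and
  \<open>j\<close> outside \<open>F\<close> in all larger ones: then \<open>F\<close> is the only
  member containing exactly one of the two. These dual functionals yield independence of the rays
  and integrality of coefficients.\<close>

lemma chain_dual_functional:
  assumes \<F>: "proper_chain \<F>" and F: "F \<in> \<F>"
  shows "\<exists>i j. \<forall>G\<in>\<F>. tdiff i j (ray G) = of_bool (G = F)"
proof -
  have fin: "finite \<F>" by simp
  obtain i where i: "i \<in> F" "i \<notin> \<Union>{G \<in> \<F>. G \<subset> F}"
  proof -
    have "\<Union>{G \<in> \<F>. G \<subset> F} \<noteq> F"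
    proof (cases "{G \<in> \<F>. G \<subset> F} = {}")
      case True
      show ?thesis unfolding True using proper_chainD(1)[OF \<F> F] by simp
    next
      case False
      then have "\<Union>{G \<in> \<F>. G \<subset> F} \<in> {G \<in> \<F>. G \<subset> F}"
        using proper_chainD(3)[OF \<F>] by (intro chain_Union_mem) auto
      then show ?thesis by blast
    qed
    moreover have "\<Union>{G \<in> \<F>. G \<subset> F} \<subseteq> F" by blast
    ultimately show ?thesis using that by blast
  qed
  obtain j where j: "j \<notin> F" "j \<in> \<Inter>{G \<in> \<F>. F \<subset> G}"
  proof -
    have "\<Inter>{G \<in> \<F>. F \<subset> G} \<noteq> F"
    proof (cases "{G \<in> \<F>. F \<subset> G} = {}")
      case True
      show ?thesis unfolding True using proper_chainD(2)[OF \<F> F] by simp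
    next
      case False
      then have "\<Inter>{G \<in> \<F>. F \<subset> G} \<in> {G \<in> \<F>. F \<subset> G}"
        using proper_chainD(3)[OF \<F>] by (intro chain_Inter_mem) auto
      then show ?thesis by blast
    qed
    moreover have "F \<subseteq> \<Inter>{G \<in> \<F>. F \<subset> G}" by blast
    ultimately show ?thesis using that by blast
  qed
  have "tdiff i j (ray G) = of_bool (G = F)" if G: "G \<in> \<F>" for G
  proof -
    consider "G = F" | "G \<subset> F" | "F \<subset> G" using proper_chainD(3)[OF \<F> F G] by blast
    then show ?thesis
    proof cases
      case 2
      then have "i \<notin> G" "j \<notin> G" using i j G by auto
      then show ?thesis using 2 by auto
    next
      case 3
      then have "i \<in> G" "j \<in> G" using i j G by auto
      then show ?thesis using 3 by auto
    qed (use i j in auto)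
  qed
  then show ?thesis by blast
qed

lemma chain_rays_independent:
  assumes \<F>: "proper_chain \<F>"
  shows "independent (ray ` \<F>)" "inj_on ray \<F>"
proof -
  show inj: "inj_on ray \<F>"
  proof (rule inj_onI)
    fix F G assume FG: "F \<in> \<F>" "G \<in> \<F>" "ray F = ray G"
    obtain i j where "\<forall>G\<in>\<F>. tdiff i j (ray G) = of_bool (G = F)"
      using chain_dual_functional[OF \<F> FG(1)] by blast
    then show "F = G" using FG by (metis of_bool_eq_1_iff)
  qed
  show "independent (ray ` \<F>)"
  proof (rule independent_if_scalars_zero)
    fix f x assume sum0: "(\<Sum>x\<in>ray ` \<F>. f x *\<^sub>R x) = 0" and "x \<in> ray ` \<F>"
    then obtain F where F: "F \<in> \<F>" "x = ray F" by blast
    obtain i j where ij: "\<forall>G\<in>\<F>. tdiff i j (ray G) = of_bool (G = F)"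
      using chain_dual_functional[OF \<F> F(1)] by blast
    have "0 = tdiff i j (\<Sum>G\<in>\<F>. f (ray G) *\<^sub>R ray G)"
      using sum0 by (simp add: sum.reindex[OF inj] linear_0[OF linear_tdiff])
    also have "\<dots> = (\<Sum>G\<in>\<F>. f (ray G) * tdiff i j (ray G))"
      by (simp only: linear_sum[OF linear_tdiff] linear_cmul[OF linear_tdiff] real_scaleR_def)
    also have "\<dots> = (\<Sum>G\<in>\<F>. if G = F then f (ray F) else 0)"
      by (rule sum.cong[OF refl]) (use ij in simp)
    finally show "f x = 0" using F by simp
  qed simp
qed

lemma span_cone_of: "span (cone_of \<F>) = span (ray ` \<F>)"
proof (rule equalityI)
  have "cone_of \<F> \<subseteq> span (ray ` \<F>)" unfolding cone_of_def
    by (rule hull_minimal) (auto intro: span_base subspace_imp_convex_cone subspace_span)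
  then show "span (cone_of \<F>) \<subseteq> span (ray ` \<F>)" by (metis span_mono span_span)
  show "span (ray ` \<F>) \<subseteq> span (cone_of \<F>)" by (rule span_mono) (auto intro: ray_in_cone_of)
qed

lemma dim_cone_of: "proper_chain \<F> \<Longrightarrow> dim (cone_of \<F>) = card \<F>"
  using chain_rays_independent[of \<F>]
  by (metis card_image dim_eq_card span_cone_of)

text \<open>The members with positive coefficient can be read off from the point alone. Hence the
  smallest cone through \<open>x\<close> is the same for every chain, which gives inclusions and
  intersections of cones.\<close>

lemma levels_cone_of:
  assumes "proper_chain \<F>" "x \<in> cone_of \<F>"
  shows "levels x \<subseteq> \<F>" "x \<in> cone_of (levels x)"
proof -
  obtain c where c: "\<And>F. F \<in> \<F> \<Longrightarrow> 0 \<le> c F" "x = (\<Sum>F\<in>\<F>. c F *\<^sub>R ray F)"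
    using cone_ofE[OF assms(2)] by blast
  have lev: "levels x = {F \<in> \<F>. 0 < c F}" unfolding c(2) by (rule levels_cone[OF assms(1) c(1)])
  then show "levels x \<subseteq> \<F>" by blast
  have "x = (\<Sum>F\<in>levels x. c F *\<^sub>R ray F)"
    unfolding c(2) lev[unfolded c(2)]
    by (rule sum.mono_neutral_right) (use c(1) in \<open>auto simp: order.order_iff_strict\<close>)
  then show "x \<in> cone_of (levels x)"
    unfolding cone_of_eq using lev by (intro CollectI exI[of _ c]) auto
qed

lemma levels_ray: "F \<noteq> {} \<Longrightarrow> F \<noteq> UNIV \<Longrightarrow> levels (ray F) = {F}"
  using levels_cone[of "{F}" "\<lambda>_. 1"] by (simp add: proper_chain_def)

lemma cone_of_subset_iff:
  assumes "proper_chain \<F>" "proper_chain \<G>"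
  shows "cone_of \<F> \<subseteq> cone_of \<G> \<longleftrightarrow> \<F> \<subseteq> \<G>"
proof
  assume *: "cone_of \<F> \<subseteq> cone_of \<G>"
  show "\<F> \<subseteq> \<G>"
  proof
    fix F assume F: "F \<in> \<F>"
    then have "levels (ray F) \<subseteq> \<G>" using levels_cone_of(1)[OF assms(2)] ray_in_cone_of * by blast
    then show "F \<in> \<G>" using levels_ray proper_chainD(1,2)[OF assms(1) F] by blast
  qed
qed (rule cone_of_mono)

lemma cone_of_inj: "proper_chain \<F> \<Longrightarrow> proper_chain \<G> \<Longrightarrow> cone_of \<F> = cone_of \<G> \<Longrightarrow> \<F> = \<G>"
  using cone_of_subset_iff by (metis order_refl subset_antisym)

lemma cone_of_Int:
  assumes "proper_chain \<F>" "proper_chain \<G>"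
  shows "cone_of \<F> \<inter> cone_of \<G> = cone_of (\<F> \<inter> \<G>)"
proof (rule equalityI; rule subsetI)
  fix x assume "x \<in> cone_of \<F> \<inter> cone_of \<G>"
  then have x: "x \<in> cone_of \<F>" "x \<in> cone_of \<G>" by auto
  have "levels x \<subseteq> \<F> \<inter> \<G>"
    using levels_cone_of(1)[OF assms(1) x(1)] levels_cone_of(1)[OF assms(2) x(2)] by blast
  then show "x \<in> cone_of (\<F> \<inter> \<G>)" using levels_cone_of(2)[OF assms(1) x(1)] cone_of_mono by blast
next
  fix x assume "x \<in> cone_of (\<F> \<inter> \<G>)"
  then show "x \<in> cone_of \<F> \<inter> cone_of \<G>"
    using cone_of_mono[of "\<F> \<inter> \<G>" \<F>] cone_of_mono[of "\<F> \<inter> \<G>" \<G>] by blast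
qed

lemma cone_of_face:
  assumes \<F>: "proper_chain \<F>" and "\<G> \<subseteq> \<F>"
  shows "cone_of \<G> face_of cone_of \<F>"
  unfolding face_of_def
proof (intro conjI ballI impI)
  show "cone_of \<G> \<subseteq> cone_of \<F>" using assms(2) by (rule cone_of_mono)
  show "convex (cone_of \<G>)" unfolding cone_of_def by (rule convex_convex_cone_hull)
  fix a b x assume ab: "a \<in> cone_of \<F>" "b \<in> cone_of \<F>" and x: "x \<in> cone_of \<G>" "x \<in> open_segment a b"
  obtain c where c: "\<And>F. F \<in> \<F> \<Longrightarrow> 0 \<le> c F" "a = (\<Sum>F\<in>\<F>. c F *\<^sub>R ray F)" using cone_ofE[OF ab(1)] by blast
  obtain d where d: "\<And>F. F \<in> \<F> \<Longrightarrow> 0 \<le> d F" "b = (\<Sum>F\<in>\<F>. d F *\<^sub>R ray F)" using cone_ofE[OF ab(2)] by blast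
  obtain t where t: "0 < t" "t < 1" "x = (1 - t) *\<^sub>R a + t *\<^sub>R b" using x(2) by (auto simp: in_segment)
  have "x = (\<Sum>F\<in>\<F>. ((1 - t) * c F + t * d F) *\<^sub>R ray F)"
    unfolding t(3) c(2) d(2) by (simp add: scaleR_sum_right scaleR_add_left sum.distrib)
  then have "levels x = {F \<in> \<F>. 0 < (1 - t) * c F + t * d F}"
    using levels_cone[OF \<F>, of "\<lambda>F. (1 - t) * c F + t * d F"] c(1) d(1) t by simp
  moreover have "levels x \<subseteq> \<G>" using levels_cone_of(1)[OF proper_chain_subset[OF \<F> assms(2)] x(1)] .
  ultimately have zero: "(1 - t) * c F + t * d F \<le> 0" if "F \<in> \<F>" "F \<notin> \<G>" for F
    using that by (auto simp: not_less)
  have zero: "c F = 0" "d F = 0" if F: "F \<in> \<F>" "F \<notin> \<G>" for F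
  proof -
    have "0 \<le> (1 - t) * c F" "0 \<le> t * d F" using c(1)[OF F(1)] d(1)[OF F(1)] t by auto
    then have "(1 - t) * c F = 0" "t * d F = 0" using zero[OF F] by linarith+
    then show "c F = 0" "d F = 0" using t by auto
  qed
  have "a = (\<Sum>F\<in>\<G>. c F *\<^sub>R ray F)" unfolding c(2)
    by (rule sum.mono_neutral_right) (use zero assms(2) in auto)
  then show "a \<in> cone_of \<G>" unfolding cone_of_eq using c(1) assms(2) by (intro CollectI exI[of _ c]) auto
  have "b = (\<Sum>F\<in>\<G>. d F *\<^sub>R ray F)" unfolding d(2)
    by (rule sum.mono_neutral_right) (use zero assms(2) in auto)
  then show "b \<in> cone_of \<G>" unfolding cone_of_eq using d(1) assms(2) by (intro CollectI exI[of _ d]) auto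
qed

text \<open>A nonzero \<open>x\<close> lies strictly between \<open>0\<close> and
  \<open>2 *\<^sub>R x\<close>, so a nonempty face contains \<open>0\<close> and is closed under
  scaling; sums are doubled midpoints. The second claim is the face property for the midpoint of
  \<open>a\<close> and \<open>b\<close>.\<close>

lemma face_of_convex_cone:
  assumes C: "convex_cone C" and "\<tau> face_of C" "\<tau> \<noteq> {}"
  shows "convex_cone \<tau>" and "a \<in> C \<Longrightarrow> b \<in> C \<Longrightarrow> a + b \<in> \<tau> \<Longrightarrow> a \<in> \<tau>"
proof -
  have sub: "\<tau> \<subseteq> C" "convex \<tau>" using assms(2) by (auto simp: face_of_def)
  have seg: "a \<in> \<tau> \<and> b \<in> \<tau>" if "a \<in> C" "b \<in> C" "x \<in> \<tau>" "x \<in> open_segment a b" for a b x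
    using assms(2) that by (auto simp: face_of_def)
  have double: "2 *\<^sub>R x \<in> \<tau> \<and> 0 \<in> \<tau>" if x: "x \<in> \<tau>" for x
  proof (cases "x = 0")
    case False
    then have "x \<in> open_segment (2 *\<^sub>R x) 0"
      unfolding in_segment by (auto intro!: exI[of _ "1/2"])
    moreover have "2 *\<^sub>R x \<in> C" "0 \<in> C"
      using sub(1) x convex_cone_scaleR[OF C, of 2] convex_cone_contains_0[OF C] by auto
    ultimately show ?thesis using seg x by blast
  qed (use x in simp)
  have zero: "0 \<in> \<tau>" using double assms(3) by blast
  have scale: "c *\<^sub>R x \<in> \<tau>" if x: "x \<in> \<tau>" and c: "0 \<le> c" for x c
  proof (cases "x = 0 \<or> c \<le> 1")
    case True
    have "(1 - c) *\<^sub>R 0 + c *\<^sub>R x \<in> \<tau>" if "c \<le> 1"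
      using convexD[OF sub(2) zero x, of "1 - c" c] that c by simp
    then show ?thesis using True zero by auto
  next
    case False
    then have "x \<in> open_segment 0 (c *\<^sub>R x)"
      unfolding in_segment by (auto intro!: exI[of _ "1 / c"])
    moreover have "c *\<^sub>R x \<in> C" "0 \<in> C"
      using sub(1) x convex_cone_scaleR[OF C c] convex_cone_contains_0[OF C] by auto
    ultimately show ?thesis using seg x by blast
  qed
  have add: "x + y \<in> \<tau>" if "x \<in> \<tau>" "y \<in> \<tau>" for x y
  proof -
    have "(1/2) *\<^sub>R x + (1/2) *\<^sub>R y \<in> \<tau>" using convexD[OF sub(2) that, of "1/2" "1/2"] by simp
    then have "2 *\<^sub>R ((1/2) *\<^sub>R x + (1/2) *\<^sub>R y) \<in> \<tau>" by (rule scale) simp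
    then show ?thesis by (simp add: scaleR_add_right)
  qed
  show "convex_cone \<tau>" unfolding convex_cone_iff using zero add scale by blast
  show "a \<in> \<tau>" if ab: "a \<in> C" "b \<in> C" "a + b \<in> \<tau>"
  proof (cases "a = b")
    case True
    then have "a = (1/2) *\<^sub>R (a + b)" by (simp add: scaleR_2[symmetric])
    then show ?thesis using scale[OF ab(3), of "1/2"] by simp
  next
    case False
    have "(1/2) *\<^sub>R (a + b) \<in> \<tau>" using scale[OF ab(3), of "1/2"] by simp
    moreover have "(1/2) *\<^sub>R (a + b) \<in> open_segment a b"
      using False unfolding in_segment by (intro conjI exI[of _ "1/2"]) (auto simp: scaleR_add_right)
    ultimately show ?thesis using seg ab by blast
  qed
qed

text \<open>A point of the face is the sum of one of its terms and the rest, both in the cone, so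
  every ray with positive coefficient belongs to the face.\<close>

lemma face_of_cone_of:
  assumes "\<tau> face_of cone_of \<F>" "\<tau> \<noteq> {}"
  shows "\<tau> = cone_of {F \<in> \<F>. ray F \<in> \<tau>}"
proof (rule equalityI)
  note \<tau> = face_of_convex_cone[OF convex_cone_cone_of assms]
  show "cone_of {F \<in> \<F>. ray F \<in> \<tau>} \<subseteq> \<tau>" unfolding cone_of_def
    by (rule hull_minimal) (use \<tau>(1) in auto)
  show "\<tau> \<subseteq> cone_of {F \<in> \<F>. ray F \<in> \<tau>}"
  proof
    fix x assume x: "x \<in> \<tau>"
    then have "x \<in> cone_of \<F>" using assms(1) by (auto simp: face_of_def)
    then obtain c where c: "\<And>F. F \<in> \<F> \<Longrightarrow> 0 \<le> c F" "x = (\<Sum>F\<in>\<F>. c F *\<^sub>R ray F)"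
      using cone_ofE by blast
    have "ray F \<in> \<tau>" if F: "F \<in> \<F>" "c F \<noteq> 0" for F
    proof -
      have "x = c F *\<^sub>R ray F + (\<Sum>G\<in>\<F> - {F}. c G *\<^sub>R ray G)"
        unfolding c(2) using F by (simp add: sum.remove)
      moreover have "c F *\<^sub>R ray F \<in> cone_of \<F>"
        using F c(1) ray_in_cone_of convex_cone_scaleR[OF convex_cone_cone_of] by blast
      moreover have "(\<Sum>G\<in>\<F> - {F}. c G *\<^sub>R ray G) \<in> cone_of \<F>"
        using c(1) by (auto intro!: convex_cone_sum[OF convex_cone_cone_of]
            convex_cone_scaleR[OF convex_cone_cone_of] ray_in_cone_of)
      ultimately have "c F *\<^sub>R ray F \<in> \<tau>" using \<tau>(2) x by metis
      then have "(1 / c F) *\<^sub>R (c F *\<^sub>R ray F) \<in> \<tau>"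
        by (rule convex_cone_scaleR[OF \<tau>(1), rotated]) (use c(1)[OF F(1)] in simp)
      then show ?thesis using F by simp
    qed
    then have "x = (\<Sum>F\<in>{F \<in> \<F>. ray F \<in> \<tau>}. c F *\<^sub>R ray F)"
      unfolding c(2) by (intro sum.mono_neutral_right) auto
    then show "x \<in> cone_of {F \<in> \<F>. ray F \<in> \<tau>}"
      unfolding cone_of_eq using c(1) by (intro CollectI exI[of _ c]) auto
  qed
qed

section \<open>The lattice and the fans of chains\<close>

lemma ray_in_tlattice: "ray F \<in> tlattice"
  unfolding tlattice_def by (intro CollectI exI[of _ "e_vec F"]) (simp add: of_bool_def)

lemma tlattice_add: "x \<in> tlattice \<Longrightarrow> y \<in> tlattice \<Longrightarrow> x + y \<in> tlattice"
  unfolding tlattice_def by (force simp: mod_one_add[symmetric])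

lemma tlattice_scale: "x \<in> tlattice \<Longrightarrow> of_int m *\<^sub>R x \<in> tlattice"
  unfolding tlattice_def by (force simp: mod_one_scaleR[symmetric])

lemma tdiff_tlattice: "x \<in> tlattice \<Longrightarrow> tdiff i j x \<in> \<int>"
  unfolding tlattice_def by auto

text \<open>The dual functional of \<open>F\<close> vanishes on the span of the facet, takes the
  value 1 at \<open>ray F\<close> and is integral on the lattice. Thus the coefficient of
  \<open>ray F\<close> in a lattice point is an integer.\<close>

lemma chain_lattice_normal:
  assumes chain: "proper_chain (insert F \<G>)" and F: "F \<notin> \<G>"
  shows "lattice_normal tlattice (cone_of \<G>) (cone_of (insert F \<G>)) (ray F)"
  unfolding lattice_normal_def
proof (rule conjI)
  show "ray F \<in> cone_of (insert F \<G>)" by (rule ray_in_cone_of) simp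
  obtain i j where ij: "\<forall>G\<in>insert F \<G>. tdiff i j (ray G) = of_bool (G = F)"
    using chain_dual_functional[OF chain, of F] by blast
  show "tlattice \<inter> span (cone_of (insert F \<G>)) =
    {of_int m *\<^sub>R ray F + t |m t. t \<in> tlattice \<inter> span (cone_of \<G>)}"
  proof (rule equalityI; rule subsetI)
    fix x assume "x \<in> tlattice \<inter> span (cone_of (insert F \<G>))"
    then have x: "x \<in> tlattice" "x \<in> span (insert (ray F) (ray ` \<G>))" by (auto simp: span_cone_of)
    then obtain a where a: "x - a *\<^sub>R ray F \<in> span (ray ` \<G>)" using span_breakdown_eq by blast
    have "tdiff i j y = 0" if "y \<in> span (ray ` \<G>)" for y
    proof -
      have "subspace {y. tdiff i j y = 0}"
        by (auto simp: subspace_def linear_0[OF linear_tdiff] linear_add[OF linear_tdiff] linear_cmul[OF linear_tdiff])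
      moreover have "ray ` \<G> \<subseteq> {y. tdiff i j y = 0}" using ij F by auto
      ultimately show ?thesis using that span_minimal by blast
    qed
    then have "tdiff i j (x - a *\<^sub>R ray F) = 0" using a by blast
    then have "tdiff i j x = a"
      using ij by (simp add: linear_diff[OF linear_tdiff] linear_cmul[OF linear_tdiff] del: tdiff_mod_one)
    then obtain m where m: "a = of_int m" using tdiff_tlattice[OF x(1), of i j] by (auto elim: Ints_cases)
    have "x - of_int m *\<^sub>R ray F \<in> tlattice"
      using tlattice_add[OF x(1) tlattice_scale[OF ray_in_tlattice, of "- m" F]] by simp
    then show "x \<in> {of_int m *\<^sub>R ray F + t |m t. t \<in> tlattice \<inter> span (cone_of \<G>)}"
      using a m by (intro CollectI exI[of _ m] exI[of _ "x - of_int m *\<^sub>R ray F"]) (auto simp: span_cone_of)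
  next
    fix x assume "x \<in> {of_int m *\<^sub>R ray F + t |m t. t \<in> tlattice \<inter> span (cone_of \<G>)}"
    then obtain m t where x: "x = of_int m *\<^sub>R ray F + t" "t \<in> tlattice" "t \<in> span (ray ` \<G>)"
      by (auto simp: span_cone_of)
    have "t \<in> span (ray ` insert F \<G>)" using x(3) span_mono[of "ray ` \<G>" "ray ` insert F \<G>"] by blast
    moreover have "ray F \<in> span (ray ` insert F \<G>)" by (rule span_base) simp
    ultimately have "x \<in> span (ray ` insert F \<G>)" unfolding x(1) by (intro span_add span_scale)
    then show "x \<in> tlattice \<inter> span (cone_of (insert F \<G>))"
      using x(1,2) tlattice_add[OF tlattice_scale[OF ray_in_tlattice]] by (simp add: span_cone_of)
  qed
qed

text \<open>With \<open>\<Phi> = flats M\<close> this is the skeleton of the Bergman fan, with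
  \<open>\<Phi> = UNIV\<close> that of the braid fan. One construction serves both.\<close>

definition chain_fan :: "'e::finite set set \<Rightarrow> nat \<Rightarrow> 'e tspace set set" where
  "chain_fan \<Phi> k = {cone_of \<F> |\<F>. proper_chain \<F> \<and> \<F> \<subseteq> \<Phi> \<and> card \<F> \<le> k}"

lemma rational_chain_fan: "rational_fan tlattice (chain_fan \<Phi> k)"
  unfolding rational_fan_def
proof (intro conjI ballI allI impI)
  have "chain_fan \<Phi> k \<subseteq> range cone_of" unfolding chain_fan_def by blast
  then show "finite (chain_fan \<Phi> k)" by (rule finite_subset) simp
next
  fix \<sigma> assume "\<sigma> \<in> chain_fan \<Phi> k"
  then obtain \<F> where "\<sigma> = cone_of \<F>" unfolding chain_fan_def by blast
  then show "rational_cone tlattice \<sigma>" unfolding rational_cone_def cone_of_def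
    by (intro exI[of _ "ray ` \<F>"]) (auto simp: ray_in_tlattice)
next
  fix \<sigma> \<tau> assume \<sigma>: "\<sigma> \<in> chain_fan \<Phi> k" and \<tau>: "\<tau> face_of \<sigma> \<and> \<tau> \<noteq> {}"
  obtain \<F> where \<F>: "\<sigma> = cone_of \<F>" "proper_chain \<F>" "\<F> \<subseteq> \<Phi>" "card \<F> \<le> k"
    using \<sigma> unfolding chain_fan_def by blast
  have sub: "{F \<in> \<F>. ray F \<in> \<tau>} \<subseteq> \<F>" by blast
  have "\<tau> = cone_of {F \<in> \<F>. ray F \<in> \<tau>}" using face_of_cone_of \<tau> \<F>(1) by blast
  moreover have "proper_chain {F \<in> \<F>. ray F \<in> \<tau>}" using proper_chain_subset[OF \<F>(2) sub] .
  moreover have "{F \<in> \<F>. ray F \<in> \<tau>} \<subseteq> \<Phi>" using sub \<F>(3) by blast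
  moreover have "card {F \<in> \<F>. ray F \<in> \<tau>} \<le> k"
    using card_mono[OF _ sub] \<F>(4) by (meson finite le_trans)
  ultimately show "\<tau> \<in> chain_fan \<Phi> k" unfolding chain_fan_def by blast
next
  fix \<sigma> \<tau> assume \<sigma>: "\<sigma> \<in> chain_fan \<Phi> k" and \<tau>: "\<tau> \<in> chain_fan \<Phi> k"
  obtain \<F> where \<F>: "\<sigma> = cone_of \<F>" "proper_chain \<F>" using \<sigma> unfolding chain_fan_def by blast
  obtain \<G> where \<G>: "\<tau> = cone_of \<G>" "proper_chain \<G>" using \<tau> unfolding chain_fan_def by blast
  show "(\<sigma> \<inter> \<tau>) face_of \<sigma>" "(\<sigma> \<inter> \<tau>) face_of \<tau>"
    unfolding \<F>(1) \<G>(1) cone_of_Int[OF \<F>(2) \<G>(2)]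
    by (rule cone_of_face[OF \<F>(2)], blast, rule cone_of_face[OF \<G>(2)], blast)
qed

lemma top_cones_chain_fan:
  "top_cones k (chain_fan \<Phi> k) = {cone_of \<F> |\<F>. proper_chain \<F> \<and> \<F> \<subseteq> \<Phi> \<and> card \<F> = k}"
  unfolding top_cones_def chain_fan_def using dim_cone_of by fastforce

lemma pure_chain_fanI:
  assumes "\<And>\<F>. \<lbrakk>proper_chain \<F>; \<F> \<subseteq> \<Phi>; card \<F> < k\<rbrakk> \<Longrightarrow>
      \<exists>F. F \<notin> \<F> \<and> F \<in> \<Phi> \<and> proper_chain (insert F \<F>)"
  shows "pure_fan k (chain_fan \<Phi> k)"
proof -
  have "\<exists>\<G>. proper_chain \<G> \<and> \<G> \<subseteq> \<Phi> \<and> card \<G> = k \<and> \<F> \<subseteq> \<G>"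
    if "proper_chain \<F>" "\<F> \<subseteq> \<Phi>" "card \<F> \<le> k" for \<F>
    using that
  proof (induction "k - card \<F>" arbitrary: \<F>)
    case 0
    then show ?case by auto
  next
    case (Suc n)
    then obtain F where F: "F \<notin> \<F>" "F \<in> \<Phi>" "proper_chain (insert F \<F>)"
      using assms[of \<F>] by (metis diff_is_0_eq nat.simps(3) not_le)
    then have "\<exists>\<G>. proper_chain \<G> \<and> \<G> \<subseteq> \<Phi> \<and> card \<G> = k \<and> insert F \<F> \<subseteq> \<G>"
      using Suc by (intro Suc.hyps(1)) auto
    then show ?case by blast
  qed
  note extend = this
  show ?thesis unfolding pure_fan_def
  proof
    fix \<tau> assume "\<tau> \<in> chain_fan \<Phi> k"
    then obtain \<F> where \<F>: "\<tau> = cone_of \<F>" "proper_chain \<F>" "\<F> \<subseteq> \<Phi>" "card \<F> \<le> k"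
      unfolding chain_fan_def by blast
    obtain \<G> where \<G>: "proper_chain \<G>" "\<G> \<subseteq> \<Phi>" "card \<G> = k" "\<F> \<subseteq> \<G>"
      using extend[OF \<F>(2-4)] by blast
    show "\<exists>\<sigma>\<in>top_cones k (chain_fan \<Phi> k). \<tau> \<subseteq> \<sigma>"
    proof (rule bexI)
      show "\<tau> \<subseteq> cone_of \<G>" unfolding \<F>(1) using \<G>(4) by (rule cone_of_mono)
      show "cone_of \<G> \<in> top_cones k (chain_fan \<Phi> k)" unfolding top_cones_chain_fan using \<G> by blast
    qed
  qed
qed

text \<open>The top cones around the cone of \<open>\<G>\<close> arise by inserting one set
  \<open>F\<close>, and \<open>ray F\<close> is a lattice normal for each. Balancing thereby becomes
  a statement about vectors indexed by sets.\<close>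

lemma balanced_chain_fan:
  assumes "\<And>\<G>. \<lbrakk>proper_chain \<G>; \<G> \<subseteq> \<Phi>; card \<G> + 1 = k\<rbrakk> \<Longrightarrow>
      (\<Sum>F\<in>{F \<in> \<Phi>. F \<notin> \<G> \<and> proper_chain (insert F \<G>)}.
        of_int (\<omega> (cone_of (insert F \<G>))) *\<^sub>R ray F) \<in> span (ray ` \<G>)"
  shows "balanced tlattice k (chain_fan \<Phi> k, \<omega>)"
  unfolding balanced_def prod.case
proof (intro ballI impI)
  fix \<tau> assume "\<tau> \<in> chain_fan \<Phi> k" and k: "dim \<tau> + 1 = k"
  then obtain \<G> where \<G>: "\<tau> = cone_of \<G>" "proper_chain \<G>" "\<G> \<subseteq> \<Phi>"
    unfolding chain_fan_def by blast
  let ?T = "{\<sigma> \<in> top_cones k (chain_fan \<Phi> k). \<tau> \<subseteq> \<sigma>}"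
  have card: "card \<G> + 1 = k" using k \<G>(1) dim_cone_of[OF \<G>(2)] by simp
  define X where "X = {F \<in> \<Phi>. F \<notin> \<G> \<and> proper_chain (insert F \<G>)}"
  define g where "g F = cone_of (insert F \<G>)" for F
  have inj: "inj_on g X"
  proof (rule inj_onI)
    fix F F' assume F: "F \<in> X" "F' \<in> X" "g F = g F'"
    then have "insert F \<G> = insert F' \<G>" unfolding X_def g_def using cone_of_inj by blast
    then show "F = F'" using F unfolding X_def by blast
  qed
  have top: "?T = g ` X"
  proof (rule equalityI; rule subsetI)
    fix \<sigma> assume "\<sigma> \<in> ?T"
    then obtain \<F> where \<F>: "\<sigma> = cone_of \<F>" "proper_chain \<F>" "\<F> \<subseteq> \<Phi>" "card \<F> = k" "\<tau> \<subseteq> \<sigma>"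
      unfolding top_cones_chain_fan by blast
    then have "\<G> \<subseteq> \<F>" using cone_of_subset_iff \<G> by blast
    then have "card (\<F> - \<G>) = 1" using \<F>(4) card by (simp add: card_Diff_subset)
    then obtain F where "\<F> - \<G> = {F}" by (rule card_1_singletonE)
    then have "\<F> = insert F \<G>" "F \<notin> \<G>" using \<open>\<G> \<subseteq> \<F>\<close> by blast+
    then show "\<sigma> \<in> g ` X" using \<F> unfolding X_def g_def by auto
  next
    fix \<sigma> assume "\<sigma> \<in> g ` X"
    then obtain F where F: "F \<in> X" "\<sigma> = g F" by blast
    have "card (insert F \<G>) = k" using F card unfolding X_def by simp
    then show "\<sigma> \<in> ?T"
      unfolding top_cones_chain_fan using F \<G> cone_of_mono[of \<G> "insert F \<G>"]
      unfolding X_def g_def by auto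
  qed
  \<comment> \<open>Normals are demanded as a function of the cone, so the inserted set is recovered
    from the cone through the inverse of \<open>g\<close>.\<close>
  define u where "u \<sigma> = ray (inv_into X g \<sigma>)" for \<sigma>
  have u: "u (g F) = ray F" if "F \<in> X" for F unfolding u_def using inj that by simp
  show "\<exists>u. (\<forall>\<sigma>\<in>?T. lattice_normal tlattice \<tau> \<sigma> (u \<sigma>)) \<and>
      (\<Sum>\<sigma>\<in>?T. of_int (\<omega> \<sigma>) *\<^sub>R u \<sigma>) \<in> span \<tau>"
  proof (intro exI conjI)
    show "\<forall>\<sigma>\<in>?T. lattice_normal tlattice \<tau> \<sigma> (u \<sigma>)"
      unfolding top
    proof (rule ballI)
      fix \<sigma> assume "\<sigma> \<in> g ` X"
      then obtain F where F: "F \<in> X" "\<sigma> = g F" by blast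
      then show "lattice_normal tlattice \<tau> \<sigma> (u \<sigma>)"
        using chain_lattice_normal[of F \<G>] u \<G>(1) unfolding g_def X_def by auto
    qed
    have "(\<Sum>\<sigma>\<in>g ` X. of_int (\<omega> \<sigma>) *\<^sub>R u \<sigma>) = (\<Sum>F\<in>X. of_int (\<omega> (g F)) *\<^sub>R ray F)"
      unfolding sum.reindex[OF inj] comp_def using u by simp
    also have "\<dots> \<in> span (ray ` \<G>)" using assms[OF \<G>(2,3) card] unfolding X_def g_def .
    also have "span (ray ` \<G>) = span \<tau>" unfolding \<G>(1) span_cone_of ..
    finally show "(\<Sum>\<sigma>\<in>?T. of_int (\<omega> \<sigma>) *\<^sub>R u \<sigma>) \<in> span \<tau>"
      unfolding top .
  qed
qed

section \<open>Cycles carried by a fixed fan\<close>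

text \<open>If \<open>y\<close> lies in \<open>V i\<close> and in no other subspace and
  \<open>x\<close> is outside \<open>V i\<close>, then all points \<open>x + n y\<close> avoid
  \<open>V i\<close>. Two of these infinitely many points share a subspace, which then contains
  \<open>y\<close>.\<close>

lemma convex_cone_subset_Union_subspaces:
  assumes C: "convex_cone C" and "finite I" "\<And>i. i \<in> I \<Longrightarrow> subspace (V i)" "C \<subseteq> (\<Union>i\<in>I. V i)"
  shows "\<exists>i\<in>I. C \<subseteq> V i"
  using assms(2-)
proof (induction I rule: finite_induct)
  case empty
  then show ?case using convex_cone_contains_0[OF C] by blast
next
  case (insert i I)
  show ?case
  proof (cases "C \<subseteq> V i \<or> C \<subseteq> (\<Union>i\<in>I. V i)")
    case True
    then show ?thesis
    proof
      assume "C \<subseteq> (\<Union>i\<in>I. V i)"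
      then show ?thesis using insert.IH insert.prems(1) by blast
    qed blast
  next
    case False
    then obtain x y where x: "x \<in> C" "x \<notin> V i" and y: "y \<in> C" "y \<notin> (\<Union>i\<in>I. V i)" by blast
    then have yi: "y \<in> V i" using insert.prems(2) by blast
    have sub: "subspace (V i)" using insert.prems(1) by simp
    have "\<exists>j\<in>I. x + of_nat n *\<^sub>R y \<in> V j" for n :: nat
    proof -
      have "x + of_nat n *\<^sub>R y \<in> C"
        by (intro convex_cone_add[OF C x(1)] convex_cone_scaleR[OF C _ y(1)]) simp
      moreover have "x + of_nat n *\<^sub>R y \<notin> V i"
      proof
        assume "x + of_nat n *\<^sub>R y \<in> V i"
        then have "(x + of_nat n *\<^sub>R y) - of_nat n *\<^sub>R y \<in> V i"
          using sub yi by (intro subspace_diff subspace_scale)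
        then show False using x by simp
      qed
      ultimately show ?thesis using insert.prems(2) by blast
    qed
    then obtain j where j: "\<And>n. j n \<in> I" "\<And>n. x + of_nat n *\<^sub>R y \<in> V (j n)" by metis
    have "\<not> inj j"
    proof
      assume "inj j"
      moreover have "finite (range j)" by (rule finite_subset[OF _ insert.hyps(1)]) (use j in auto)
      ultimately show False using finite_imageD infinite_UNIV_nat by blast
    qed
    then obtain m n where mn: "m \<noteq> n" "j m = j n" unfolding inj_def by blast
    have sub: "subspace (V (j n))" using insert.prems(1) j by simp
    have "(x + of_nat m *\<^sub>R y) - (x + of_nat n *\<^sub>R y) \<in> V (j n)"
      using j(2)[of m] j(2)[of n] mn(2) sub by (intro subspace_diff) auto
    then have "(of_nat m - of_nat n) *\<^sub>R y \<in> V (j n)" by (simp add: scaleR_diff_left)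
    then have "inverse (of_nat m - of_nat n :: real) *\<^sub>R (of_nat m - of_nat n) *\<^sub>R y \<in> V (j n)"
      using sub by (rule subspace_scale[rotated])
    then have "y \<in> V (j n)" using mn(1) by simp
    then show ?thesis using y j by blast
  qed
qed

text \<open>The finite spanning set makes independent sets finite, so that \<open>dim\<close> can be
  compared by cardinalities of nested bases.\<close>

lemma dim_subset_finite_span:
  fixes S T :: "'v::real_vector set"
  assumes "S \<subseteq> T" "finite G" "T \<subseteq> span G"
  shows "dim S \<le> dim T" "dim S = dim T \<Longrightarrow> span S = span T"
proof -
  obtain B where B: "B \<subseteq> S" "independent B" "S \<subseteq> span B"
    by (rule maximal_independent_subset)
  obtain B' where B': "B \<subseteq> B'" "B' \<subseteq> T" "independent B'" "T \<subseteq> span B'"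
    by (rule maximal_independent_subset_extend[of B T]) (use B assms(1) in auto)
  have fin: "finite B'"
    using independent_span_bound[OF assms(2) B'(3)] B'(2) assms(3) by blast
  have span: "span S = span B" "span T = span B'"
    using B B' by (metis span_mono span_span subset_antisym)+
  have dims: "dim S = card B" "dim T = card B'"
    using dim_eq_card[OF span(1)[symmetric] B(2)] dim_eq_card[OF span(2)[symmetric] B'(3)] .
  show "dim S \<le> dim T" unfolding dims using fin B'(1) by (rule card_mono)
  show "span S = span T" if "dim S = dim T"
  proof -
    have "B = B'" using that fin B'(1) unfolding dims by (simp add: card_subset_eq)
    then show ?thesis using span by simp
  qed
qed

lemma span_convex_cone:
  assumes "convex_cone C" "x \<in> span C"
  obtains a b where "a \<in> C" "b \<in> C" "x = a - b"
proof -
  let ?D = "{a - b |a b. a \<in> C \<and> b \<in> C}"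
  have "subspace ?D"
    unfolding subspace_def
  proof (intro conjI allI ballI)
    show "0 \<in> ?D"
      using convex_cone_contains_0[OF assms(1)] by force
    fix x y assume "x \<in> ?D" "y \<in> ?D"
    then obtain a b c d where *: "a \<in> C" "b \<in> C" "c \<in> C" "d \<in> C" "x = a - b" "y = c - d" by blast
    have "x + y = (a + c) - (b + d)" using * by simp
    then show "x + y \<in> ?D" using * convex_cone_add[OF assms(1)] by blast
  next
    fix t :: real and x assume "x \<in> ?D"
    then obtain a b where *: "a \<in> C" "b \<in> C" "x = a - b" by blast
    show "t *\<^sub>R x \<in> ?D"
    proof (cases "0 \<le> t")
      case True
      have "t *\<^sub>R x = t *\<^sub>R a - t *\<^sub>R b" using * by (simp add: scaleR_diff_right)
      then show ?thesis using * convex_cone_scaleR[OF assms(1) True] by blast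
    next
      case False
      then have "0 \<le> - t" by simp
      have "t *\<^sub>R x = (- t) *\<^sub>R b - (- t) *\<^sub>R a" using * by (simp add: scaleR_diff_right)
      then show ?thesis using * convex_cone_scaleR[OF assms(1) \<open>0 \<le> - t\<close>] by blast
    qed
  qed
  moreover have "C \<subseteq> ?D"
    using convex_cone_contains_0[OF assms(1)] by force
  ultimately have "x \<in> ?D" using assms(2) span_minimal by blast
  then show ?thesis using that by blast
qed

lemma rational_cone_convex_cone: "rational_cone L \<sigma> \<Longrightarrow> convex_cone \<sigma>"
  unfolding rational_cone_def using convex_cone_convex_cone_hull by blast

lemma rational_cone_finite_span:
  assumes "rational_cone L \<sigma>"
  obtains G where "finite G" "\<sigma> \<subseteq> span G"
proof -
  obtain G where G: "finite G" "\<sigma> = convex_cone hull G" using assms unfolding rational_cone_def by blast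
  have "\<sigma> \<subseteq> span G" unfolding G(2)
    by (rule hull_minimal) (rule span_superset, rule convex_cone_span)
  then show ?thesis using that G by blast
qed

lemma rational_cone_dim_subset:
  assumes "rational_cone L \<sigma>" "S \<subseteq> \<sigma>"
  shows "dim S \<le> dim \<sigma>" "dim S = dim \<sigma> \<Longrightarrow> span S = span \<sigma>"
proof -
  obtain G where G: "finite G" "\<sigma> \<subseteq> span G" using rational_cone_finite_span[OF assms(1)] .
  show "dim S \<le> dim \<sigma>" "dim S = dim \<sigma> \<Longrightarrow> span S = span \<sigma>"
    using dim_subset_finite_span[OF assms(2) G] by blast+
qed

text \<open>A point \<open>x\<close> of the cone lies in the span of the face, hence
  \<open>x = a - b\<close> with \<open>a\<close> and \<open>b\<close> in the face. Then
  \<open>x + b\<close> is in the face, and so is its summand \<open>x\<close>.\<close>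

lemma face_same_dim:
  assumes \<sigma>: "rational_cone L \<sigma>" and \<tau>: "\<tau> face_of \<sigma>" "\<tau> \<noteq> {}" "dim \<tau> = dim \<sigma>"
  shows "\<tau> = \<sigma>"
proof
  show sub: "\<tau> \<subseteq> \<sigma>" using \<tau>(1) by (rule face_of_imp_subset)
  show "\<sigma> \<subseteq> \<tau>"
  proof
    fix x assume x: "x \<in> \<sigma>"
    note face = face_of_convex_cone[OF rational_cone_convex_cone[OF \<sigma>] \<tau>(1,2)]
    have "x \<in> span \<tau>" using rational_cone_dim_subset(2)[OF \<sigma> sub \<tau>(3)] x span_base by blast
    then obtain a b where ab: "a \<in> \<tau>" "b \<in> \<tau>" "x = a - b" using span_convex_cone[OF face(1)] by blast
    have "x + b \<in> \<tau>" using ab by simp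
    then show "x \<in> \<tau>" using face(2)[OF x, of b] ab sub by blast
  qed
qed

lemma top_cone_rational:
  "rational_fan L \<Sigma> \<Longrightarrow> \<sigma> \<in> top_cones k \<Sigma> \<Longrightarrow> rational_cone L \<sigma> \<and> dim \<sigma> = k"
  unfolding rational_fan_def top_cones_def by blast

lemma finite_top_cones: "rational_fan L \<Sigma> \<Longrightarrow> finite (top_cones k \<Sigma>)"
  unfolding rational_fan_def top_cones_def by simp

lemma top_cones_overlap_eq:
  assumes \<Sigma>: "rational_fan L \<Sigma>" and "\<sigma> \<in> top_cones k \<Sigma>" "\<tau> \<in> top_cones k \<Sigma>" "dim (\<sigma> \<inter> \<tau>) = k"
  shows "\<sigma> = \<tau>"
proof -
  have rat: "rational_cone L \<sigma>" "dim \<sigma> = k" "rational_cone L \<tau>" "dim \<tau> = k"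
    using assms top_cone_rational by blast+
  have ne: "\<sigma> \<inter> \<tau> \<noteq> {}"
    using convex_cone_contains_0[OF rational_cone_convex_cone[OF rat(1)]]
      convex_cone_contains_0[OF rational_cone_convex_cone[OF rat(3)]] by blast
  have "(\<sigma> \<inter> \<tau>) face_of \<sigma>" "(\<sigma> \<inter> \<tau>) face_of \<tau>"
    using \<Sigma> assms(2,3) unfolding rational_fan_def top_cones_def by blast+
  then have "\<sigma> \<inter> \<tau> = \<sigma>" "\<sigma> \<inter> \<tau> = \<tau>"
    using face_same_dim[OF rat(1) _ ne] face_same_dim[OF rat(3) _ ne] assms(4) rat by auto
  then show ?thesis by blast
qed

lemma convex_cone_Int: "convex_cone S \<Longrightarrow> convex_cone T \<Longrightarrow> convex_cone (S \<inter> T)"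
  unfolding convex_cone_iff by blast

text \<open>The spans of the finitely many pieces cover the cone, so one of them contains it
  entirely.\<close>

lemma covered_cone_overlap:
  assumes C: "convex_cone C" "C \<subseteq> \<sigma>" "rational_cone L \<sigma>" and fin: "finite \<T>" and cov: "C \<subseteq> \<Union>\<T>"
  shows "\<exists>\<tau>\<in>\<T>. dim (C \<inter> \<tau>) = dim C"
proof -
  have "C \<subseteq> (\<Union>\<tau>\<in>\<T>. span (C \<inter> \<tau>))"
  proof
    fix x assume "x \<in> C"
    then obtain \<tau> where "\<tau> \<in> \<T>" "x \<in> C \<inter> \<tau>" using cov by auto
    then show "x \<in> (\<Union>\<tau>\<in>\<T>. span (C \<inter> \<tau>))" using span_base[of x "C \<inter> \<tau>"] by auto
  qed
  then have "\<exists>\<tau>\<in>\<T>. C \<subseteq> span (C \<inter> \<tau>)"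
    by (intro convex_cone_subset_Union_subspaces[OF C(1) fin]) (auto intro: subspace_span)
  then obtain \<tau> where \<tau>: "\<tau> \<in> \<T>" "C \<subseteq> span (C \<inter> \<tau>)" by blast
  have "span (C \<inter> \<tau>) = span C"
    using \<tau>(2) by (metis Int_lower1 span_mono span_span subset_antisym)
  then have "dim (C \<inter> \<tau>) = dim C" by (metis dim_span)
  then show ?thesis using \<tau> by blast
qed

lemma support_iff: "fan_support k X = \<Union>{\<sigma> \<in> top_cones k (fst X). snd X \<sigma> \<noteq> 0}"
  by (cases X) (simp add: fan_support_def)

text \<open>For transitivity, let \<open>\<sigma>\<close> and \<open>\<rho>\<close> overlap in full
  dimension. Unless both weights vanish, the overlap lies in the support of the middle fan, one of
  whose top cones meets it in full dimension and transmits the weight.\<close>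

lemma equiv_fan_equiv: "equiv {X. tropical_fan L k X} (fan_equiv L k)"
proof (rule equivI)
  show "fan_equiv L k \<subseteq> {X. tropical_fan L k X} \<times> {X. tropical_fan L k X}"
    unfolding fan_equiv_def by auto
  show "refl_on {X. tropical_fan L k X} (fan_equiv L k)"
    unfolding refl_on_def fan_equiv_def tropical_fan_def
    by (auto dest: top_cones_overlap_eq)
  show "sym (fan_equiv L k)"
    unfolding sym_def fan_equiv_def by (auto simp: Int_commute)
  show "trans (fan_equiv L k)"
  proof (rule transI)
    fix X Y Z assume XY: "(X, Y) \<in> fan_equiv L k" and YZ: "(Y, Z) \<in> fan_equiv L k"
    have fans: "rational_fan L (fst X)" "rational_fan L (fst Y)" "rational_fan L (fst Z)"
      using XY YZ unfolding fan_equiv_def tropical_fan_def by auto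
    have supp: "fan_support k X = fan_support k Y" "fan_support k Y = fan_support k Z"
      using XY YZ unfolding fan_equiv_def by auto
    have "snd X \<sigma> = snd Z \<rho>" if \<sigma>: "\<sigma> \<in> top_cones k (fst X)" and \<rho>: "\<rho> \<in> top_cones k (fst Z)"
      and dim: "dim (\<sigma> \<inter> \<rho>) = k" for \<sigma> \<rho>
    proof (cases "snd X \<sigma> = 0 \<and> snd Z \<rho> = 0")
      case False
      then have "\<sigma> \<inter> \<rho> \<subseteq> fan_support k Y"
        using \<sigma> \<rho> unfolding supp(1)[symmetric] support_iff[of k X] using supp unfolding support_iff[of k Z] support_iff[of k X]
        by blast
      then have cov: "\<sigma> \<inter> \<rho> \<subseteq> \<Union>(top_cones k (fst Y))" unfolding support_iff by blast
      have cc: "convex_cone (\<sigma> \<inter> \<rho>)" and rat: "rational_cone L \<sigma>" "dim \<sigma> = k" "rational_cone L \<rho>" "dim \<rho> = k"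
        using top_cone_rational[OF fans(1) \<sigma>] top_cone_rational[OF fans(3) \<rho>]
        by (auto intro!: convex_cone_Int dest: rational_cone_convex_cone)
      obtain \<tau> where \<tau>: "\<tau> \<in> top_cones k (fst Y)" "dim (\<sigma> \<inter> \<rho> \<inter> \<tau>) = k"
        using covered_cone_overlap[OF cc _ rat(1) finite_top_cones[OF fans(2)] cov] dim by auto
      have "dim (\<sigma> \<inter> \<rho> \<inter> \<tau>) \<le> dim (\<sigma> \<inter> \<tau>)" "dim (\<sigma> \<inter> \<tau>) \<le> k"
      proof -
        obtain G where G: "finite G" "\<sigma> \<subseteq> span G" using rational_cone_finite_span[OF rat(1)] .
        show "dim (\<sigma> \<inter> \<rho> \<inter> \<tau>) \<le> dim (\<sigma> \<inter> \<tau>)"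
          by (rule dim_subset_finite_span(1)[OF _ G(1)]) (use G(2) in auto)
        show "dim (\<sigma> \<inter> \<tau>) \<le> k"
          using rational_cone_dim_subset(1)[OF rat(1), of "\<sigma> \<inter> \<tau>"] rat(2) by simp
      qed
      moreover have "dim (\<sigma> \<inter> \<rho> \<inter> \<tau>) \<le> dim (\<tau> \<inter> \<rho>)" "dim (\<tau> \<inter> \<rho>) \<le> k"
      proof -
        obtain G where G: "finite G" "\<rho> \<subseteq> span G" using rational_cone_finite_span[OF rat(3)] .
        show "dim (\<sigma> \<inter> \<rho> \<inter> \<tau>) \<le> dim (\<tau> \<inter> \<rho>)"
          by (rule dim_subset_finite_span(1)[OF _ G(1)]) (use G(2) in auto)
        show "dim (\<tau> \<inter> \<rho>) \<le> k"
          using rational_cone_dim_subset(1)[OF rat(3), of "\<tau> \<inter> \<rho>"] rat(4) by simp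
      qed
      ultimately have "dim (\<sigma> \<inter> \<tau>) = k" "dim (\<tau> \<inter> \<rho>) = k" using \<tau>(2) by auto
      then have "snd X \<sigma> = snd Y \<tau>" "snd Y \<tau> = snd Z \<rho>"
        using XY YZ \<sigma> \<rho> \<tau>(1) unfolding fan_equiv_def by auto
      then show ?thesis by simp
    qed simp
    then show "(X, Z) \<in> fan_equiv L k"
      using XY YZ unfolding fan_equiv_def by auto
  qed
qed

text \<open>The representative vanishing at one fixed coordinate embeds the quotient linearly into
  Euclidean space.\<close>

definition tcoord :: "'e::finite tspace \<Rightarrow> real ^ 'e" where
  "tcoord x = (\<chi> i. tdiff i (SOME j. True) x)"

lemma linear_tcoord: "linear tcoord"
  by (rule linearI)
    (simp_all add: tcoord_def vec_eq_iff linear_add[OF linear_tdiff] linear_cmul[OF linear_tdiff])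

lemma inj_tcoord: "inj tcoord"
  by (rule injI) (auto simp: tcoord_def vec_eq_iff intro: tspace_eqI)

text \<open>The type \<open>tspace\<close> carries no topology, so closedness of finitely generated cones is imported
  from Euclidean space, in the form of limits along a line.\<close>

lemma rational_cone_radial_limit:
  fixes \<tau> :: "'e::finite tspace set"
  assumes \<tau>: "rational_cone L \<tau>" and N: "infinite N" "\<And>n. n \<in> N \<Longrightarrow> x + (1 / real (Suc n)) *\<^sub>R y \<in> \<tau>"
  shows "x \<in> \<tau>"
proof -
  obtain G where G: "finite G" "\<tau> = convex_cone hull G" using \<tau> unfolding rational_cone_def by blast
  have im: "tcoord ` \<tau> = convex_cone hull (tcoord ` G)"
    unfolding G(2) using convex_cone_hull_linear_image[OF linear_tcoord] by metis
  have "closed (tcoord ` \<tau>)" unfolding im using G(1) by (intro closed_convex_cone_hull) simp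
  moreover have "\<exists>z\<in>tcoord ` \<tau>. dist z (tcoord x) < e" if e: "e > 0" for e
  proof -
    obtain m :: nat where m: "norm (tcoord y) / e < real m" using reals_Archimedean2 by blast
    obtain n where n: "n \<in> N" "m < n" using N(1) unfolding infinite_nat_iff_unbounded by blast
    have "tcoord (x + (1 / real (Suc n)) *\<^sub>R y) = tcoord x + (1 / real (Suc n)) *\<^sub>R tcoord y"
      by (simp only: linear_add[OF linear_tcoord] linear_cmul[OF linear_tcoord])
    then have "dist (tcoord (x + (1 / real (Suc n)) *\<^sub>R y)) (tcoord x) = norm (tcoord y) / real (Suc n)"
      by (simp add: dist_norm)
    also have "\<dots> < e"
    proof -
      have "norm (tcoord y) < e * real m" using m e by (simp add: divide_less_eq mult.commute)
      also have "\<dots> \<le> e * real (Suc n)" using n e by (intro mult_left_mono) auto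
      finally show ?thesis by (simp add: divide_less_eq)
    qed
    finally show ?thesis using N(2)[OF n(1)] by blast
  qed
  ultimately have "tcoord x \<in> tcoord ` \<tau>" using closed_approachable by blast
  then show ?thesis using inj_image_mem_iff[OF inj_tcoord] by blast
qed

text \<open>A full-dimensional overlap is found by approaching \<open>x\<close> along a generic
  direction \<open>y\<close> of \<open>\<sigma>\<close>. Some cone contains infinitely many of the
  approximating points; two of them put \<open>y\<close> into the span of its overlap, so the
  overlap is full, and closedness adds \<open>x\<close>.\<close>

lemma cone_subset_overlapping:
  fixes \<sigma> :: "'e::finite tspace set"
  assumes \<sigma>: "rational_cone L \<sigma>" "dim \<sigma> = k" and T: "finite \<T>" "\<And>\<tau>. \<tau> \<in> \<T> \<Longrightarrow> rational_cone L \<tau>"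
    and cov: "\<sigma> \<subseteq> \<Union>\<T>"
  shows "\<sigma> \<subseteq> \<Union>{\<tau> \<in> \<T>. dim (\<sigma> \<inter> \<tau>) = k}"
proof
  fix x assume x: "x \<in> \<sigma>"
  note cc = rational_cone_convex_cone[OF \<sigma>(1)]
  let ?bad = "{\<tau> \<in> \<T>. dim (\<sigma> \<inter> \<tau>) \<noteq> k}"
  have "\<not> \<sigma> \<subseteq> (\<Union>\<tau>\<in>?bad. span (\<sigma> \<inter> \<tau>))"
  proof
    assume "\<sigma> \<subseteq> (\<Union>\<tau>\<in>?bad. span (\<sigma> \<inter> \<tau>))"
    then have "\<exists>\<tau>\<in>?bad. \<sigma> \<subseteq> span (\<sigma> \<inter> \<tau>)"
      using T(1) by (intro convex_cone_subset_Union_subspaces[OF cc]) (auto intro: subspace_span)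
    then obtain \<tau> where \<tau>: "\<tau> \<in> ?bad" "\<sigma> \<subseteq> span (\<sigma> \<inter> \<tau>)" by blast
    have "span (\<sigma> \<inter> \<tau>) = span \<sigma>"
      using \<tau>(2) by (metis Int_lower1 span_mono span_span subset_antisym)
    then have "dim (\<sigma> \<inter> \<tau>) = k" using \<sigma>(2) by (metis dim_span)
    then show False using \<tau>(1) by simp
  qed
  \<comment> \<open>Generic: outside the spans of all overlaps of lower dimension.\<close>
  then obtain y where y: "y \<in> \<sigma>" "\<And>\<tau>. \<tau> \<in> ?bad \<Longrightarrow> y \<notin> span (\<sigma> \<inter> \<tau>)" by blast
  define p where "p n = x + (1 / real (Suc n)) *\<^sub>R y" for n
  have p: "p n \<in> \<sigma>" for n
    unfolding p_def by (intro convex_cone_add[OF cc x] convex_cone_scaleR[OF cc _ y(1)]) simp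
  then have "\<exists>\<tau>\<in>\<T>. p n \<in> \<tau>" for n using cov by blast
  then obtain t where t: "\<And>n. t n \<in> \<T>" "\<And>n. p n \<in> t n" by metis
  have "\<exists>n0. infinite {n. t n = t n0}"
  proof -
    have "finite (t ` UNIV)" by (rule finite_subset[OF _ T(1)]) (use t in auto)
    then show ?thesis using pigeonhole_infinite[of "UNIV :: nat set" t] by auto
  qed
  then obtain n0 where n0: "infinite {n. t n = t n0}" by blast
  have inn: "p n \<in> t n0" if "n \<in> {n. t n = t n0}" for n using t(2)[of n] that by simp
  have "dim (\<sigma> \<inter> t n0) = k"
  proof (rule ccontr)
    assume "dim (\<sigma> \<inter> t n0) \<noteq> k"
    then have ny: "y \<notin> span (\<sigma> \<inter> t n0)" using y(2) t(1) by blast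
    obtain m where m: "t m = t n0" "n0 < m" using n0 unfolding infinite_nat_iff_unbounded by blast
    have "p n0 - p m \<in> span (\<sigma> \<inter> t n0)"
      using p[of n0] p[of m] inn[of n0] inn[of m] m(1) by (intro span_diff span_base) auto
    moreover have "p n0 - p m = (1 / real (Suc n0) - 1 / real (Suc m)) *\<^sub>R y"
      unfolding p_def by (simp add: scaleR_diff_left)
    moreover have nz: "1 / real (Suc n0) - 1 / real (Suc m) \<noteq> 0" using m(2) by (simp del: of_nat_Suc)
    ultimately have "inverse (1 / real (Suc n0) - 1 / real (Suc m)) *\<^sub>R
        ((1 / real (Suc n0) - 1 / real (Suc m)) *\<^sub>R y) \<in> span (\<sigma> \<inter> t n0)"
      by (metis span_scale)
    then show False using ny nz by (simp del: of_nat_Suc)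
  qed
  moreover have "x \<in> t n0"
    using rational_cone_radial_limit[OF T(2)[OF t(1)] n0, of x y n0] inn unfolding p_def by blast
  ultimately show "x \<in> \<Union>{\<tau> \<in> \<T>. dim (\<sigma> \<inter> \<tau>) = k}" using t(1) by blast
qed

text \<open>Weights may cancel, so the support of a sum is not determined by the two supports. A
  point of \<open>\<sigma>\<close> lies in some \<open>\<tau>\<close> that overlaps
  \<open>\<sigma>\<close> in full dimension; there both pairs of weights agree, hence so do their
  sums.\<close>

lemma fan_equiv_add:
  fixes \<Sigma> T :: "'e::finite tspace set set"
  assumes ab: "((\<Sigma>, a), (T, \<alpha>)) \<in> fan_equiv L k" "((\<Sigma>, b), (T, \<beta>)) \<in> fan_equiv L k"
    and trop: "tropical_fan L k (\<Sigma>, \<lambda>\<sigma>. a \<sigma> + b \<sigma>)" "tropical_fan L k (T, \<lambda>\<sigma>. \<alpha> \<sigma> + \<beta> \<sigma>)"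
  shows "((\<Sigma>, \<lambda>\<sigma>. a \<sigma> + b \<sigma>), (T, \<lambda>\<sigma>. \<alpha> \<sigma> + \<beta> \<sigma>)) \<in> fan_equiv L k"
proof -
  have sub: "fan_support k (\<Sigma>, \<lambda>\<sigma>. a \<sigma> + b \<sigma>) \<subseteq> fan_support k (T, \<lambda>\<sigma>. \<alpha> \<sigma> + \<beta> \<sigma>)"
    if ab: "((\<Sigma>, a), (T, \<alpha>)) \<in> fan_equiv L k" "((\<Sigma>, b), (T, \<beta>)) \<in> fan_equiv L k"
    for \<Sigma> T :: "'e tspace set set" and a b \<alpha> \<beta>
  proof
    have fans: "rational_fan L \<Sigma>" "rational_fan L T" using ab unfolding fan_equiv_def tropical_fan_def by auto
    have supp: "fan_support k (\<Sigma>, a) = fan_support k (T, \<alpha>)" "fan_support k (\<Sigma>, b) = fan_support k (T, \<beta>)"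
      using ab unfolding fan_equiv_def by auto
    fix x assume "x \<in> fan_support k (\<Sigma>, \<lambda>\<sigma>. a \<sigma> + b \<sigma>)"
    then obtain \<sigma> where \<sigma>: "\<sigma> \<in> top_cones k \<Sigma>" "a \<sigma> + b \<sigma> \<noteq> 0" "x \<in> \<sigma>"
      unfolding fan_support_def by auto
    then have "a \<sigma> \<noteq> 0 \<or> b \<sigma> \<noteq> 0" by auto
    then have "\<sigma> \<subseteq> fan_support k (T, \<alpha>) \<or> \<sigma> \<subseteq> fan_support k (T, \<beta>)"
      unfolding supp[symmetric] using \<sigma>(1) unfolding fan_support_def by auto
    then have "\<sigma> \<subseteq> \<Union>(top_cones k T)" unfolding fan_support_def by auto
    then have "\<sigma> \<subseteq> \<Union>{\<tau> \<in> top_cones k T. dim (\<sigma> \<inter> \<tau>) = k}"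
      using cone_subset_overlapping[of L \<sigma> k "top_cones k T"] top_cone_rational[OF fans(1) \<sigma>(1)]
        finite_top_cones[OF fans(2)] top_cone_rational[OF fans(2)] by blast
    then obtain \<tau> where \<tau>: "\<tau> \<in> top_cones k T" "dim (\<sigma> \<inter> \<tau>) = k" "x \<in> \<tau>" using \<sigma>(3) by blast
    then have "a \<sigma> = \<alpha> \<tau>" "b \<sigma> = \<beta> \<tau>" using ab \<sigma>(1) unfolding fan_equiv_def by auto
    then have "\<alpha> \<tau> + \<beta> \<tau> \<noteq> 0" using \<sigma>(2) by simp
    then show "x \<in> fan_support k (T, \<lambda>\<sigma>. \<alpha> \<sigma> + \<beta> \<sigma>)" using \<tau> unfolding fan_support_def by auto
  qed
  have sym: "((T, \<alpha>), (\<Sigma>, a)) \<in> fan_equiv L k" "((T, \<beta>), (\<Sigma>, b)) \<in> fan_equiv L k"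
    using ab equiv_fan_equiv unfolding equiv_def by (meson symD)+
  have "fan_support k (\<Sigma>, \<lambda>\<sigma>. a \<sigma> + b \<sigma>) = fan_support k (T, \<lambda>\<sigma>. \<alpha> \<sigma> + \<beta> \<sigma>)"
    using sub[OF ab] sub[OF sym] by blast
  then show ?thesis using trop ab unfolding fan_equiv_def by auto
qed

lemma tropical_fan_empty: "tropical_fan L k ({}, \<omega>)"
  unfolding tropical_fan_def rational_fan_def pure_fan_def balanced_def by simp

lemma fan_equiv_empty_iff:
  "(X, ({}, \<omega>)) \<in> fan_equiv L k \<longleftrightarrow> tropical_fan L k X \<and> (\<forall>\<sigma>\<in>top_cones k (fst X). snd X \<sigma> = 0)"
proof
  assume *: "(X, ({}, \<omega>)) \<in> fan_equiv L k"
  then have X: "tropical_fan L k X" "fan_support k X = {}"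
    unfolding fan_equiv_def by (auto simp: fan_support_def top_cones_def)
  have "snd X \<sigma> = 0" if \<sigma>: "\<sigma> \<in> top_cones k (fst X)" for \<sigma>
  proof (rule ccontr)
    assume "snd X \<sigma> \<noteq> 0"
    then have "\<sigma> \<subseteq> fan_support k X" using \<sigma> unfolding support_iff by blast
    moreover have "0 \<in> \<sigma>"
      using X(1) \<sigma> top_cone_rational rational_cone_convex_cone convex_cone_contains_0
      unfolding tropical_fan_def by metis
    ultimately show False using X(2) by blast
  qed
  then show "tropical_fan L k X \<and> (\<forall>\<sigma>\<in>top_cones k (fst X). snd X \<sigma> = 0)" using X by blast
next
  assume "tropical_fan L k X \<and> (\<forall>\<sigma>\<in>top_cones k (fst X). snd X \<sigma> = 0)"
  then show "(X, ({}, \<omega>)) \<in> fan_equiv L k"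
    unfolding fan_equiv_def using tropical_fan_empty
    by (auto simp: support_iff top_cones_def)
qed

text \<open>Working with cycles carried by one fan avoids common refinements of arbitrary fans.\<close>

locale fixed_fan_cycles =
  fixes L :: "'e::finite tspace set" and k :: nat and T :: "'e tspace set set"
    and W :: "('e tspace set \<Rightarrow> int) set"
  assumes trop: "\<omega> \<in> W \<Longrightarrow> tropical_fan L k (T, \<omega>)"
    and W_zero: "(\<lambda>_. 0) \<in> W"
    and W_add: "\<alpha> \<in> W \<Longrightarrow> \<beta> \<in> W \<Longrightarrow> (\<lambda>\<sigma>. \<alpha> \<sigma> + \<beta> \<sigma>) \<in> W"
    and W_uminus: "\<alpha> \<in> W \<Longrightarrow> (\<lambda>\<sigma>. - \<alpha> \<sigma>) \<in> W"
begin

abbreviation cl :: "('e tspace set \<Rightarrow> int) \<Rightarrow> 'e tspace wfan set" where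
  "cl \<omega> \<equiv> cycle_class L k (T, \<omega>)"

lemma class_refl: "\<omega> \<in> W \<Longrightarrow> ((T, \<omega>), (T, \<omega>)) \<in> fan_equiv L k"
  using trop equiv_class_self[OF equiv_fan_equiv] by blast

lemma class_eq: "(X, Y) \<in> fan_equiv L k \<Longrightarrow> cycle_class L k X = cycle_class L k Y"
  unfolding cycle_class_def by (rule equiv_class_eq[OF equiv_fan_equiv])

lemma cl_carrier: "\<omega> \<in> W \<Longrightarrow> cl \<omega> \<in> carrier (cycle_group L k)"
  unfolding cycle_group_def cycle_class_def using trop by (auto intro: quotientI)

text \<open>Each common fan of the two cycles contributes the same class by
  \<open>fan_equiv_add\<close>, or the empty set if the sum on it is not a tropical fan.
  \<open>T\<close> itself shows that the class does occur.\<close>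

lemma cycle_add_cl:
  assumes \<alpha>: "\<alpha> \<in> W" and \<beta>: "\<beta> \<in> W"
  shows "cycle_add L k (cl \<alpha>) (cl \<beta>) = cl (\<lambda>\<sigma>. \<alpha> \<sigma> + \<beta> \<sigma>)"
proof (rule equalityI; rule subsetI)
  fix X assume "X \<in> cycle_add L k (cl \<alpha>) (cl \<beta>)"
  then obtain \<Sigma> \<omega> \<omega>' where *: "((T, \<alpha>), (\<Sigma>, \<omega>)) \<in> fan_equiv L k" "((T, \<beta>), (\<Sigma>, \<omega>')) \<in> fan_equiv L k"
    "X \<in> cycle_class L k (\<Sigma>, \<lambda>\<sigma>. \<omega> \<sigma> + \<omega>' \<sigma>)"
    unfolding cycle_add_def cycle_class_def by auto
  then have "tropical_fan L k (\<Sigma>, \<lambda>\<sigma>. \<omega> \<sigma> + \<omega>' \<sigma>)" unfolding cycle_class_def fan_equiv_def by auto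
  then have "((T, \<lambda>\<sigma>. \<alpha> \<sigma> + \<beta> \<sigma>), (\<Sigma>, \<lambda>\<sigma>. \<omega> \<sigma> + \<omega>' \<sigma>)) \<in> fan_equiv L k"
    using fan_equiv_add[OF *(1,2)] trop[OF W_add[OF \<alpha> \<beta>]] by blast
  then show "X \<in> cl (\<lambda>\<sigma>. \<alpha> \<sigma> + \<beta> \<sigma>)" using *(3) class_eq by blast
next
  fix X assume "X \<in> cl (\<lambda>\<sigma>. \<alpha> \<sigma> + \<beta> \<sigma>)"
  moreover have "(T, \<alpha>) \<in> cl \<alpha>" "(T, \<beta>) \<in> cl \<beta>" unfolding cycle_class_def using class_refl[OF \<alpha>] class_refl[OF \<beta>] by auto
  ultimately show "X \<in> cycle_add L k (cl \<alpha>) (cl \<beta>)" unfolding cycle_add_def by blast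
qed

lemma cl_zero: "zero_cycle L k = cl (\<lambda>_. 0)"
  unfolding zero_cycle_def
  by (rule class_eq[symmetric]) (simp add: fan_equiv_empty_iff trop[OF W_zero])

lemma cl_cong: "\<alpha> \<in> W \<Longrightarrow> \<beta> \<in> W \<Longrightarrow> (\<And>\<sigma>. \<sigma> \<in> top_cones k T \<Longrightarrow> \<alpha> \<sigma> = \<beta> \<sigma>) \<Longrightarrow> cl \<alpha> = cl \<beta>"
proof (rule class_eq)
  assume W: "\<alpha> \<in> W" "\<beta> \<in> W" and eq: "\<And>\<sigma>. \<sigma> \<in> top_cones k T \<Longrightarrow> \<alpha> \<sigma> = \<beta> \<sigma>"
  have "rational_fan L T" using trop[OF W(1)] unfolding tropical_fan_def by simp
  then show "((T, \<alpha>), (T, \<beta>)) \<in> fan_equiv L k"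
    unfolding fan_equiv_def fan_support_def using trop W eq by (auto dest: top_cones_overlap_eq)
qed

text \<open>\<open>m_inv\<close> is a definite description, so the inverse must be unique among all
  cycles, also those not given on \<open>T\<close>. The sum with an inverse \<open>y\<close>
  contains the empty fan, which yields a common fan \<open>\<Sigma>\<close> of
  \<open>cl \<alpha>\<close> and \<open>y\<close> on which the weights are opposite.\<close>

lemma inv_cl:
  assumes \<alpha>: "\<alpha> \<in> W"
  shows "inv\<^bsub>cycle_group L k\<^esub> (cl \<alpha>) = cl (\<lambda>\<sigma>. - \<alpha> \<sigma>)"
  unfolding m_inv_def
proof (rule the_equality)
  have "cycle_add L k (cl \<alpha>) (cl (\<lambda>\<sigma>. - \<alpha> \<sigma>)) = zero_cycle L k"
    "cycle_add L k (cl (\<lambda>\<sigma>. - \<alpha> \<sigma>)) (cl \<alpha>) = zero_cycle L k"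
    unfolding cycle_add_cl[OF \<alpha> W_uminus[OF \<alpha>]] cycle_add_cl[OF W_uminus[OF \<alpha>] \<alpha>] cl_zero by simp_all
  then show "cl (\<lambda>\<sigma>. - \<alpha> \<sigma>) \<in> carrier (cycle_group L k) \<and>
      cl \<alpha> \<otimes>\<^bsub>cycle_group L k\<^esub> cl (\<lambda>\<sigma>. - \<alpha> \<sigma>) = \<one>\<^bsub>cycle_group L k\<^esub> \<and>
      cl (\<lambda>\<sigma>. - \<alpha> \<sigma>) \<otimes>\<^bsub>cycle_group L k\<^esub> cl \<alpha> = \<one>\<^bsub>cycle_group L k\<^esub>"
    using cl_carrier[OF W_uminus[OF \<alpha>]] by (simp add: cycle_group_def)
next
  fix y assume y: "y \<in> carrier (cycle_group L k) \<and> cl \<alpha> \<otimes>\<^bsub>cycle_group L k\<^esub> y = \<one>\<^bsub>cycle_group L k\<^esub> \<and>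
      y \<otimes>\<^bsub>cycle_group L k\<^esub> cl \<alpha> = \<one>\<^bsub>cycle_group L k\<^esub>"
  then have "cycle_add L k (cl \<alpha>) y = zero_cycle L k" by (simp add: cycle_group_def)
  moreover have "({}, \<lambda>_. 0) \<in> zero_cycle L k"
    unfolding zero_cycle_def cycle_class_def
    by (simp add: fan_equiv_empty_iff tropical_fan_empty top_cones_def)
  ultimately have "({}, \<lambda>_. 0) \<in> cycle_add L k (cl \<alpha>) y" by simp
  then obtain \<Sigma> \<omega> \<omega>' where *: "((T, \<alpha>), (\<Sigma>, \<omega>)) \<in> fan_equiv L k" "(\<Sigma>, \<omega>') \<in> y"
    "((\<Sigma>, \<lambda>\<sigma>. \<omega> \<sigma> + \<omega>' \<sigma>), ({}, \<lambda>_. 0)) \<in> fan_equiv L k"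
    unfolding cycle_add_def cycle_class_def by auto
  obtain Y where Y: "y = fan_equiv L k `` {Y}" "tropical_fan L k Y"
    using y unfolding cycle_group_def by (auto elim: quotientE)
  have "(Y, (\<Sigma>, \<omega>')) \<in> fan_equiv L k" using *(2) Y(1) by blast
  then have y_eq: "y = cycle_class L k (\<Sigma>, \<omega>')" and trop': "tropical_fan L k (\<Sigma>, \<omega>')"
    unfolding Y(1) using class_eq unfolding cycle_class_def by (blast, simp add: fan_equiv_def)
  have "\<omega>' \<sigma> = - \<omega> \<sigma>" if "\<sigma> \<in> top_cones k \<Sigma>" for \<sigma>
    using *(3) that unfolding fan_equiv_empty_iff by (simp add: eq_neg_iff_add_eq_0 add.commute)
  then have "((T, \<lambda>\<sigma>. - \<alpha> \<sigma>), (\<Sigma>, \<omega>')) \<in> fan_equiv L k"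
    using *(1) trop' trop[OF W_uminus[OF \<alpha>]] unfolding fan_equiv_def fan_support_def by auto
  then show "y = cl (\<lambda>\<sigma>. - \<alpha> \<sigma>)" unfolding y_eq using class_eq by blast
qed

lemma cl_int_pow_sign:
  assumes \<alpha>: "\<alpha> \<in> W"
  shows "cl \<alpha> [^]\<^bsub>cycle_group L k\<^esub> ((-1) ^ m :: int) = cl (\<lambda>\<sigma>. (-1) ^ m * \<alpha> \<sigma>)"
proof -
  have one: "cl \<alpha> [^]\<^bsub>cycle_group L k\<^esub> (1 :: nat) = cl \<alpha>"
    using cycle_add_cl[OF W_zero \<alpha>] by (simp add: nat_pow_def cycle_group_def cl_zero)
  then have "cl \<alpha> [^]\<^bsub>cycle_group L k\<^esub> (1 :: int) = cl \<alpha>"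
    by (metis int_pow_int of_nat_1)
  moreover have "cl \<alpha> [^]\<^bsub>cycle_group L k\<^esub> (- 1 :: int) = cl (\<lambda>\<sigma>. - \<alpha> \<sigma>)"
    using one inv_cl[OF \<alpha>] by (simp add: int_pow_def nat_pow_def)
  ultimately show ?thesis by (cases "even m") simp_all
qed

lemma W_sum: "finite I \<Longrightarrow> (\<And>i. i \<in> I \<Longrightarrow> \<alpha> i \<in> W) \<Longrightarrow> (\<lambda>\<sigma>. \<Sum>i\<in>I. \<alpha> i \<sigma>) \<in> W"
proof (induction I rule: finite_induct)
  case (insert i I)
  then show ?case using W_add[of "\<alpha> i" "\<lambda>\<sigma>. \<Sum>i\<in>I. \<alpha> i \<sigma>"] by simp
qed (simp add: W_zero)

text \<open>The product is evaluated on the inductive relation \<open>foldSetD\<close>, by existence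
  and uniqueness of its value. In this way commutativity and associativity are used only for cycles
  carried by \<open>T\<close>.\<close>

lemma finprod_cl:
  assumes I: "finite I" and f: "\<And>i. i \<in> I \<Longrightarrow> \<alpha> i \<in> W \<and> f i = cl (\<alpha> i)"
  shows "finprod (cycle_group L k) f I = cl (\<lambda>\<sigma>. \<Sum>i\<in>I. \<alpha> i \<sigma>)"
proof -
  let ?D = "carrier (cycle_group L k)" and ?m = "monoid.mult (cycle_group L k) \<circ> f"
  let ?F = "foldSetD ?D ?m \<one>\<^bsub>cycle_group L k\<^esub>"
  have one: "\<one>\<^bsub>cycle_group L k\<^esub> = cl (\<lambda>_. 0)" by (simp add: cycle_group_def cl_zero)
  have step: "?m i (cl (\<lambda>\<sigma>. \<Sum>i\<in>A. \<alpha> i \<sigma>)) = cl (\<lambda>\<sigma>. \<Sum>i\<in>insert i A. \<alpha> i \<sigma>)"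
    if "i \<in> I" "i \<notin> A" "A \<subseteq> I" for i A
  proof -
    have "finite A" using that(3) I finite_subset by blast
    moreover have "(\<lambda>\<sigma>. \<Sum>i\<in>A. \<alpha> i \<sigma>) \<in> W" by (rule W_sum) (use that f \<open>finite A\<close> in auto)
    ultimately show ?thesis
      using cycle_add_cl[of "\<alpha> i" "\<lambda>\<sigma>. \<Sum>i\<in>A. \<alpha> i \<sigma>"] f[OF that(1)] that(2) by (simp add: cycle_group_def)
  qed
  have ex: "(A, cl (\<lambda>\<sigma>. \<Sum>i\<in>A. \<alpha> i \<sigma>)) \<in> ?F" if "A \<subseteq> I" for A
    using finite_subset[OF that I] that
  proof (induction A rule: finite_induct)
    case empty
    then show ?case using cl_carrier[OF W_zero] one by (auto intro: foldSetD.emptyI)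
  next
    case (insert i A)
    have "finite (insert i A)" using insert by simp
    then have "(\<lambda>\<sigma>. \<Sum>i\<in>insert i A. \<alpha> i \<sigma>) \<in> W" by (rule W_sum) (use insert f in auto)
    then have "?m i (cl (\<lambda>\<sigma>. \<Sum>i\<in>A. \<alpha> i \<sigma>)) \<in> ?D"
      using step[of i A] insert cl_carrier by auto
    moreover have "(A, cl (\<lambda>\<sigma>. \<Sum>i\<in>A. \<alpha> i \<sigma>)) \<in> ?F" using insert by blast
    ultimately have "(insert i A, ?m i (cl (\<lambda>\<sigma>. \<Sum>i\<in>A. \<alpha> i \<sigma>))) \<in> ?F"
      by (rule foldSetD.insertI[OF insert.hyps(2)])
    moreover have "?m i (cl (\<lambda>\<sigma>. \<Sum>i\<in>A. \<alpha> i \<sigma>)) = cl (\<lambda>\<sigma>. \<Sum>i\<in>insert i A. \<alpha> i \<sigma>)"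
      using insert by (intro step) auto
    ultimately show ?case by (simp only:)
  qed
  have uniq: "A \<subseteq> I \<longrightarrow> z = cl (\<lambda>\<sigma>. \<Sum>i\<in>A. \<alpha> i \<sigma>)" if "(A, z) \<in> ?F" for A z
    using that
  proof (induction rule: foldSetD.induct)
    case emptyI
    then show ?case using one by simp
  next
    case (insertI i A y)
    then show ?case using step[of i A] by auto
  qed
  have "foldD ?D ?m \<one>\<^bsub>cycle_group L k\<^esub> I = cl (\<lambda>\<sigma>. \<Sum>i\<in>I. \<alpha> i \<sigma>)"
    unfolding foldD_def
  proof (rule the_equality)
    show "(I, cl (\<lambda>\<sigma>. \<Sum>i\<in>I. \<alpha> i \<sigma>)) \<in> ?F" by (rule ex) simp
    show "z = cl (\<lambda>\<sigma>. \<Sum>i\<in>I. \<alpha> i \<sigma>)" if "(I, z) \<in> ?F" for z using uniq[OF that] by simp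
  qed
  then show ?thesis using I by (simp add: finprod_def)
qed

end

section \<open>Weights of chains\<close>

text \<open>The successor of \<open>F\<close> in the chain, with \<open>UNIV\<close> as the last
  one. It replaces list indices once chains are sets.\<close>

definition upper :: "'e set set \<Rightarrow> 'e set \<Rightarrow> 'e set" where
  "upper \<F> F = \<Inter>{G \<in> insert UNIV \<F>. F \<subset> G}"

text \<open>By lemma \<open>beta_minor\<close> the factors are the invariants \<open>\<beta>(M|F\<^sub>i\<^sub>+\<^sub>1/F\<^sub>i)\<close> up to the signs
  \<open>(-1)\<^sup>r\<^sup>(\<^sup>F\<^sub>i\<^sub>+\<^sub>1\<^sup>)\<^sup>-\<^sup>r\<^sup>(\<^sup>F\<^sub>i\<^sup>)\<close>, whose product cancels the rank in the sign of
  \<open>chain_weight\<close>.\<close>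

definition chain_wt :: "('e::finite set \<Rightarrow> int) \<Rightarrow> 'e set set \<Rightarrow> int" where
  "chain_wt r \<F> = - ((-1) ^ card \<F>) * (\<Prod>F\<in>insert {} \<F>. (-1) ^ card F * altsum r F (upper \<F> F))"

lemma chain_comparable:
  assumes "proper_chain \<F>" "F \<in> insert {} \<F>" "G \<in> insert UNIV (insert {} \<F>)"
  shows "F \<subseteq> G \<or> G \<subseteq> F"
  using assms proper_chainD(3)[OF assms(1)] by blast

lemma upper_least: "G \<in> insert UNIV \<F> \<Longrightarrow> F \<subset> G \<Longrightarrow> upper \<F> F \<subseteq> G"
  unfolding upper_def by blast

lemma upper_mem:
  fixes \<F> :: "'e::finite set set"
  assumes \<F>: "proper_chain \<F>" and F: "F \<in> insert {} \<F>"
  shows "upper \<F> F \<in> insert UNIV \<F>" "F \<subset> upper \<F> F"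
proof -
  have "F \<noteq> UNIV" using F proper_chainD(2)[OF \<F>] by auto
  then have "{G \<in> insert UNIV \<F>. F \<subset> G} \<noteq> {}" by blast
  then have "upper \<F> F \<in> {G \<in> insert UNIV \<F>. F \<subset> G}"
    unfolding upper_def
    by (rule chain_Inter_mem[rotated]) (use proper_chainD(3)[OF \<F>] in auto)
  then show "upper \<F> F \<in> insert UNIV \<F>" "F \<subset> upper \<F> F" by blast+
qed

lemma chain_insert:
  assumes \<G>: "proper_chain \<G>" and G: "G \<in> insert {} \<G>" and F: "G \<subset> F" "F \<subset> upper \<G> G"
  shows "F \<notin> \<G>" "proper_chain (insert F \<G>)"
proof -
  show "F \<notin> \<G>" using upper_least[of F \<G> G] F by auto
  have "F \<subseteq> K \<or> K \<subseteq> F" if K: "K \<in> \<G>" for K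
  proof -
    have "G \<subseteq> K \<or> K \<subseteq> G" using chain_comparable[OF \<G> G] K by blast
    then consider "K \<subseteq> G" | "G \<subset> K" by blast
    then show ?thesis
      using upper_least[of K \<G> G] K F by cases blast+
  qed
  moreover have "F \<noteq> {}" "F \<noteq> UNIV" using F by auto
  ultimately show "proper_chain (insert F \<G>)"
    using \<G> unfolding proper_chain_def by auto
qed

lemma chain_insertE:
  fixes \<G> :: "'e::finite set set"
  assumes F: "F \<notin> \<G>" "proper_chain (insert F \<G>)"
  obtains G where "G \<in> insert {} \<G>" "G \<subset> F" "F \<subset> upper \<G> G"
proof -
  have \<G>: "proper_chain \<G>" using proper_chain_subset[OF F(2)] by blast
  have Fne: "F \<noteq> {}" "F \<noteq> UNIV" using proper_chainD(1,2)[OF F(2)] by auto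
  define G where "G = \<Union>{K \<in> insert {} \<G>. K \<subset> F}"
  have "{K \<in> insert {} \<G>. K \<subset> F} \<noteq> {}" using Fne by blast
  then have "G \<in> {K \<in> insert {} \<G>. K \<subset> F}"
    unfolding G_def by (rule chain_Union_mem[rotated]) (use proper_chainD(3)[OF \<G>] in auto)
  then have G: "G \<in> insert {} \<G>" "G \<subset> F" by auto
  have U: "upper \<G> G \<in> insert UNIV \<G>" "G \<subset> upper \<G> G" using upper_mem[OF \<G> G(1)] by auto
  have "F \<subset> upper \<G> G"
  proof (rule ccontr)
    assume *: "\<not> F \<subset> upper \<G> G"
    have "upper \<G> G \<noteq> F" using U(1) F(1) Fne(2) by auto
    moreover have "F \<subseteq> upper \<G> G \<or> upper \<G> G \<subseteq> F"
      using U(1) proper_chainD(3)[OF F(2), of F "upper \<G> G"] by auto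
    ultimately have "upper \<G> G \<subset> F" using * by blast
    then have "upper \<G> G \<in> {K \<in> insert {} \<G>. K \<subset> F}" using U(1) by auto
    then have "upper \<G> G \<subseteq> G" unfolding G_def by blast
    then show False using U(2) by blast
  qed
  then show ?thesis using that G by blast
qed

lemma upper_insert:
  fixes \<G> :: "'e::finite set set"
  assumes \<G>: "proper_chain \<G>" and G: "G \<in> insert {} \<G>" and F: "G \<subset> F" "F \<subset> upper \<G> G"
  shows "upper (insert F \<G>) G = F" "upper (insert F \<G>) F = upper \<G> G"
    and "K \<in> insert {} \<G> \<Longrightarrow> K \<noteq> G \<Longrightarrow> upper (insert F \<G>) K = upper \<G> K"
proof -
  note ins = chain_insert[OF \<G> G F]
  note mem = upper_mem[OF ins(2)]
  have U: "upper \<G> G \<in> insert UNIV \<G>" using upper_mem[OF \<G> G] by blast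
  show "upper (insert F \<G>) G = F"
  proof -
    let ?U = "upper (insert F \<G>) G"
    have "?U \<subseteq> F" using F(1) by (intro upper_least) auto
    moreover have "?U \<in> insert UNIV (insert F \<G>)" "G \<subset> ?U" using mem[of G] G by auto
    moreover have "upper \<G> G \<subseteq> ?U" if "?U \<noteq> F"
      using that calculation by (intro upper_least) auto
    ultimately show ?thesis using F(2) by blast
  qed
  show "upper (insert F \<G>) F = upper \<G> G"
  proof (rule equalityI)
    show "upper (insert F \<G>) F \<subseteq> upper \<G> G" using U F(2) by (intro upper_least) auto
    have "upper (insert F \<G>) F \<in> insert UNIV (insert F \<G>)" "F \<subset> upper (insert F \<G>) F"
      using mem[of F] by auto
    then show "upper \<G> G \<subseteq> upper (insert F \<G>) F" using F(1) by (intro upper_least) auto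
  qed
  show "upper (insert F \<G>) K = upper \<G> K" if K: "K \<in> insert {} \<G>" "K \<noteq> G"
  proof (rule equalityI)
    show "upper (insert F \<G>) K \<subseteq> upper \<G> K" using upper_mem[OF \<G> K(1)] by (intro upper_least) auto
    have U': "upper (insert F \<G>) K \<in> insert UNIV (insert F \<G>)" "K \<subset> upper (insert F \<G>) K"
      using mem[of K] K by auto
    have "upper (insert F \<G>) K \<noteq> F"
    proof
      assume eq: "upper (insert F \<G>) K = F"
      then have KF: "K \<subset> F" using U' by simp
      have "K \<subseteq> G \<or> G \<subseteq> K" using chain_comparable[OF \<G> K(1)] G by blast
      then show False
      proof
        assume "K \<subseteq> G"
        then have "K \<subset> G" "G \<in> \<G>" using K(2) G by auto
        then have "upper (insert F \<G>) K \<subseteq> G" by (intro upper_least) auto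
        then show False using eq F(1) by blast
      next
        assume "G \<subseteq> K"
        then have "G \<subset> K" "K \<in> \<G>" using K by auto
        then have "upper \<G> G \<subseteq> K" by (intro upper_least) auto
        then show False using KF F(2) by blast
      qed
    qed
    then show "upper \<G> K \<subseteq> upper (insert F \<G>) K" using U' by (intro upper_least) auto
  qed
qed

text \<open>Inserting \<open>F\<close> into the gap above \<open>G\<close> replaces one factor of
  the product by two and leaves the others alone. The constant \<open>c\<close> collects those
  others together with the signs.\<close>

lemma chain_wt_insert:
  fixes \<G> :: "'e::finite set set"
  assumes \<G>: "proper_chain \<G>" and G: "G \<in> insert {} \<G>"
  shows "\<exists>c. \<forall>F. G \<subset> F \<and> F \<subset> upper \<G> G \<longrightarrow> chain_wt r (insert F \<G>) =
    c * ((-1) ^ card F * altsum r G F * altsum r F (upper \<G> G))"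
proof (intro exI allI impI)
  fix F assume F: "G \<subset> F \<and> F \<subset> upper \<G> G"
  let ?t = "\<lambda>\<F> K. (-1) ^ card K * altsum r K (upper \<F> K)"
  note ins = chain_insert[OF \<G> G, of F] and up = upper_insert[OF \<G> G, of F]
  have nF: "F \<notin> insert {} \<G>" using ins F by auto
  have "(\<Prod>K\<in>insert {} (insert F \<G>). ?t (insert F \<G>) K) =
      ?t (insert F \<G>) F * (\<Prod>K\<in>insert {} \<G>. ?t (insert F \<G>) K)"
    unfolding insert_commute[of "{}" F] using nF by (subst prod.insert) auto
  also have "(\<Prod>K\<in>insert {} \<G>. ?t (insert F \<G>) K) =
      ?t (insert F \<G>) G * (\<Prod>K\<in>insert {} \<G> - {G}. ?t (insert F \<G>) K)"
    by (rule prod.remove) (use G in auto)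
  also have "(\<Prod>K\<in>insert {} \<G> - {G}. ?t (insert F \<G>) K) = (\<Prod>K\<in>insert {} \<G> - {G}. ?t \<G> K)"
    by (rule prod.cong[OF refl]) (use up(3) F in auto)
  finally have "(\<Prod>K\<in>insert {} (insert F \<G>). ?t (insert F \<G>) K) =
      ((-1) ^ card F * altsum r F (upper \<G> G)) * (((-1) ^ card G * altsum r G F) *
        (\<Prod>K\<in>insert {} \<G> - {G}. ?t \<G> K))"
    using up(1,2) F by simp
  moreover have "card (insert F \<G>) = Suc (card \<G>)" using nF by simp
  ultimately show "chain_wt r (insert F \<G>) =
      ((-1) ^ card \<G> * (-1) ^ card G * (\<Prod>K\<in>insert {} \<G> - {G}. ?t \<G> K)) *
      ((-1) ^ card F * altsum r G F * altsum r F (upper \<G> G))"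
    unfolding chain_wt_def by (simp add: mult_ac)
qed

text \<open>The coordinate of the sum at \<open>e\<close> is 0 outside \<open>H\<close> and the
  total weight inside \<open>G\<close>. On \<open>H - G\<close> it is constant by the convolution
  identity, so the sum is a combination of the indicator vectors of the two ends.\<close>

lemma interval_e_vec_sum:
  fixes r :: "'e::finite set \<Rightarrow> int"
  assumes GH: "G \<subset> H" and step: "\<And>A e. r (insert e A) = r A \<or> r (insert e A) = r A + 1"
  defines "g \<equiv> \<lambda>F. (-1) ^ card F * altsum r G F * altsum r F H"
  shows "\<exists>a b. (\<Sum>F\<in>{F. G \<subset> F \<and> F \<subset> H}. of_int (g F) *\<^sub>R e_vec F) = a *\<^sub>R e_vec G + b *\<^sub>R e_vec H"
proof -
  let ?I = "{F. G \<subset> F \<and> F \<subset> H}"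
  define Z where "Z = (\<Sum>F\<in>?I. g F)"
  define t where "t e = (\<Sum>F\<in>?I. g F * of_bool (e \<in> F))" for e
  \<comment> \<open>The identity sums over an interval that includes \<open>F = H\<close>, so this
    term is subtracted; \<open>F = G\<close> does not occur because
    \<open>e \<notin> G\<close>.\<close>
  have t2: "2 * t e = altsum (\<lambda>A. r A ^ 2 + r A) G H - 2 * g H" if e: "e \<in> H - G" for e
  proof -
    have "(\<Sum>F\<in>{insert e G..H}. g F) = (\<Sum>F\<in>insert H {F \<in> ?I. e \<in> F}. g F)"
      using e GH by (intro sum.cong) auto
    also have "\<dots> = g H + (\<Sum>F\<in>{F \<in> ?I. e \<in> F}. g F)" by (subst sum.insert) auto
    also have "(\<Sum>F\<in>{F \<in> ?I. e \<in> F}. g F) = t e"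
      unfolding t_def by (rule sum.mono_neutral_cong_left) auto
    finally show ?thesis
      using altsum_convolution[of H e G r] e GH step unfolding g_def by auto
  qed
  obtain e0 where e0: "e0 \<in> H - G" using GH by blast
  have tG: "t e = Z" if "e \<in> G" for e unfolding t_def Z_def using that by (intro sum.cong) auto
  have tH: "t e = 0" if "e \<notin> H" for e unfolding t_def using that by (intro sum.neutral) auto
  have tHG: "t e = t e0" if "e \<in> H - G" for e using t2[OF that] t2[OF e0] by simp
  have "(\<Sum>F\<in>?I. of_int (g F) *\<^sub>R e_vec F) = of_int (Z - t e0) *\<^sub>R e_vec G + of_int (t e0) *\<^sub>R e_vec H"
  proof (rule vec_eq_iff[THEN iffD2], rule allI)
    fix e
    have "(\<Sum>F\<in>?I. of_int (g F) *\<^sub>R e_vec F) $ e = (\<Sum>F\<in>?I. of_int (g F) * of_bool (e \<in> F))"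
      by (simp add: sum_component)
    also have "\<dots> = of_int (t e)" by (simp add: t_def)
    also have "\<dots> = (of_int (Z - t e0) *\<^sub>R e_vec G + of_int (t e0) *\<^sub>R e_vec H) $ e"
      using tG[of e] tH[of e] tHG[of e] GH by (cases "e \<in> G"; cases "e \<in> H") auto
    finally show "(\<Sum>F\<in>?I. of_int (g F) *\<^sub>R e_vec F) $ e =
        (of_int (Z - t e0) *\<^sub>R e_vec G + of_int (t e0) *\<^sub>R e_vec H) $ e" .
  qed
  then show ?thesis by blast
qed

lemma ray_trivial:
  "ray {} = (0 :: 'e::finite tspace)" "ray UNIV = (0 :: 'e::finite tspace)"
proof -
  have 0: "(0 :: 'e tspace) = mod_one 0" by (rule zero_tspace.abs_eq)
  show "ray {} = (0 :: 'e tspace)" "ray UNIV = (0 :: 'e tspace)"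
    unfolding 0 mod_one_eq_iff by (rule exI[of _ 0], simp, rule exI[of _ 1], simp)
qed

text \<open>The insertable sets split into the gaps of the chain, and each gap contributes a
  combination of the rays of its two ends. The ends \<open>{}\<close> and \<open>UNIV\<close> have
  zero ray, so only members of the chain remain.\<close>

lemma chain_wt_balanced:
  fixes \<G> :: "'e::finite set set"
  assumes \<G>: "proper_chain \<G>"
    and step: "\<And>A e. r (insert e A) = r A \<or> r (insert e A) = r A + 1"
  shows "(\<Sum>F\<in>{F. F \<notin> \<G> \<and> proper_chain (insert F \<G>)}. of_int (chain_wt r (insert F \<G>)) *\<^sub>R ray F)
    \<in> span (ray ` \<G>)"
proof -
  let ?I = "\<lambda>G. {F. G \<subset> F \<and> F \<subset> upper \<G> G}"
  have eq: "{F. F \<notin> \<G> \<and> proper_chain (insert F \<G>)} = (\<Union>G\<in>insert {} \<G>. ?I G)"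
  proof (rule equalityI; rule subsetI)
    fix F assume "F \<in> {F. F \<notin> \<G> \<and> proper_chain (insert F \<G>)}"
    then have F: "F \<notin> \<G>" "proper_chain (insert F \<G>)" by auto
    obtain G where "G \<in> insert {} \<G>" "G \<subset> F" "F \<subset> upper \<G> G" by (rule chain_insertE[OF F])
    then show "F \<in> (\<Union>G\<in>insert {} \<G>. ?I G)" by blast
  next
    fix F assume "F \<in> (\<Union>G\<in>insert {} \<G>. ?I G)"
    then obtain G where "G \<in> insert {} \<G>" "G \<subset> F" "F \<subset> upper \<G> G" by auto
    then have "F \<notin> \<G>" "proper_chain (insert F \<G>)" by (rule chain_insert[OF \<G>])+
    then show "F \<in> {F. F \<notin> \<G> \<and> proper_chain (insert F \<G>)}" by simp
  qed
  have disj: "?I G \<inter> ?I G' = {}" if G: "G \<in> insert {} \<G>" "G' \<in> insert {} \<G>" "G \<noteq> G'" for G G'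
  proof -
    have aux: "?I G \<inter> ?I G' = {}" if "G \<subset> G'" "G' \<in> insert {} \<G>" for G G'
    proof -
      have "upper \<G> G \<subseteq> G'" using that by (intro upper_least) auto
      then show ?thesis by blast
    qed
    have "G \<subset> G' \<or> G' \<subset> G" using chain_comparable[OF \<G> G(1)] G(2,3) by blast
    then show ?thesis using aux[of G G'] aux[of G' G] G by blast
  qed
  have "(\<Sum>F\<in>?I G. of_int (chain_wt r (insert F \<G>)) *\<^sub>R ray F) \<in> span (ray ` \<G>)"
    if G: "G \<in> insert {} \<G>" for G
  proof -
    let ?H = "upper \<G> G"
    obtain c where c: "\<And>F. G \<subset> F \<Longrightarrow> F \<subset> ?H \<Longrightarrow> chain_wt r (insert F \<G>) =
        c * ((-1) ^ card F * altsum r G F * altsum r F ?H)"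
      using chain_wt_insert[OF \<G> G, of r] by blast
    obtain a b where ab: "(\<Sum>F\<in>?I G. of_int ((-1) ^ card F * altsum r G F * altsum r F ?H) *\<^sub>R e_vec F) =
        a *\<^sub>R e_vec G + b *\<^sub>R e_vec ?H"
      using interval_e_vec_sum[OF upper_mem(2)[OF \<G> G] step] by blast
    have "(\<Sum>F\<in>?I G. of_int (chain_wt r (insert F \<G>)) *\<^sub>R ray F) =
        (\<Sum>F\<in>?I G. of_int c *\<^sub>R (of_int ((-1) ^ card F * altsum r G F * altsum r F ?H) *\<^sub>R ray F))"
      by (rule sum.cong[OF refl]) (simp add: c)
    also have "\<dots> = of_int c *\<^sub>R mod_one (\<Sum>F\<in>?I G. of_int ((-1) ^ card F * altsum r G F * altsum r F ?H) *\<^sub>R e_vec F)"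
      by (simp only: linear_sum[OF linear_mod_one] mod_one_scaleR scaleR_sum_right)
    also have "\<dots> = of_int c *\<^sub>R (a *\<^sub>R ray G + b *\<^sub>R ray ?H)"
      unfolding ab by (simp only: mod_one_add mod_one_scaleR)
    also have "\<dots> \<in> span (ray ` \<G>)"
    proof -
      have "ray K \<in> span (ray ` \<G>)" if "K \<in> insert UNIV (insert {} \<G>)" for K
        using that by (auto simp: ray_trivial span_zero intro: span_base)
      then have "ray G \<in> span (ray ` \<G>)" "ray ?H \<in> span (ray ` \<G>)"
        using G upper_mem(1)[OF \<G> G] by blast+
      then show ?thesis by (intro span_scale span_add)
    qed
    finally show ?thesis .
  qed
  then have "(\<Sum>G\<in>insert {} \<G>. \<Sum>F\<in>?I G. of_int (chain_wt r (insert F \<G>)) *\<^sub>R ray F) \<in> span (ray ` \<G>)"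
    by (rule span_sum)
  moreover have "(\<Sum>F\<in>(\<Union>G\<in>insert {} \<G>. ?I G). of_int (chain_wt r (insert F \<G>)) *\<^sub>R ray F) =
      (\<Sum>G\<in>insert {} \<G>. \<Sum>F\<in>?I G. of_int (chain_wt r (insert F \<G>)) *\<^sub>R ray F)"
    by (rule sum.UNION_disjoint) (use disj in auto)
  ultimately show ?thesis unfolding eq by simp
qed

section \<open>Chains as sorted lists and as sets\<close>

lemma strict_chain_list_unique:
  "sorted_wrt (\<subset>) xs \<Longrightarrow> sorted_wrt (\<subset>) ys \<Longrightarrow> set xs = set ys \<Longrightarrow> xs = ys"
proof (induction xs arbitrary: ys)
  case (Cons x xs)
  then obtain y ys' where ys: "ys = y # ys'" by (cases ys) auto
  have "x = y \<or> x \<in> set ys'" "y = x \<or> y \<in> set xs" using Cons.prems(3) ys by auto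
  then have xy: "x = y" using Cons.prems(1,2) ys by auto
  have "x \<notin> set xs" "y \<notin> set ys'" using Cons.prems(1,2) ys by auto
  then have "set xs = set ys'" using Cons.prems(3) ys xy by auto
  then show ?case using Cons ys xy by simp
qed simp

lemma strict_chain_distinct: "sorted_wrt (\<subset>) xs \<Longrightarrow> distinct xs"
  by (induction xs) auto

lemma sorted_chain_iff:
  "sorted_wrt (\<subset>) ({} # Fs @ [UNIV :: 'e::finite set]) \<longleftrightarrow> sorted_wrt (\<subset>) Fs \<and> {} \<notin> set Fs \<and> UNIV \<notin> set Fs"
  by (auto simp: sorted_wrt_append)

lemma sorted_chain_proper:
  assumes "sorted_wrt (\<subset>) ({} # Fs @ [UNIV :: 'e::finite set])"
  shows "proper_chain (set Fs)" "card (set Fs) = length Fs"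
proof -
  have s: "sorted_wrt (\<subset>) Fs" "{} \<notin> set Fs" "UNIV \<notin> set Fs" using assms unfolding sorted_chain_iff by auto
  have "F \<subseteq> G \<or> G \<subseteq> F" if "F \<in> set Fs" "G \<in> set Fs" for F G
  proof -
    obtain i j where ij: "i < length Fs" "j < length Fs" "F = Fs ! i" "G = Fs ! j"
      using \<open>F \<in> set Fs\<close> \<open>G \<in> set Fs\<close> by (metis in_set_conv_nth)
    consider "i < j" | "j < i" | "i = j" by linarith
    then show ?thesis
      using ij sorted_wrt_nth_less[OF s(1), of i j] sorted_wrt_nth_less[OF s(1), of j i] by cases auto
  qed
  then show "proper_chain (set Fs)" using s unfolding proper_chain_def by blast
  show "card (set Fs) = length Fs" using strict_chain_distinct[OF s(1)] by (rule distinct_card)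
qed

lemma proper_chain_sorted_list:
  fixes \<F> :: "'e::finite set set"
  assumes "proper_chain \<F>"
  shows "\<exists>Fs. set Fs = \<F> \<and> sorted_wrt (\<subset>) ({} # Fs @ [UNIV])"
proof -
  have "\<exists>Fs. set Fs = \<F> \<and> sorted_wrt (\<subset>) Fs"
    using assms
  proof (induction "card \<F>" arbitrary: \<F>)
    case 0
    then show ?case by (intro exI[of _ "[]"]) simp
  next
    case (Suc n)
    let ?T = "\<Union>\<F>"
    have "\<F> \<noteq> {}" using Suc.hyps(2) by auto
    then have T: "?T \<in> \<F>" by (rule chain_Union_mem[rotated]) (use proper_chainD(3)[OF Suc.prems] in auto)
    have "n = card (\<F> - {?T})" using Suc.hyps(2) T by simp
    then obtain Fs where Fs: "set Fs = \<F> - {?T}" "sorted_wrt (\<subset>) Fs"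
      using Suc.hyps(1) proper_chain_subset[OF Suc.prems, of "\<F> - {?T}"] by blast
    have "sorted_wrt (\<subset>) (Fs @ [?T])" using Fs by (auto simp: sorted_wrt_append)
    moreover have "set (Fs @ [?T]) = \<F>" using Fs T by auto
    ultimately show ?case by blast
  qed
  then show ?thesis
    using proper_chainD(1,2)[OF assms] unfolding sorted_chain_iff by blast
qed

lemma sign_telescope:
  assumes "\<And>i. i \<le> k \<Longrightarrow> f i \<le> f (Suc i)"
  shows "(\<Prod>i=0..k. (-1 :: int) ^ (f (Suc i) - f i)) = (-1) ^ (f (Suc k) - f 0)"
  using assms
proof (induction k)
  case (Suc k)
  have "j \<le> Suc k \<Longrightarrow> f 0 \<le> f j" for j
  proof (induction j)
    case (Suc j)
    then show ?case using Suc.prems \<open>\<And>i. i \<le> Suc k \<Longrightarrow> f i \<le> f (Suc i)\<close>[of j] by linarith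
  qed simp
  from this[of "Suc k"] have "f (Suc (Suc k)) - f 0 = (f (Suc k) - f 0) + (f (Suc (Suc k)) - f (Suc k))"
    using Suc.prems[of "Suc k"] by simp
  moreover have "(\<Prod>i=0..k. (-1 :: int) ^ (f (Suc i) - f i)) = (-1) ^ (f (Suc k) - f 0)"
    using Suc by simp
  ultimately show ?case by (simp only: prod.atLeast0_atMost_Suc power_add)
qed simp

text \<open>The bound on the length makes the truncated exponent
  \<open>matroid_rank M - 1 - k\<close> genuine. Together with the telescoped sign
  \<open>(-1) ^ matroid_rank M\<close> it leaves \<open>- ((-1) ^ k)\<close>, the leading sign of
  \<open>chain_wt\<close>.\<close>

lemma chain_weight_eq:
  fixes M :: "'e::finite matroid"
  assumes M: "M \<in> Mat" and Fs: "sorted_wrt (\<subset>) ({} # Fs @ [UNIV])" and len: "length Fs < matroid_rank M"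
  shows "chain_weight M Fs = chain_wt (\<lambda>A. int (rank_on M A)) (set Fs)"
proof -
  let ?k = "length Fs" and ?r = "rank_on M" and ?L = "{} # Fs @ [UNIV]"
  let ?\<F> = "set Fs"
  define r where "r = (\<lambda>A. int (rank_on M A))"
  define G where "G i = ?L ! i" for i
  have mat: "is_matroid M" "ground M = UNIV" using M unfolding Mat_def by auto
  have lt: "G i \<subset> G j" if "i < j" "j \<le> Suc ?k" for i j
    unfolding G_def using sorted_wrt_nth_less[OF Fs that(1)] that(2) by simp
  have G0: "G 0 = {}" and GE: "G (Suc ?k) = UNIV" unfolding G_def by (simp_all add: nth_append)
  have img: "G ` {0..?k} = insert {} ?\<F>"
  proof -
    have "{0..?k} = insert 0 (Suc ` {0..<?k})"
    proof (rule equalityI; rule subsetI)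
      fix i assume "i \<in> {0..?k}"
      then show "i \<in> insert 0 (Suc ` {0..<?k})" by (cases i) auto
    qed auto
    then have "G ` {0..?k} = insert (G 0) ((\<lambda>i. G (Suc i)) ` {0..<?k})"
      by (simp only: image_insert image_image)
    also have "(\<lambda>i. G (Suc i)) ` {0..<?k} = ?\<F>"
    proof (rule equalityI; rule subsetI)
      fix F assume "F \<in> (\<lambda>i. G (Suc i)) ` {0..<?k}"
      then obtain i where "i < ?k" "F = Fs ! i" unfolding G_def by (auto simp: nth_append)
      then show "F \<in> ?\<F>" by simp
    next
      fix F assume "F \<in> ?\<F>"
      then obtain i where "i < ?k" "F = Fs ! i" by (metis in_set_conv_nth)
      then show "F \<in> (\<lambda>i. G (Suc i)) ` {0..<?k}"
        unfolding G_def by (intro image_eqI[of _ _ i]) (auto simp: nth_append)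
    qed
    finally show ?thesis using G0 by simp
  qed
  have inj: "inj_on G {0..?k}"
  proof (rule inj_onI)
    fix i j assume "i \<in> {0..?k}" "j \<in> {0..?k}" "G i = G j"
    then show "i = j" using lt[of i j] lt[of j i] by (cases i j rule: linorder_cases) auto
  qed
  have up: "upper ?\<F> (G i) = G (Suc i)" if i: "i \<le> ?k" for i
  proof (rule equalityI)
    have "G (Suc i) \<in> insert UNIV ?\<F>"
    proof (cases "i = ?k")
      case True
      then show ?thesis using GE by simp
    next
      case False
      then have "G (Suc i) = Fs ! i" "i < ?k" using i unfolding G_def by (auto simp: nth_append)
      then show ?thesis by simp
    qed
    then show "upper ?\<F> (G i) \<subseteq> G (Suc i)" using lt[of i "Suc i"] i by (intro upper_least) auto
    have "G i \<in> insert {} ?\<F>" unfolding img[symmetric] using i by (intro imageI) simp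
    note U = upper_mem[OF sorted_chain_proper(1)[OF Fs] this]
    have "\<exists>j\<le>Suc ?k. upper ?\<F> (G i) = G j"
    proof (cases "upper ?\<F> (G i) = UNIV")
      case True
      then show ?thesis using GE by (intro exI[of _ "Suc ?k"]) simp
    next
      case False
      then have "upper ?\<F> (G i) \<in> insert {} ?\<F>" using U(1) by simp
      then obtain j where "j \<in> {0..?k}" "upper ?\<F> (G i) = G j" unfolding img[symmetric] by (rule imageE)
      then show ?thesis by (intro exI[of _ j]) simp
    qed
    then obtain j where j: "j \<le> Suc ?k" "upper ?\<F> (G i) = G j" by blast
    have "i < j"
    proof (rule ccontr)
      assume "\<not> i < j"
      then have "G j \<subseteq> G i" using lt[of j i] i by (cases "i = j") auto
      then show False using U(2) j(2) by simp
    qed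
    then have "Suc i = j \<or> Suc i < j" by auto
    then show "G (Suc i) \<subseteq> upper ?\<F> (G i)" using lt[of "Suc i" j] j by auto
  qed
  have mono: "?r (G i) \<le> ?r (G (Suc i))" if "i \<le> ?k" for i
    using lt[of i "Suc i"] that by (intro rank_mono[OF mat(1)]) auto
  have "chain_weight M Fs = (-1) ^ (matroid_rank M - 1 - ?k) *
      (\<Prod>i=0..?k. beta_invariant (contraction (restriction M (G (i + 1))) (G i)))"
    unfolding chain_weight_def Let_def mat(2) G_def ..
  also have "(\<Prod>i=0..?k. beta_invariant (contraction (restriction M (G (i + 1))) (G i))) =
      (\<Prod>i=0..?k. (-1) ^ (?r (G (Suc i)) - ?r (G i)) * ((-1) ^ card (G i) * altsum r (G i) (upper ?\<F> (G i))))"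
  proof (rule prod.cong[OF refl])
    fix i assume "i \<in> {0..?k}"
    then have i: "i \<le> ?k" by simp
    show "beta_invariant (contraction (restriction M (G (i + 1))) (G i)) =
        (-1) ^ (?r (G (Suc i)) - ?r (G i)) * ((-1) ^ card (G i) * altsum r (G i) (upper ?\<F> (G i)))"
      using beta_minor[OF mat(1), of "G i" "G (Suc i)"] lt[of i "Suc i"] i mat(2)
      by (simp add: up[OF i] r_def power_add)
  qed
  also have "\<dots> = (\<Prod>i=0..?k. (-1) ^ (?r (G (Suc i)) - ?r (G i))) *
      (\<Prod>i=0..?k. (-1) ^ card (G i) * altsum r (G i) (upper ?\<F> (G i)))"
    by (rule prod.distrib)
  also have "(\<Prod>i=0..?k. (-1 :: int) ^ (?r (G (Suc i)) - ?r (G i))) = (-1) ^ matroid_rank M"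
    using sign_telescope[of ?k "\<lambda>i. ?r (G i)"] mono
    by (simp add: G0 GE rank_on_empty[OF mat(1)] matroid_rank_def mat(2))
  also have "(\<Prod>i=0..?k. (-1) ^ card (G i) * altsum r (G i) (upper ?\<F> (G i))) =
      (\<Prod>F\<in>insert {} ?\<F>. (-1) ^ card F * altsum r F (upper ?\<F> F))"
    unfolding img[symmetric] by (simp add: prod.reindex[OF inj])
  finally have "chain_weight M Fs = (-1) ^ (matroid_rank M - 1 - ?k) * ((-1) ^ matroid_rank M *
      (\<Prod>F\<in>insert {} ?\<F>. (-1) ^ card F * altsum r F (upper ?\<F> F)))" .
  moreover have "(-1 :: int) ^ (matroid_rank M - 1 - ?k) * (-1) ^ matroid_rank M = - ((-1) ^ ?k)"
  proof -
    obtain m where "matroid_rank M = Suc (?k + m)" using len less_imp_Suc_add by blast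
    then show ?thesis by (simp add: power_add)
  qed
  ultimately show ?thesis
    unfolding chain_wt_def sorted_chain_proper(2)[OF Fs] r_def by (simp add: mult.assoc[symmetric])
qed

section \<open>CSM cycles on the braid fan\<close>

lemma Mat_is_matroid: "M \<in> Mat \<Longrightarrow> is_matroid M" and Mat_ground: "M \<in> Mat \<Longrightarrow> ground M = UNIV"
  unfolding Mat_def by auto

lemma flats_iff:
  "M \<in> Mat \<Longrightarrow> F \<in> flats M \<longleftrightarrow> (\<forall>x. x \<notin> F \<longrightarrow> rank_on M F < rank_on M (insert x F))"
  unfolding flats_def by (auto simp: Mat_ground)

lemma flat_rank_less:
  assumes M: "M \<in> Mat" and F: "F \<in> flats M" and "F \<subset> G"
  shows "rank_on M F < rank_on M G"
proof -
  obtain x where x: "x \<in> G" "x \<notin> F" using assms(3) by blast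
  have "rank_on M F < rank_on M (insert x F)" using F x unfolding flats_iff[OF M] by blast
  also have "\<dots> \<le> rank_on M G" using x assms(3) by (intro rank_mono[OF Mat_is_matroid[OF M]]) blast
  finally show ?thesis .
qed

lemma chain_of_flats_card:
  fixes M :: "'e::finite matroid"
  assumes M: "M \<in> Mat" and \<F>: "proper_chain \<F>" and fl: "insert {} \<F> \<subseteq> flats M"
  shows "card \<F> < matroid_rank M"
proof -
  have "inj_on (rank_on M) (insert {} \<F>)"
  proof (rule inj_onI, rule ccontr)
    fix F G assume FG: "F \<in> insert {} \<F>" "G \<in> insert {} \<F>" "rank_on M F = rank_on M G" "F \<noteq> G"
    then have "F \<subset> G \<or> G \<subset> F" using chain_comparable[OF \<F> FG(1)] by blast
    then show False using flat_rank_less[OF M, of F G] flat_rank_less[OF M, of G F] FG fl by auto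
  qed
  moreover have "rank_on M ` insert {} \<F> \<subseteq> {..<matroid_rank M}"
  proof (rule image_subsetI)
    fix F assume F: "F \<in> insert {} \<F>"
    then have "F \<subset> UNIV" using proper_chainD(2)[OF \<F>] by auto
    then show "rank_on M F \<in> {..<matroid_rank M}"
      using flat_rank_less[OF M, of F UNIV] F fl by (auto simp: matroid_rank_def Mat_ground[OF M])
  qed
  ultimately have "card (insert {} \<F>) \<le> matroid_rank M"
    using card_inj_on_le[of "rank_on M" "insert {} \<F>" "{..<matroid_rank M}"] by simp
  moreover have "{} \<notin> \<F>" using proper_chainD(1)[OF \<F>] by blast
  ultimately show ?thesis by simp
qed

text \<open>Flatness is passed down from the top of the chain. If some \<open>x\<close> outside
  \<open>F\<close> does not raise the rank of \<open>F\<close>, then either \<open>x\<close> is in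
  the successor of \<open>F\<close> and the factor of \<open>F\<close> vanishes, or it is outside
  and contradicts flatness of the successor. Flatness of the bottom member \<open>{}\<close> is
  looplessness.\<close>

lemma chain_wt_nonzero:
  fixes M :: "'e::finite matroid"
  assumes M: "M \<in> Mat" and \<F>: "proper_chain \<F>" and nz: "chain_wt (\<lambda>A. int (rank_on M A)) \<F> \<noteq> 0"
  shows "\<F> \<subseteq> flats M" "loopless M" "card \<F> < matroid_rank M"
proof -
  note mat = Mat_is_matroid[OF M]
  let ?r = "\<lambda>A. int (rank_on M A)"
  have alt: "altsum ?r F (upper \<F> F) \<noteq> 0" if "F \<in> insert {} \<F>" for F
  proof
    assume "altsum ?r F (upper \<F> F) = 0"
    then have "(\<Prod>F\<in>insert {} \<F>. (-1) ^ card F * altsum ?r F (upper \<F> F)) = 0"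
      using that by (intro prod_zero) auto
    then show False using nz unfolding chain_wt_def by simp
  qed
  have flat: "F \<in> flats M" if "F \<in> insert {} \<F>" for F
    using that
  proof (induction "card (- F)" arbitrary: F rule: less_induct)
    case less
    let ?U = "upper \<F> F"
    note U = upper_mem[OF \<F> less.prems]
    show ?case unfolding flats_iff[OF M]
    proof (intro allI impI)
      fix x assume x: "x \<notin> F"
      have "rank_on M (insert x F) \<noteq> rank_on M F"
      proof
        assume eq: "rank_on M (insert x F) = rank_on M F"
        have sub: "rank_on M (insert x A) = rank_on M A" if "F \<subseteq> A" for A
          using rank_insert_submod[OF mat that eq] .
        show False
        proof (cases "x \<in> ?U")
          case True
          have "altsum ?r F ?U = 0" by (rule altsum_loop[of _ x]) (use True x sub in auto)
          then show False using alt[OF less.prems] by simp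
        next
          case False
          then have "?U \<in> \<F>" using U(1) by auto
          moreover have "card (- ?U) < card (- F)" using U(2) by (intro psubset_card_mono) auto
          ultimately have "?U \<in> flats M" using less.hyps by blast
          then have "rank_on M ?U < rank_on M (insert x ?U)" using False unfolding flats_iff[OF M] by blast
          then show False using sub[of ?U] U(2) by auto
        qed
      qed
      then show "rank_on M F < rank_on M (insert x F)"
        using rank_mono[OF mat, of F "insert x F"] by (simp add: subset_insertI le_neq_implies_less)
    qed
  qed
  then show "\<F> \<subseteq> flats M" by blast
  show "card \<F> < matroid_rank M" using chain_of_flats_card[OF M \<F>] flat by blast
  show "loopless M" unfolding loopless_def
  proof
    fix x
    have "rank_on M {} < rank_on M {x}" using flat[of "{}"] unfolding flats_iff[OF M] by simp
    moreover obtain B where B: "B \<in> bases M" "card ({x} \<inter> B) = rank_on M {x}" using rank_attained[OF mat] .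
    ultimately have "x \<in> B" by (cases "x \<in> B") auto
    then show "\<exists>B\<in>bases M. x \<in> B" using B by blast
  qed
qed

lemma loopless_empty_flat:
  assumes M: "M \<in> Mat" and "loopless M"
  shows "{} \<in> flats M"
  unfolding flats_iff[OF M]
proof (intro allI impI)
  fix x
  note mat = Mat_is_matroid[OF M]
  obtain B where B: "B \<in> bases M" "x \<in> B" using assms(2) Mat_ground[OF M] unfolding loopless_def by blast
  then have "1 \<le> rank_on M {x}" using rank_ge[OF mat B(1), of "{x}"] by simp
  then show "rank_on M {} < rank_on M (insert x {})" by (simp add: rank_on_empty[OF mat])
qed

text \<open>If all rank jumps were at most 1, every value from 0 to the rank would occur, which is
  more values than the chain with its two trivial ends has members.\<close>

lemma chain_rank_gap:
  fixes M :: "'e::finite matroid"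
  assumes M: "M \<in> Mat" and \<F>: "proper_chain \<F>" and fl: "insert {} \<F> \<subseteq> flats M"
    and card: "card \<F> + 1 < matroid_rank M"
  shows "\<exists>G\<in>insert {} \<F>. rank_on M G + 1 < rank_on M (upper \<F> G)"
proof (rule ccontr)
  let ?r = "rank_on M" and ?R = "insert UNIV (insert {} \<F>)"
  assume "\<not> ?thesis"
  then have gap: "?r (upper \<F> G) \<le> ?r G + 1" if "G \<in> insert {} \<F>" for G using that by (meson not_less)
  have rU: "?r UNIV = matroid_rank M" by (simp add: matroid_rank_def Mat_ground[OF M])
  have "j \<le> matroid_rank M \<Longrightarrow> \<exists>G\<in>?R. ?r G = j" for j
  proof (induction j)
    case 0
    then show ?case using rank_on_empty[OF Mat_is_matroid[OF M]] by blast
  next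
    case (Suc j)
    then obtain G where G: "G \<in> ?R" "?r G = j" by auto
    then have "G \<noteq> UNIV" using rU Suc.prems by auto
    then have G': "G \<in> insert {} \<F>" using G(1) by blast
    note U = upper_mem[OF \<F> G']
    have "?r G < ?r (upper \<F> G)" using flat_rank_less[OF M _ U(2)] fl G' by blast
    then have "?r (upper \<F> G) = Suc j" using gap[OF G'] G(2) by simp
    then show ?case using U(1) by blast
  qed
  then have "{..matroid_rank M} \<subseteq> ?r ` ?R" by (auto simp: image_iff)
  then have "card {..matroid_rank M} \<le> card (?r ` ?R)" by (intro card_mono) auto
  also have "\<dots> \<le> card ?R" by (rule card_image_le) simp
  also have "\<dots> \<le> card \<F> + 2" using card_insert_le_m1 by (simp add: card_insert_if)
  finally show False using card by simp
qed

lemma flat_closure: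
  fixes M :: "'e::finite matroid"
  assumes M: "M \<in> Mat"
  defines "cl \<equiv> \<lambda>A. {x. rank_on M (insert x A) = rank_on M A}"
  shows "rank_on M (cl A) = rank_on M A" "cl A \<in> flats M"
  using rank_closure[of UNIV A "rank_on M"] rank_mono[OF Mat_is_matroid[OF M]]
    rank_insert_submod[OF Mat_is_matroid[OF M]]
  unfolding cl_def flats_iff[OF M] by auto

text \<open>In a gap of rank at least 2, the closure of \<open>G\<close> with one further element of
  the gap is a flat strictly in between, so a short chain of flats can be lengthened.\<close>

lemma pure_chain_fan_flats:
  fixes M :: "'e::finite matroid"
  assumes M: "M \<in> Mat" and ll: "loopless M" and k: "k < matroid_rank M"
  shows "pure_fan k (chain_fan (flats M) k)"
proof (rule pure_chain_fanI)
  note mat = Mat_is_matroid[OF M]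
  let ?r = "rank_on M"
  fix \<F> assume \<F>: "proper_chain \<F>" "\<F> \<subseteq> flats M" "card \<F> < k"
  then have fl: "insert {} \<F> \<subseteq> flats M" using loopless_empty_flat[OF M ll] by blast
  obtain G where G: "G \<in> insert {} \<F>" "?r G + 1 < ?r (upper \<F> G)"
    using chain_rank_gap[OF M \<F>(1) fl] \<F>(3) k by auto
  note U = upper_mem[OF \<F>(1) G(1)]
  obtain x where x: "x \<in> upper \<F> G" "x \<notin> G" using U(2) by blast
  define F where "F = {y. ?r (insert y (insert x G)) = ?r (insert x G)}"
  have F: "?r F = ?r (insert x G)" "F \<in> flats M" unfolding F_def using flat_closure[OF M] by blast+
  have "insert x G \<subseteq> F"
  proof
    fix y assume "y \<in> insert x G"
    then show "y \<in> F" unfolding F_def by (simp add: insert_absorb)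
  qed
  then have "G \<subset> F" using x(2) by auto
  moreover have "F \<subseteq> upper \<F> G"
  proof
    fix y assume "y \<in> F"
    then have eq: "?r (insert y (insert x G)) = ?r (insert x G)" unfolding F_def by simp
    have "insert x G \<subseteq> upper \<F> G" using x(1) U(2) by blast
    then have "?r (insert y (upper \<F> G)) = ?r (upper \<F> G)" using eq by (rule rank_insert_submod[OF mat])
    moreover have "upper \<F> G = UNIV \<or> upper \<F> G \<in> flats M" using U(1) \<F>(2) by blast
    ultimately show "y \<in> upper \<F> G" unfolding flats_iff[OF M] by (metis UNIV_I less_irrefl)
  qed
  moreover have "F \<noteq> upper \<F> G" using F(1) G(2) rank_insert_le[OF mat, of x G] by auto
  ultimately have "G \<subset> F" "F \<subset> upper \<F> G" by auto
  then show "\<exists>F. F \<notin> \<F> \<and> F \<in> flats M \<and> proper_chain (insert F \<F>)"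
    using chain_insert[OF \<F>(1) G(1)] F(2) by blast
qed

lemma bergman_skeleton_eq:
  fixes M :: "'e::finite matroid"
  assumes M: "M \<in> Mat"
  shows "bergman_skeleton k M = chain_fan (flats M) k"
proof (rule equalityI; rule subsetI)
  fix \<sigma> assume "\<sigma> \<in> bergman_skeleton k M"
  then obtain Fs where Fs: "\<sigma> = chain_cone Fs" "flat_chain M Fs" "length Fs \<le> k"
    unfolding bergman_skeleton_def by blast
  then have s: "sorted_wrt (\<subset>) ({} # Fs @ [UNIV])" "set Fs \<subseteq> flats M"
    unfolding flat_chain_def by (auto simp only: Mat_ground[OF M])
  show "\<sigma> \<in> chain_fan (flats M) k"
    unfolding chain_fan_def using Fs s sorted_chain_proper[OF s(1)] chain_cone_eq_cone_of[of Fs] by auto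
next
  fix \<sigma> assume "\<sigma> \<in> chain_fan (flats M) k"
  then obtain \<F> where \<F>: "\<sigma> = cone_of \<F>" "proper_chain \<F>" "\<F> \<subseteq> flats M" "card \<F> \<le> k"
    unfolding chain_fan_def by blast
  obtain Fs where Fs: "set Fs = \<F>" "sorted_wrt (\<subset>) ({} # Fs @ [UNIV])"
    using proper_chain_sorted_list[OF \<F>(2)] by blast
  then have "flat_chain M Fs" unfolding flat_chain_def Mat_ground[OF M] using \<F>(3) by blast
  moreover have "length Fs \<le> k" using sorted_chain_proper(2)[OF Fs(2)] Fs(1) \<F>(4) by simp
  moreover have "\<sigma> = chain_cone Fs" using \<F>(1) Fs(1) chain_cone_eq_cone_of by blast
  ultimately show "\<sigma> \<in> bergman_skeleton k M" unfolding bergman_skeleton_def by blast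
qed

lemma csm_weight_eq:
  fixes M :: "'e::finite matroid"
  assumes M: "M \<in> Mat" and \<F>: "proper_chain \<F>" "\<F> \<subseteq> flats M" "card \<F> = k" and k: "k < matroid_rank M"
  shows "csm_weight k M (cone_of \<F>) = chain_wt (\<lambda>A. int (rank_on M A)) \<F>"
proof -
  obtain Fs where Fs: "set Fs = \<F>" "sorted_wrt (\<subset>) ({} # Fs @ [UNIV])"
    using proper_chain_sorted_list[OF \<F>(1)] by blast
  have len: "length Fs = k" using sorted_chain_proper(2)[OF Fs(2)] Fs(1) \<F>(3) by simp
  have "(THE Fs. flat_chain M Fs \<and> length Fs = k \<and> chain_cone Fs = cone_of \<F>) = Fs"
  proof (rule the_equality)
    show "flat_chain M Fs \<and> length Fs = k \<and> chain_cone Fs = cone_of \<F>"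
      unfolding flat_chain_def Mat_ground[OF M] chain_cone_eq_cone_of using Fs \<F>(2) len by blast
    fix Fs' assume *: "flat_chain M Fs' \<and> length Fs' = k \<and> chain_cone Fs' = cone_of \<F>"
    then have s: "sorted_wrt (\<subset>) ({} # Fs' @ [UNIV])" "cone_of (set Fs') = cone_of \<F>"
      unfolding flat_chain_def Mat_ground[OF M] chain_cone_eq_cone_of by blast+
    have "set Fs' = set Fs"
      using cone_of_inj[OF sorted_chain_proper(1)[OF s(1)] \<F>(1) s(2)] Fs(1) by simp
    then show "Fs' = Fs"
      using s(1) Fs(2) unfolding sorted_chain_iff by (intro strict_chain_list_unique) auto
  qed
  then show ?thesis unfolding csm_weight_def using chain_weight_eq[OF M Fs(2)] len k Fs(1) by simp
qed

definition cone_weight :: "('e::finite set \<Rightarrow> int) \<Rightarrow> 'e tspace set \<Rightarrow> int" where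
  "cone_weight r \<sigma> = chain_wt r (THE \<F>. proper_chain \<F> \<and> cone_of \<F> = \<sigma>)"

lemma cone_weight_cone_of: "proper_chain \<F> \<Longrightarrow> cone_weight r (cone_of \<F>) = chain_wt r \<F>"
proof -
  assume \<F>: "proper_chain \<F>"
  have "(THE \<F>'. proper_chain \<F>' \<and> cone_of \<F>' = cone_of \<F>) = \<F>"
    by (rule the_equality) (use \<F> cone_of_inj in blast)+
  then show ?thesis unfolding cone_weight_def by simp
qed

text \<open>All CSM cycles live on the \<open>k\<close>-skeleton of the braid fan, which is pure of
  dimension \<open>k\<close> only for \<open>k < n + 1\<close>.\<close>

definition braid_fan :: "nat \<Rightarrow> 'e::finite tspace set set" where
  "braid_fan k = (if k < CARD('e) then chain_fan UNIV k else {})"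

text \<open>Balancing with the normals fixed to be rays. \<open>balanced\<close> lets the normals
  vary with the weight, whereas this condition is linear and evidently closed under sums and
  negatives.\<close>

definition braid_weights :: "nat \<Rightarrow> ('e::finite tspace set \<Rightarrow> int) set" where
  "braid_weights k = {\<omega>. \<forall>\<G>. proper_chain \<G> \<and> card \<G> + 1 = k \<longrightarrow>
     (\<Sum>F\<in>{F. F \<notin> \<G> \<and> proper_chain (insert F \<G>)}. of_int (\<omega> (cone_of (insert F \<G>))) *\<^sub>R ray F)
       \<in> span (ray ` \<G>)}"

text \<open>All subsets are flats of the free matroid, so the braid fan is a Bergman fan and
  inherits purity.\<close>

lemma free_matroid:
  defines "M \<equiv> \<lparr>ground = UNIV, bases = {UNIV :: 'e::finite set}\<rparr>"
  shows "M \<in> Mat" "loopless M" "matroid_rank M = CARD('e)" "flats M = UNIV"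
proof -
  have r: "rank_on M A = card A" for A by (simp add: rank_on_def M_def)
  show "M \<in> Mat" by (simp add: M_def Mat_def is_matroid_def)
  show "loopless M" by (simp add: loopless_def M_def)
  show "matroid_rank M = CARD('e)" by (simp add: matroid_rank_def r) (simp add: M_def)
  show "flats M = UNIV" by (auto simp: flats_def r) (simp_all add: M_def)
qed

lemma tropical_braid_fan:
  fixes \<omega> :: "'e::finite tspace set \<Rightarrow> int"
  assumes "\<omega> \<in> braid_weights k"
  shows "tropical_fan tlattice k (braid_fan k, \<omega>)"
proof (cases "k < CARD('e)")
  case True
  have "pure_fan k (chain_fan (UNIV :: 'e set set) k)"
  proof -
    let ?M = "\<lparr>ground = UNIV, bases = {UNIV :: 'e set}\<rparr>"
    have "pure_fan k (chain_fan (flats ?M) k)"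
      by (rule pure_chain_fan_flats) (use True free_matroid[where 'e = 'e] in simp_all)
    then show ?thesis by (simp add: free_matroid(4))
  qed
  moreover have "balanced tlattice k (chain_fan (UNIV :: 'e set set) k, \<omega>)"
    by (rule balanced_chain_fan) (use assms in \<open>auto simp: braid_weights_def\<close>)
  ultimately show ?thesis
    unfolding tropical_fan_def braid_fan_def using True rational_chain_fan by simp
next
  case False
  then show ?thesis unfolding braid_fan_def by (simp add: tropical_fan_empty)
qed

lemma fixed_fan_cycles_braid:
  "fixed_fan_cycles tlattice k (braid_fan k :: 'e::finite tspace set set) (braid_weights k)"
proof
  fix \<alpha> \<beta> :: "'e tspace set \<Rightarrow> int"
  show "\<alpha> \<in> braid_weights k \<Longrightarrow> tropical_fan tlattice k (braid_fan k, \<alpha>)" by (rule tropical_braid_fan)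
  show "(\<lambda>_. 0) \<in> (braid_weights k :: ('e tspace set \<Rightarrow> int) set)"
    unfolding braid_weights_def by (simp add: span_zero)
  show "(\<lambda>\<sigma>. \<alpha> \<sigma> + \<beta> \<sigma>) \<in> braid_weights k" if "\<alpha> \<in> braid_weights k" "\<beta> \<in> braid_weights k"
    using that unfolding braid_weights_def
    by (auto simp: scaleR_add_left sum.distrib intro!: span_add)
  show "(\<lambda>\<sigma>. - \<alpha> \<sigma>) \<in> braid_weights k" if "\<alpha> \<in> braid_weights k"
    using that unfolding braid_weights_def
    by (auto simp: sum_negf intro!: span_neg)
qed

lemma rank_step:
  assumes "M \<in> Mat"
  shows "int (rank_on M (insert e A)) = int (rank_on M A) \<or>
    int (rank_on M (insert e A)) = int (rank_on M A) + 1"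
  using rank_insert_le[OF Mat_is_matroid[OF assms], of e A]
    rank_mono[OF Mat_is_matroid[OF assms], of A "insert e A"] by (auto simp: subset_insertI)

lemma cone_weight_braid:
  fixes M :: "'e::finite matroid"
  assumes M: "M \<in> Mat"
  shows "cone_weight (\<lambda>A. int (rank_on M A)) \<in> braid_weights k"
  unfolding braid_weights_def
proof (intro CollectI allI impI)
  fix \<G> :: "'e set set" assume \<G>: "proper_chain \<G> \<and> card \<G> + 1 = k"
  let ?r = "\<lambda>A. int (rank_on M A)" and ?I = "{F. F \<notin> \<G> \<and> proper_chain (insert F \<G>)}"
  have "(\<Sum>F\<in>?I. of_int (cone_weight ?r (cone_of (insert F \<G>))) *\<^sub>R ray F) =
      (\<Sum>F\<in>?I. of_int (chain_wt ?r (insert F \<G>)) *\<^sub>R ray F)"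
    by (rule sum.cong[OF refl]) (simp add: cone_weight_cone_of)
  also have "\<dots> \<in> span (ray ` \<G>)"
    by (rule chain_wt_balanced) (use \<G> rank_step[OF M] in blast)+
  finally show "(\<Sum>F\<in>?I. of_int (cone_weight ?r (cone_of (insert F \<G>))) *\<^sub>R ray F) \<in> span (ray ` \<G>)" .
qed

lemma tropical_bergman_skeleton:
  fixes M :: "'e::finite matroid"
  assumes M: "M \<in> Mat" and ll: "loopless M" and k: "k < matroid_rank M"
  shows "tropical_fan tlattice k (bergman_skeleton k M, csm_weight k M)"
  unfolding tropical_fan_def bergman_skeleton_eq[OF M] fst_conv
proof (intro conjI rational_chain_fan pure_chain_fan_flats[OF M ll k] balanced_chain_fan)
  let ?r = "\<lambda>A. int (rank_on M A)"
  fix \<G> assume \<G>: "proper_chain \<G>" "\<G> \<subseteq> flats M" "card \<G> + 1 = k"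
  let ?I = "{F \<in> flats M. F \<notin> \<G> \<and> proper_chain (insert F \<G>)}"
  have "(\<Sum>F\<in>?I. of_int (csm_weight k M (cone_of (insert F \<G>))) *\<^sub>R ray F) =
      (\<Sum>F\<in>?I. of_int (chain_wt ?r (insert F \<G>)) *\<^sub>R ray F)"
  proof (rule sum.cong[OF refl])
    fix F assume F: "F \<in> ?I"
    have "csm_weight k M (cone_of (insert F \<G>)) = chain_wt ?r (insert F \<G>)"
      by (rule csm_weight_eq[OF M]) (use F \<G> k in auto)
    then show "of_int (csm_weight k M (cone_of (insert F \<G>))) *\<^sub>R ray F =
        of_int (chain_wt ?r (insert F \<G>)) *\<^sub>R ray F" by simp
  qed
  \<comment> \<open>Chains with a member that is not a flat have weight zero, so the sum extends to
    all insertable sets, where balancing is known.\<close>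
  also have "\<dots> = (\<Sum>F\<in>{F. F \<notin> \<G> \<and> proper_chain (insert F \<G>)}. of_int (chain_wt ?r (insert F \<G>)) *\<^sub>R ray F)"
  proof (rule sum.mono_neutral_left)
    show "\<forall>F\<in>{F. F \<notin> \<G> \<and> proper_chain (insert F \<G>)} - ?I. of_int (chain_wt ?r (insert F \<G>)) *\<^sub>R ray F = 0"
    proof
      fix F assume F: "F \<in> {F. F \<notin> \<G> \<and> proper_chain (insert F \<G>)} - ?I"
      then have "proper_chain (insert F \<G>)" "F \<notin> flats M" by auto
      then have "chain_wt ?r (insert F \<G>) = 0" using chain_wt_nonzero(1)[OF M] by blast
      then show "of_int (chain_wt ?r (insert F \<G>)) *\<^sub>R ray F = 0" by simp
    qed
  qed auto
  also have "\<dots> \<in> span (ray ` \<G>)" using \<G>(1) rank_step[OF M] by (rule chain_wt_balanced)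
  finally show "(\<Sum>F\<in>?I. of_int (csm_weight k M (cone_of (insert F \<G>))) *\<^sub>R ray F) \<in> span (ray ` \<G>)" .
qed

text \<open>Extending the weights by zero from chains of flats to all chains does not change the
  class. In the cases where \<open>csm\<close> is the zero cycle by definition, every chain of
  length \<open>k\<close> has weight zero.\<close>

lemma csm_eq_braid:
  fixes M :: "'e::finite matroid"
  assumes M: "M \<in> Mat"
  shows "csm k M = cycle_class tlattice k (braid_fan k, cone_weight (\<lambda>A. int (rank_on M A)))"
proof -
  interpret fixed_fan_cycles tlattice k "braid_fan k :: 'e tspace set set" "braid_weights k"
    by (rule fixed_fan_cycles_braid)
  let ?r = "\<lambda>A. int (rank_on M A)"
  note trop_braid = tropical_braid_fan[OF cone_weight_braid[OF M], of k]
  obtain B where B: "B \<in> bases M" using is_matroid_finite(2)[OF Mat_is_matroid[OF M]] by blast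
  have "matroid_rank M = card B"
    unfolding matroid_rank_def using rank_on_ground[OF Mat_is_matroid[OF M] B] .
  then have rank: "matroid_rank M \<le> CARD('e)" by (simp add: card_mono)
  have top: "\<exists>\<F>. \<sigma> = cone_of \<F> \<and> proper_chain \<F> \<and> card \<F> = k \<and> k < CARD('e)"
    if "\<sigma> \<in> top_cones k (braid_fan k)" for \<sigma> :: "'e tspace set"
  proof (cases "k < CARD('e)")
    case True
    then show ?thesis using that unfolding braid_fan_def by (auto simp: top_cones_chain_fan)
  next
    case False
    then show ?thesis using that unfolding braid_fan_def by (simp add: top_cones_def)
  qed
  show ?thesis
  proof (cases "loopless M \<and> k < matroid_rank M")
    case False
    have "cone_weight ?r \<sigma> = 0" if "\<sigma> \<in> top_cones k (braid_fan k)" for \<sigma>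
      using top[OF that] False chain_wt_nonzero(2,3)[OF M] cone_weight_cone_of by metis
    then have "((braid_fan k, cone_weight ?r), ({}, \<lambda>_. 0)) \<in> fan_equiv tlattice k"
      unfolding fan_equiv_empty_iff using trop_braid by simp
    then have "cl (cone_weight ?r) = zero_cycle tlattice k" unfolding zero_cycle_def by (rule class_eq)
    then show ?thesis using False unfolding csm_def by auto
  next
    case True
    let ?X = "(bergman_skeleton k M, csm_weight k M)" and ?Y = "(braid_fan k :: 'e tspace set set, cone_weight ?r)"
    have kc: "k < CARD('e)" using True rank by simp
    have braid: "braid_fan k = chain_fan (UNIV :: 'e set set) k" unfolding braid_fan_def using kc by simp
    have wt: "csm_weight k M (cone_of \<F>) = cone_weight ?r (cone_of \<F>)"
      if "proper_chain \<F>" "\<F> \<subseteq> flats M" "card \<F> = k" for \<F>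
      using csm_weight_eq[OF M that] True cone_weight_cone_of[OF that(1)] by simp
    have topX: "top_cones k (fst ?X) = {cone_of \<F> |\<F>. proper_chain \<F> \<and> \<F> \<subseteq> flats M \<and> card \<F> = k}"
      unfolding fst_conv bergman_skeleton_eq[OF M] by (rule top_cones_chain_fan)
    have topY: "top_cones k (fst ?Y) = {cone_of \<F> |\<F>. proper_chain \<F> \<and> card \<F> = k}"
      unfolding fst_conv braid top_cones_chain_fan by simp
    have sub: "top_cones k (fst ?X) \<subseteq> top_cones k (fst ?Y)" unfolding topX topY by blast
    have "fan_support k ?X = fan_support k ?Y"
      unfolding support_iff
    proof (rule arg_cong[of _ _ Union], rule equalityI; rule subsetI)
      fix \<sigma> assume "\<sigma> \<in> {\<sigma> \<in> top_cones k (fst ?X). snd ?X \<sigma> \<noteq> 0}"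
      then show "\<sigma> \<in> {\<sigma> \<in> top_cones k (fst ?Y). snd ?Y \<sigma> \<noteq> 0}"
        using sub wt unfolding topX by auto
    next
      fix \<sigma> assume "\<sigma> \<in> {\<sigma> \<in> top_cones k (fst ?Y). snd ?Y \<sigma> \<noteq> 0}"
      then obtain \<F> where \<F>: "\<sigma> = cone_of \<F>" "proper_chain \<F>" "card \<F> = k" "cone_weight ?r \<sigma> \<noteq> 0"
        unfolding topY by auto
      then have "\<F> \<subseteq> flats M" using chain_wt_nonzero(1)[OF M \<F>(2)] cone_weight_cone_of[OF \<F>(2)] by simp
      then show "\<sigma> \<in> {\<sigma> \<in> top_cones k (fst ?X). snd ?X \<sigma> \<noteq> 0}"
        unfolding topX using \<F> wt by auto
    qed
    moreover have "snd ?X \<sigma> = snd ?Y \<tau>"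
      if "\<sigma> \<in> top_cones k (fst ?X)" "\<tau> \<in> top_cones k (fst ?Y)" "dim (\<sigma> \<inter> \<tau>) = k" for \<sigma> \<tau>
    proof -
      have "\<sigma> = \<tau>"
        using top_cones_overlap_eq[OF rational_chain_fan, of \<sigma> k UNIV k \<tau>] that sub
        unfolding fst_conv braid by blast
      then show ?thesis using that(1) wt unfolding topX by auto
    qed
    ultimately have "(?X, ?Y) \<in> fan_equiv tlattice k"
      using tropical_bergman_skeleton[OF M, of k] True trop_braid unfolding fan_equiv_def by blast
    then have "cycle_class tlattice k ?X = cycle_class tlattice k ?Y" by (rule class_eq)
    then show ?thesis using True unfolding csm_def by simp
  qed
qed

section \<open>Valuativity\<close>

lemma polytope_matroid_polytope: "M \<in> Mat \<Longrightarrow> polytope (matroid_polytope M)"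
  unfolding matroid_polytope_def polytope_def
  using is_matroid_finite(3)[OF Mat_is_matroid] by blast

lemma e_vec_in_matroid_polytope:
  fixes M :: "'e::finite matroid"
  shows "e_vec B \<in> matroid_polytope M \<longleftrightarrow> B \<in> bases M"
proof
  assume "B \<in> bases M"
  then show "e_vec B \<in> matroid_polytope M" unfolding matroid_polytope_def by (intro hull_inc) simp
next
  assume B: "e_vec B \<in> matroid_polytope M"
  \<comment> \<open>Among 0/1 vectors this functional is maximal at \<open>e_vec B\<close> only, and
    drops by at least 1 elsewhere, so it separates \<open>e_vec B\<close> from the other
    vertices.\<close>
  define w :: "real ^ 'e" where "w = (\<chi> i. if i \<in> B then 1 else -1)"
  have inner: "w \<bullet> e_vec A = (\<Sum>i\<in>UNIV. (if i \<in> B then 1 else -1) * of_bool (i \<in> A))" for A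
    by (simp add: inner_vec_def w_def)
  have wB: "w \<bullet> e_vec B = (\<Sum>i\<in>UNIV. of_bool (i \<in> B))"
    unfolding inner by (rule sum.cong) auto
  show "B \<in> bases M"
  proof (rule ccontr)
    assume nB: "B \<notin> bases M"
    have "w \<bullet> e_vec A \<le> w \<bullet> e_vec B - 1" if A: "A \<in> bases M" for A
    proof -
      have "A \<noteq> B" using A nB by blast
      then obtain i where i: "(i \<in> A) \<noteq> (i \<in> B)" by blast
      let ?t = "\<lambda>i. of_bool (i \<in> B) - (if i \<in> B then 1 else -1) * of_bool (i \<in> A) :: real"
      have "?t i \<le> (\<Sum>i\<in>UNIV. ?t i)" by (rule member_le_sum) auto
      moreover have "?t i = 1" using i by auto
      moreover have "(\<Sum>i\<in>UNIV. ?t i) = w \<bullet> e_vec B - w \<bullet> e_vec A"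
        unfolding wB unfolding inner by (rule sum_subtractf)
      ultimately show ?thesis by linarith
    qed
    then have "matroid_polytope M \<subseteq> {x. w \<bullet> x \<le> w \<bullet> e_vec B - 1}"
      unfolding matroid_polytope_def
      by (intro hull_minimal convex_halfspace_le) auto
    then show False using B by auto
  qed
qed

lemma matroid_polytope_inj:
  assumes "M \<in> Mat" "N \<in> Mat" "matroid_polytope M = matroid_polytope N"
  shows "M = N"
proof (rule matroid.equality)
  show "ground M = ground N" using Mat_ground assms by metis
  show "bases M = bases N" using e_vec_in_matroid_polytope assms(3) by blast
qed simp

lemma matroid_of_polytope: "M \<in> Mat \<Longrightarrow> matroid_of (matroid_polytope M) = M"
  unfolding matroid_of_def by (rule the_equality) (auto intro: matroid_polytope_inj)

text \<open>Symmetric exchange keeps the midpoint of two vertices. If both lie in the face, the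
  midpoint does, and the face then contains the exchanged vertices as well; thus the bases whose
  vertices lie in the face satisfy exchange.\<close>

lemma face_of_matroid_polytope:
  fixes N :: "'e::finite matroid"
  assumes N: "N \<in> Mat" and F: "F face_of matroid_polytope N" "F \<noteq> {}"
  shows "\<exists>M\<in>Mat. matroid_polytope M = F"
proof -
  note mat = Mat_is_matroid[OF N]
  define M where "M = \<lparr>ground = UNIV, bases = {B \<in> bases N. e_vec B \<in> F}\<rparr>"
  have "compact (e_vec ` bases N)" using is_matroid_finite(3)[OF mat] by (intro finite_imp_compact) simp
  then obtain S' where S': "S' \<subseteq> e_vec ` bases N" "F = convex hull S'"
    using F(1) unfolding matroid_polytope_def by (rule face_of_convex_hull_subset)
  have convF: "convex F" using F(1) by (rule face_of_imp_convex)
  have eq: "matroid_polytope M = F"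
  proof (rule equalityI)
    show "matroid_polytope M \<subseteq> F" unfolding matroid_polytope_def M_def
      by (rule hull_minimal) (use convF in auto)
    have "S' \<subseteq> e_vec ` bases M"
    proof
      fix v assume v: "v \<in> S'"
      then obtain B where B: "B \<in> bases N" "v = e_vec B" using S'(1) by blast
      moreover have "v \<in> F" unfolding S'(2) using v by (rule hull_inc)
      ultimately show "v \<in> e_vec ` bases M" unfolding M_def by auto
    qed
    then show "F \<subseteq> matroid_polytope M" unfolding matroid_polytope_def S'(2) by (rule hull_mono)
  qed
  have exchange: "\<exists>y\<in>B - A. insert y (A - {x}) \<in> bases M"
    if AB: "A \<in> bases M" "B \<in> bases M" and x: "x \<in> A - B" for A B x
  proof -
    have A: "A \<in> bases N" "e_vec A \<in> F" and B: "B \<in> bases N" "e_vec B \<in> F" using AB unfolding M_def by auto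
    obtain y where y: "y \<in> B - A" "insert y (A - {x}) \<in> bases N" "insert x (B - {y}) \<in> bases N"
      using symmetric_exchange[OF mat A(1) B(1) x] by blast
    let ?A = "insert y (A - {x})" and ?B = "insert x (B - {y})"
    have in_poly: "e_vec ?A \<in> matroid_polytope N" "e_vec ?B \<in> matroid_polytope N"
      using y unfolding e_vec_in_matroid_polytope by auto
    have sum: "e_vec ?A + e_vec ?B = e_vec A + e_vec B"
    proof (rule vec_eq_iff[THEN iffD2], rule allI)
      fix i show "(e_vec ?A + e_vec ?B) $ i = (e_vec A + e_vec B) $ i"
        using x y(1) by (cases "i = x"; cases "i = y") auto
    qed
    have "(1/2) *\<^sub>R e_vec A + (1/2) *\<^sub>R e_vec B \<in> F" using convexD[OF convF A(2) B(2), of "1/2" "1/2"] by simp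
    moreover have "(1/2) *\<^sub>R e_vec A + (1/2) *\<^sub>R e_vec B = (1/2) *\<^sub>R e_vec ?A + (1/2) *\<^sub>R e_vec ?B"
      using sum by (simp only: scaleR_add_right[symmetric])
    ultimately have mid: "(1/2) *\<^sub>R e_vec ?A + (1/2) *\<^sub>R e_vec ?B \<in> F" by simp
    have "e_vec ?A \<in> F"
    \<comment> \<open>When the exchanged vertices coincide, their open segment is empty, but the
      midpoint is already the vertex.\<close>
    proof (cases "e_vec ?A = e_vec ?B")
      case True
      then show ?thesis using mid by (simp add: scaleR_add_left[symmetric])
    next
      case False
      then have "(1/2) *\<^sub>R e_vec ?A + (1/2) *\<^sub>R e_vec ?B \<in> open_segment (e_vec ?A) (e_vec ?B)"
        unfolding in_segment by (intro conjI exI[of _ "1/2"]) auto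
      then show ?thesis using F(1) in_poly mid unfolding face_of_def by blast
    qed
    then have "?A \<in> bases M" using y(2) unfolding M_def by simp
    then show ?thesis using y(1) by blast
  qed
  have "bases M \<noteq> {}" using F(2) unfolding eq[symmetric] matroid_polytope_def by auto
  then have "is_matroid M" unfolding is_matroid_def
    using exchange by (auto simp: M_def)
  then have "M \<in> Mat" unfolding Mat_def by (simp add: M_def)
  then show ?thesis using eq by blast
qed

lemma matroid_polytope_sum_le:
  fixes M :: "'e::finite matroid"
  assumes M: "M \<in> Mat" and x: "x \<in> matroid_polytope M"
  shows "(\<Sum>i\<in>A. x $ i) \<le> real (rank_on M A)"
proof -
  have eq: "(\<Sum>i\<in>A. x $ i) = e_vec A \<bullet> x" for x :: "real ^ 'e"
    by (simp add: inner_vec_def of_bool_def if_distrib[of "\<lambda>c. c * _"] sum.If_cases cong: if_cong)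
  have "e_vec A \<bullet> e_vec B \<le> real (rank_on M A)" if B: "B \<in> bases M" for B
  proof -
    have "e_vec A \<bullet> e_vec B = real (card (A \<inter> B))"
      unfolding eq[symmetric] by (simp add: of_bool_def sum.If_cases)
    then show ?thesis using rank_ge[OF Mat_is_matroid[OF M] B, of A] by simp
  qed
  then have "matroid_polytope M \<subseteq> {x. e_vec A \<bullet> x \<le> real (rank_on M A)}"
    unfolding matroid_polytope_def by (intro hull_minimal convex_halfspace_le) auto
  then show ?thesis unfolding eq using x by blast
qed

text \<open>Since the ranks of a chain of sets are attained by a common basis, a conjunction of lower
  bounds for them is a condition on the matroid polytope alone.\<close>

lemma chain_rank_bounds_iff:
  fixes M :: "'e::finite matroid" and A :: "'i \<Rightarrow> 'e set" and s :: "'i \<Rightarrow> nat"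
  assumes M: "M \<in> Mat" and I: "finite I" and chain: "\<And>i j. i \<in> I \<Longrightarrow> j \<in> I \<Longrightarrow> A i \<subseteq> A j \<or> A j \<subseteq> A i"
  shows "(\<forall>i\<in>I. s i \<le> rank_on M (A i)) \<longleftrightarrow>
    matroid_polytope M \<inter> {x. \<forall>i\<in>I. real (s i) - 1 < (\<Sum>j\<in>A i. x $ j)} \<noteq> {}"
proof
  assume s: "\<forall>i\<in>I. s i \<le> rank_on M (A i)"
  obtain B where B: "B \<in> bases M" "\<forall>X\<in>A ` I. card (X \<inter> B) = rank_on M X"
    using chain_basis[OF Mat_is_matroid[OF M], of "A ` I"] I chain by auto
  have "real (s i) - 1 < (\<Sum>j\<in>A i. e_vec B $ j)" if "i \<in> I" for i
  proof -
    have "(\<Sum>j\<in>A i. e_vec B $ j) = real (card (A i \<inter> B))" by (simp add: of_bool_def sum.If_cases)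
    moreover have "s i \<le> card (A i \<inter> B)" using s B(2) that by auto
    ultimately show ?thesis by simp
  qed
  then have "e_vec B \<in> matroid_polytope M \<inter> {x. \<forall>i\<in>I. real (s i) - 1 < (\<Sum>j\<in>A i. x $ j)}"
    using e_vec_in_matroid_polytope[THEN iffD2, OF B(1)] by blast
  then show "matroid_polytope M \<inter> {x. \<forall>i\<in>I. real (s i) - 1 < (\<Sum>j\<in>A i. x $ j)} \<noteq> {}" by blast
next
  assume "matroid_polytope M \<inter> {x. \<forall>i\<in>I. real (s i) - 1 < (\<Sum>j\<in>A i. x $ j)} \<noteq> {}"
  then obtain x where x: "x \<in> matroid_polytope M" "\<forall>i\<in>I. real (s i) - 1 < (\<Sum>j\<in>A i. x $ j)" by blast
  show "\<forall>i\<in>I. s i \<le> rank_on M (A i)"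
  proof
    fix i assume "i \<in> I"
    \<comment> \<open>Ranks are integers, so exceeding \<open>s i - 1\<close> is reaching
      \<open>s i\<close>; the strict form is what makes the region open.\<close>
    then have "real (s i) - 1 < real (rank_on M (A i))"
      using x(2) matroid_polytope_sum_le[OF M x(1), of "A i"] by fastforce
    then show "s i \<le> rank_on M (A i)" by linarith
  qed
qed

lemma open_convex_bounds:
  fixes A :: "'i \<Rightarrow> 'e::finite set" and c :: "'i \<Rightarrow> real"
  assumes "finite I"
  shows "open {x :: real ^ 'e. \<forall>i\<in>I. c i < (\<Sum>j\<in>A i. x $ j)}"
    and "convex {x :: real ^ 'e. \<forall>i\<in>I. c i < (\<Sum>j\<in>A i. x $ j)}"
proof -
  have eq: "{x :: real ^ 'e. \<forall>i\<in>I. c i < (\<Sum>j\<in>A i. x $ j)} = (\<Inter>i\<in>I. {x. c i < e_vec (A i) \<bullet> x})"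
    by (auto simp: inner_vec_def of_bool_def if_distrib[of "\<lambda>c. c * _"] sum.If_cases cong: if_cong)
  show "open {x :: real ^ 'e. \<forall>i\<in>I. c i < (\<Sum>j\<in>A i. x $ j)}"
    unfolding eq using assms by (intro open_INT ballI) (auto simp: open_halfspace_gt)
  show "convex {x :: real ^ 'e. \<forall>i\<in>I. c i < (\<Sum>j\<in>A i. x $ j)}"
    unfolding eq by (intro convex_INT) (auto simp: convex_halfspace_gt)
qed

lemma rank_le_card_UNIV:
  fixes M :: "'e::finite matroid"
  assumes "M \<in> Mat" shows "rank_on M A \<le> CARD('e)"
  using rank_attained[OF Mat_is_matroid[OF assms], of A] by (metis card_mono finite subset_UNIV)

lemma prod_of_bool: "finite X \<Longrightarrow> (\<Prod>x\<in>X. of_bool (P x)) = (of_bool (\<forall>x\<in>X. P x) :: int)"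
  by (induction X rule: finite_induct) (auto simp: of_bool_def)

text \<open>After expansion a summand is indexed by a function \<open>g\<close> choosing, for every
  member \<open>F\<close> and for \<open>{}\<close>, a set in the gap above it and a threshold. Its
  coefficient \<open>D g\<close> and its region \<open>C g\<close> do not depend on the matroid, so
  the Euler relation applies to each summand separately.\<close>

lemma chain_wt_valuation:
  fixes M :: "'e::finite matroid"
  assumes M: "M \<in> Mat" and S: "polytope_subdivision S (matroid_polytope M)"
    and faces: "\<And>F. F \<in> interior_faces S (matroid_polytope M) \<Longrightarrow>
      matroid_of F \<in> Mat \<and> matroid_polytope (matroid_of F) = F"
    and \<F>: "proper_chain \<F>"
  shows "chain_wt (\<lambda>A. int (rank_on M A)) \<F> =
    (\<Sum>F\<in>interior_faces S (matroid_polytope M).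
      (-1) ^ nat (aff_dim (matroid_polytope M) - aff_dim F) *
      chain_wt (\<lambda>A. int (rank_on (matroid_of F) A)) \<F>)"
proof -
  let ?X = "insert {} \<F>" and ?N = "{1..CARD('e)}"
  let ?B = "\<lambda>F. {F..upper \<F> F} \<times> ?N"
  define C where "C g = {x :: real ^ 'e. \<forall>F\<in>?X. real (snd (g F)) - 1 < (\<Sum>j\<in>fst (g F). x $ j)}"
    for g :: "'e set \<Rightarrow> 'e set \<times> nat"
  define D where "D g = - ((-1) ^ card \<F>) * (\<Prod>F\<in>?X. (-1 :: int) ^ card F * (-1) ^ card (fst (g F)))"
    for g :: "'e set \<Rightarrow> 'e set \<times> nat"
  have expand: "chain_wt (\<lambda>A. int (rank_on N A)) \<F> =
      (\<Sum>g\<in>PiE ?X ?B. D g * of_bool (matroid_polytope N \<inter> C g \<noteq> {}))" if N: "N \<in> Mat" for N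
  proof -
    let ?b = "\<lambda>p. of_bool (snd p \<le> rank_on N (fst p)) :: int"
    \<comment> \<open>Thresholds range up to the size of the ground set, so that the index set is
      the same for all matroids.\<close>
    have rank: "int (rank_on N A) = (\<Sum>s\<in>?N. of_bool (s \<le> rank_on N A))" for A
    proof -
      have "(\<Sum>s\<in>?N. of_bool (s \<le> rank_on N A) :: int) = (\<Sum>s\<in>{1..rank_on N A}. 1)"
        by (rule sum.mono_neutral_cong_right) (use rank_le_card_UNIV[OF N, of A] in auto)
      then show ?thesis by simp
    qed
    have alt: "(-1) ^ card F * altsum (\<lambda>A. int (rank_on N A)) F (upper \<F> F) =
        (\<Sum>p\<in>?B F. ((-1) ^ card F * (-1) ^ card (fst p)) * ?b p)" for F
    proof -
      have "altsum (\<lambda>A. int (rank_on N A)) F (upper \<F> F) =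
          (\<Sum>A\<in>{F..upper \<F> F}. \<Sum>s\<in>?N. (-1) ^ card A * of_bool (s \<le> rank_on N A))"
        unfolding altsum_def rank sum_distrib_left ..
      also have "\<dots> = (\<Sum>p\<in>?B F. (-1) ^ card (fst p) * ?b p)"
        by (simp only: sum.cartesian_product case_prod_unfold)
      finally show ?thesis by (simp only: sum_distrib_left mult.assoc)
    qed
    have "(\<Prod>F\<in>?X. (-1) ^ card F * altsum (\<lambda>A. int (rank_on N A)) F (upper \<F> F)) =
        (\<Sum>g\<in>PiE ?X ?B. \<Prod>F\<in>?X. ((-1) ^ card F * (-1) ^ card (fst (g F))) * ?b (g F))"
      unfolding alt by (rule prod_sum_PiE) auto
    also have "\<dots> = (\<Sum>g\<in>PiE ?X ?B. (\<Prod>F\<in>?X. (-1) ^ card F * (-1) ^ card (fst (g F))) *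
        of_bool (matroid_polytope N \<inter> C g \<noteq> {}))"
    proof (rule sum.cong[OF refl])
      fix g assume g: "g \<in> PiE ?X ?B"
      have gF: "F \<subseteq> fst (g F)" "fst (g F) \<subseteq> upper \<F> F" if "F \<in> ?X" for F
        using PiE_mem[OF g that] by auto
      \<comment> \<open>A set chosen for \<open>F\<close> ends below the successor of
        \<open>F\<close>, where the choices for later members begin, so the chosen sets are
        nested.\<close>
      have chain: "fst (g F) \<subseteq> fst (g G) \<or> fst (g G) \<subseteq> fst (g F)" if FG: "F \<in> ?X" "G \<in> ?X" for F G
      proof -
        have aux: "fst (g F) \<subseteq> fst (g G)" if "F \<in> ?X" "G \<in> ?X" "F \<subset> G" for F G
        proof -
          have "upper \<F> F \<subseteq> G" using that by (intro upper_least) auto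
          then show ?thesis using gF[OF that(1)] gF[OF that(2)] by blast
        qed
        consider "F = G" | "F \<subset> G" | "G \<subset> F" using chain_comparable[OF \<F> FG(1)] FG(2) by blast
        then show ?thesis using aux FG by cases blast+
      qed
      have "(\<Prod>F\<in>?X. ?b (g F)) = of_bool (\<forall>F\<in>?X. snd (g F) \<le> rank_on N (fst (g F)))"
        by (rule prod_of_bool) simp
      also have "\<dots> = of_bool (matroid_polytope N \<inter> C g \<noteq> {})"
        unfolding C_def using chain_rank_bounds_iff[OF N, of ?X "\<lambda>F. fst (g F)" "\<lambda>F. snd (g F)"] chain by simp
      finally show "(\<Prod>F\<in>?X. ((-1) ^ card F * (-1) ^ card (fst (g F))) * ?b (g F)) =
          (\<Prod>F\<in>?X. (-1) ^ card F * (-1) ^ card (fst (g F))) * of_bool (matroid_polytope N \<inter> C g \<noteq> {})"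
        unfolding prod.distrib[of _ "\<lambda>F. ?b (g F)"] by simp
    qed
    finally show ?thesis unfolding chain_wt_def D_def by (simp add: sum_distrib_left mult.assoc)
  qed
  let ?\<F> = "interior_faces S (matroid_polytope M)"
  let ?s = "\<lambda>F. (-1 :: int) ^ nat (aff_dim (matroid_polytope M) - aff_dim F)"
  have "chain_wt (\<lambda>A. int (rank_on M A)) \<F> =
      (\<Sum>g\<in>PiE ?X ?B. D g * (\<Sum>F\<in>?\<F>. ?s F * of_bool (F \<inter> C g \<noteq> {})))"
    unfolding expand[OF M]
  proof (rule sum.cong[OF refl])
    fix g
    have "open (C g)" "convex (C g)" unfolding C_def by (rule open_convex_bounds, simp)+
    then show "D g * of_bool (matroid_polytope M \<inter> C g \<noteq> {}) =
        D g * (\<Sum>F\<in>?\<F>. ?s F * of_bool (F \<inter> C g \<noteq> {}))"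
      using subdivision_valuation[OF S polytope_matroid_polytope[OF M], of "C g"] by simp
  qed
  also have "\<dots> = (\<Sum>g\<in>PiE ?X ?B. \<Sum>F\<in>?\<F>. ?s F * (D g * of_bool (F \<inter> C g \<noteq> {})))"
    by (simp add: sum_distrib_left mult.left_commute)
  also have "\<dots> = (\<Sum>F\<in>?\<F>. \<Sum>g\<in>PiE ?X ?B. ?s F * (D g * of_bool (F \<inter> C g \<noteq> {})))"
    by (rule sum.swap)
  also have "\<dots> = (\<Sum>F\<in>?\<F>. ?s F * chain_wt (\<lambda>A. int (rank_on (matroid_of F) A)) \<F>)"
  proof (rule sum.cong[OF refl])
    fix F assume F: "F \<in> ?\<F>"
    show "(\<Sum>g\<in>PiE ?X ?B. ?s F * (D g * of_bool (F \<inter> C g \<noteq> {}))) =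
        ?s F * chain_wt (\<lambda>A. int (rank_on (matroid_of F) A)) \<F>"
      using expand[of "matroid_of F"] faces[OF F] by (simp add: sum_distrib_left)
  qed
  finally show ?thesis .
qed

theorem theorem4p5:
  fixes k :: nat
  shows "(csm k :: 'e::finite matroid \<Rightarrow> 'e tspace wfan set) \<in> Mat \<rightarrow> carrier (Z_group k)
    \<and> (\<forall>M\<in>(Mat :: 'e matroid set). \<forall>S. matroid_subdivision S (matroid_polytope M) \<longrightarrow>
         csm k M =
           finprod (Z_group k)
             (\<lambda>F. csm k (matroid_of F)
                    [^]\<^bsub>Z_group k\<^esub> ((-1) ^ nat (aff_dim (matroid_polytope M) - aff_dim F) :: int))
             (interior_faces S (matroid_polytope M)))"
proof (intro conjI ballI allI impI)
  interpret fixed_fan_cycles tlattice k "braid_fan k :: 'e tspace set set" "braid_weights k"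
    by (rule fixed_fan_cycles_braid)
  show "(csm k :: 'e matroid \<Rightarrow> 'e tspace wfan set) \<in> Mat \<rightarrow> carrier (Z_group k)"
    using csm_eq_braid cl_carrier[OF cone_weight_braid] by (metis Pi_I)
  fix M :: "'e matroid" and S assume M: "M \<in> Mat" and sub: "matroid_subdivision S (matroid_polytope M)"
  let ?Q = "matroid_polytope M"
  let ?w = "\<lambda>N. cone_weight (\<lambda>A. int (rank_on N A)) :: 'e tspace set \<Rightarrow> int"
  let ?s = "\<lambda>F. (-1 :: int) ^ nat (aff_dim ?Q - aff_dim F)"
  have S: "polytope_subdivision S ?Q" and poly: "\<And>P. P \<in> S \<Longrightarrow> \<exists>N\<in>Mat. P = matroid_polytope N"
    using sub unfolding matroid_subdivision_def by auto
  have faces: "matroid_of F \<in> Mat \<and> matroid_polytope (matroid_of F) = F" if F: "F \<in> interior_faces S ?Q" for F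
  proof -
    obtain P where P: "P \<in> S" "F face_of P" "F \<noteq> {}" using F unfolding interior_faces_def by blast
    obtain N where N: "N \<in> Mat" "P = matroid_polytope N" using poly[OF P(1)] by blast
    obtain M' where M': "M' \<in> Mat" "matroid_polytope M' = F"
      using face_of_matroid_polytope[OF N(1)] P(2,3) N(2) by blast
    show ?thesis using matroid_of_polytope[OF M'(1)] M' by simp
  qed
  have fin: "finite (interior_faces S ?Q)"
    using interior_face_sum(1)[OF S polytope_matroid_polytope[OF M]] .
  define \<alpha> where "\<alpha> F = (\<lambda>\<sigma>. ?s F * ?w (matroid_of F) \<sigma>)" for F
  have \<alpha>: "\<alpha> F \<in> braid_weights k \<and> csm k (matroid_of F) [^]\<^bsub>Z_group k\<^esub> ?s F = cl (\<alpha> F)"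
    if F: "F \<in> interior_faces S ?Q" for F
  proof -
    have N: "matroid_of F \<in> Mat" using faces[OF F] by blast
    note w = cone_weight_braid[OF N, of k]
    have "\<alpha> F \<in> braid_weights k"
      unfolding \<alpha>_def using w W_uminus[OF w] by (cases "even (nat (aff_dim ?Q - aff_dim F))") simp_all
    moreover have "csm k (matroid_of F) [^]\<^bsub>Z_group k\<^esub> ?s F = cl (\<alpha> F)"
      unfolding csm_eq_braid[OF N] \<alpha>_def by (rule cl_int_pow_sign[OF w])
    ultimately show ?thesis by blast
  qed
  have "finprod (Z_group k) (\<lambda>F. csm k (matroid_of F) [^]\<^bsub>Z_group k\<^esub> ?s F) (interior_faces S ?Q) =
      cl (\<lambda>\<sigma>. \<Sum>F\<in>interior_faces S ?Q. \<alpha> F \<sigma>)"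
    using fin \<alpha> by (rule finprod_cl)
  also have "\<dots> = cl (?w M)"
  proof (rule cl_cong)
    show "(\<lambda>\<sigma>. \<Sum>F\<in>interior_faces S ?Q. \<alpha> F \<sigma>) \<in> braid_weights k"
      by (rule W_sum[OF fin]) (use \<alpha> in blast)
    show "?w M \<in> braid_weights k" by (rule cone_weight_braid[OF M])
    \<comment> \<open>A class is determined by the weights of the top cones, each of which is the
      cone of a chain, so the identity for chain weights decides.\<close>
    fix \<sigma> :: "'e tspace set" assume "\<sigma> \<in> top_cones k (braid_fan k)"
    then obtain \<F> where \<F>: "\<sigma> = cone_of \<F>" "proper_chain \<F>"
      unfolding braid_fan_def by (auto simp: top_cones_chain_fan top_cones_def[of k "{}"] split: if_splits)
    show "(\<Sum>F\<in>interior_faces S ?Q. \<alpha> F \<sigma>) = ?w M \<sigma>"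
      unfolding \<alpha>_def \<F>(1) cone_weight_cone_of[OF \<F>(2)]
      using chain_wt_valuation[OF M S faces \<F>(2)] by simp
  qed
  finally show "csm k M = finprod (Z_group k)
      (\<lambda>F. csm k (matroid_of F) [^]\<^bsub>Z_group k\<^esub> ((-1) ^ nat (aff_dim ?Q - aff_dim F) :: int))
      (interior_faces S ?Q)"
    unfolding csm_eq_braid[OF M] by simp
qed

end
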